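(* Let $A$ be a $2\times 2$ real symmetric positive-semidefinite matrix and let $f:\mathbb{H}\times\mathbb{R}^2\to\mathbb{R}$ satisfy: (A1) there exists $L_1>0$ such that $|f(p,w_1)-f(p,w_2)|\le L_1|w_1-w_2|$ for all $p\in\mathbb{H}$, $w_1,w_2\in\mathbb{R}^2$; (A2) for every $\rho>0$ there exists $L_2(\rho)>0$ such that $|f(p,w)-f(q,w)|\le L_2(\rho)\,|p\cdot q^{-1}|_G$ for all $p,q\in\mathbb{H}$ with $|p|,|q|\le\rho$ and all $w\in\mathbb{R}^2$; (A3) there exists $C_f>0$ such that $|f(p,\xi)|\le C_f(1+|\xi|)$ for all $p\in\mathbb{H}$, $\xi\in\mathbb{R}^2$. Let $u\in C(\mathbb{H}\times[0,\infty))$ be the unique viscosity solution of $$u_t-\operatorname{tr}\left(A(\nabla_H^2u)^\ast\right)+f(p,\nabla_Hu)=0\ \text{ in }\mathbb{H}\times(0,\infty),\qquad u(\cdot,0)=u_0\ \text{ in }\mathbb{H},$$ satisfying the growth condition (G) for any $T>0$ there exist $k>0$ and $C_T>0$ such that $|u(p,t)|\le C_Te^{k\langle p\rangle}$ for all $(p,t)\in\mathbb{H}\times[0,T]$. Assume in addition that $f$ is right invariant concave in $\mathbb{H}\times\mathbb{R}^2$, i.e. $$f(h^{-1}\cdot p,\xi)+f(h\cdot p,\eta)\le2f\left(p,\tfrac12(\xi+\eta)\right)$$ for all $p\in\mathbb{H}$, $h\in\mathbb{H}_0$ and $\xi,\eta\in\mathbb{R}^2$. If $u_0$ is right invariant h-convex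 in $\mathbb{H}$, then so is $u(\cdot,t)$ for all $t\ge0$.
   Context: The Heisenberg group $\mathbb{H}$ is $\mathbb{R}^3$ with the group law $(x_p,y_p,z_p)\cdot(x_q,y_q,z_q)=\left(x_p+x_q,\,y_p+y_q,\,z_p+z_q+\tfrac12(x_py_q-x_qy_p)\right)$; the inverse of $p=(x,y,z)$ is $p^{-1}=(-x,-y,-z)$. Set $\mathbb{H}_0=\{(h_1,h_2,0):h_1,h_2\in\mathbb{R}\}\subset\mathbb{H}$. The Korányi gauge is $|p|_G=\left((x^2+y^2)^2+16z^2\right)^{1/4}$; $|p|$ is the Euclidean norm; $\langle p\rangle=(1+x^4+y^4+16z^2)^{1/4}$ for $p=(x,y,z)$. An upper semicontinuous function $w:\mathbb{H}\to\mathbb{R}$ is right invariant h-convex in $\mathbb{H}$ if $w(h^{-1}\cdot p)+w(h\cdot p)\ge2w(p)$ for all $p\in\mathbb{H}$ and $h\in\mathbb{H}_0$. Left-invariant vector fields: $X_1=\partial_x-\tfrac y2\partial_z$, $X_2=\partial_y+\tfrac x2\partial_z$. The horizontal gradient is $\nabla_Hu=(X_1u,X_2u)$, and the symmetrized horizontal Hessian $(\nabla_H^2u)^\ast$ is the symmetric $2\times2$ matrix with diagonal entries $X_1^2u$, $X_2^2u$ and off-diagonal entries $\tfrac12(X_1X_2u+X_2X_1u)$ (derivatives in the space variable only). Viscosity notions: an upper semicontinuous (resp. lower semicontinuous) function $u$ is a viscosity subsolution (resp. supersolution) of the equation in $\mathbb{H}\times(0,\infty)$ if, whenever $\phi$ is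 $C^2$ near $(p_0,t_0)\in\mathbb{H}\times(0,\infty)$ and $u-\phi$ has a local maximum (resp. minimum) at $(p_0,t_0)$, one has $\phi_t-\operatorname{tr}(A(\nabla_H^2\phi)^\ast)+f(p_0,\nabla_H\phi)\le0$ (resp. $\ge0$) at $(p_0,t_0)$. A continuous function is a viscosity solution if it is both. *)

theory Defs
  imports "HOL-Analysis.Analysis"
begin

section \<open>The Heisenberg group\<close>

text \<open>
  The norm of \<^typ>\<open>real \<times> real \<times> real\<close> is the Euclidean norm of \<open>\<real>\<^sup>3\<close> and its topology is the
  usual one. The additive structure of this type is not the group structure of the Heisenberg
  group, which gets its own operations.
\<close>

type_synonym heis = "real \<times> real \<times> real"

fun hmult :: "heis \<Rightarrow> heis \<Rightarrow> heis"  (infixl \<open>\<odot>\<close> 70) where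
  "(x1, y1, z1) \<odot> (x2, y2, z2) = (x1 + x2, y1 + y2, z1 + z2 + (x1 * y2 - x2 * y1) / 2)"

fun hinv :: "heis \<Rightarrow> heis" where
  "hinv (x, y, z) = (- x, - y, - z)"

definition H0 :: "heis set" where
  "H0 = {(h1, h2, 0) | h1 h2. True}"

fun gauge_norm :: "heis \<Rightarrow> real" where
  "gauge_norm (x, y, z) = root 4 ((x\<^sup>2 + y\<^sup>2)\<^sup>2 + 16 * z\<^sup>2)"

fun japanese :: "heis \<Rightarrow> real" where
  "japanese (x, y, z) = root 4 (1 + x ^ 4 + y ^ 4 + 16 * z\<^sup>2)"

section \<open>Semicontinuity and h-convexity\<close>

definition usc_on :: "'a::topological_space set \<Rightarrow> ('a \<Rightarrow> real) \<Rightarrow> bool" where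
  "usc_on S w \<longleftrightarrow> (\<forall>p\<in>S. \<forall>c>w p. \<forall>\<^sub>F q in at p within S. w q < c)"

definition lsc_on :: "'a::topological_space set \<Rightarrow> ('a \<Rightarrow> real) \<Rightarrow> bool" where
  "lsc_on S w \<longleftrightarrow> (\<forall>p\<in>S. \<forall>c<w p. \<forall>\<^sub>F q in at p within S. c < w q)"

definition right_inv_h_convex :: "(heis \<Rightarrow> real) \<Rightarrow> bool" where
  "right_inv_h_convex w \<longleftrightarrow>
     usc_on UNIV w \<and> (\<forall>p. \<forall>h\<in>H0. w (hinv h \<odot> p) + w (h \<odot> p) \<ge> 2 * w p)"

definition right_inv_concave :: "(heis \<Rightarrow> real^2 \<Rightarrow> real) \<Rightarrow> bool" where
  "right_inv_concave f \<longleftrightarrow>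
     (\<forall>p. \<forall>h\<in>H0. \<forall>\<xi> \<eta>. f (hinv h \<odot> p) \<xi> + f (h \<odot> p) \<eta> \<le> 2 * f p ((1/2) *\<^sub>R (\<xi> + \<eta>)))"

section \<open>Horizontal derivatives\<close>

text \<open>
  The operators are applied below only to functions that are \<open>C\<^sup>2\<close> near the point of evaluation,
  where all the derivatives involved exist.
\<close>

fun X1 :: "(heis \<Rightarrow> real) \<Rightarrow> heis \<Rightarrow> real" where
  "X1 u (x, y, z) = deriv (\<lambda>s. u (s, y, z)) x - y / 2 * deriv (\<lambda>s. u (x, y, s)) z"

fun X2 :: "(heis \<Rightarrow> real) \<Rightarrow> heis \<Rightarrow> real" where
  "X2 u (x, y, z) = deriv (\<lambda>s. u (x, s, z)) y + x / 2 * deriv (\<lambda>s. u (x, y, s)) z"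

definition hgrad :: "(heis \<Rightarrow> real) \<Rightarrow> heis \<Rightarrow> real^2" where
  "hgrad u p = vector [X1 u p, X2 u p]"

definition hhess_sym :: "(heis \<Rightarrow> real) \<Rightarrow> heis \<Rightarrow> real^2^2" where
  "hhess_sym u p =
     (let m = (X1 (X2 u) p + X2 (X1 u) p) / 2
      in vector [vector [X1 (X1 u) p, m], vector [m, X2 (X2 u) p]])"

section \<open>Viscosity solutions\<close>

definition C2_on :: "'a::real_normed_vector set \<Rightarrow> ('a \<Rightarrow> real) \<Rightarrow> bool" where
  "C2_on U \<phi> \<longleftrightarrow>
     (\<exists>(D1 :: 'a \<Rightarrow> 'a \<Rightarrow>\<^sub>L real) (D2 :: 'a \<Rightarrow> 'a \<Rightarrow>\<^sub>L 'a \<Rightarrow>\<^sub>L real).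
        (\<forall>x\<in>U. (\<phi> has_derivative blinfun_apply (D1 x)) (at x)) \<and>
        (\<forall>x\<in>U. (D1 has_derivative blinfun_apply (D2 x)) (at x)) \<and>
        continuous_on U D2)"

definition C2_near :: "'a::real_normed_vector \<Rightarrow> ('a \<Rightarrow> real) \<Rightarrow> bool" where
  "C2_near x \<phi> \<longleftrightarrow> (\<exists>U. open U \<and> x \<in> U \<and> C2_on U \<phi>)"

abbreviation space_time :: "(heis \<times> real) set" where
  "space_time \<equiv> UNIV \<times> {0<..}"

definition parabolic_op ::
  "real^2^2 \<Rightarrow> (heis \<Rightarrow> real^2 \<Rightarrow> real) \<Rightarrow> (heis \<times> real \<Rightarrow> real) \<Rightarrow> heis \<Rightarrow> real \<Rightarrow> real" where
  "parabolic_op A f \<phi> p t =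
     deriv (\<lambda>s. \<phi> (p, s)) t - trace (A ** hhess_sym (\<lambda>q. \<phi> (q, t)) p)
       + f p (hgrad (\<lambda>q. \<phi> (q, t)) p)"

text \<open>
  Every point of \<open>space_time\<close> is interior to it, so local extrema may be taken with respect to the
  full neighbourhood filter.
\<close>

definition viscosity_subsolution ::
  "real^2^2 \<Rightarrow> (heis \<Rightarrow> real^2 \<Rightarrow> real) \<Rightarrow> (heis \<times> real \<Rightarrow> real) \<Rightarrow> bool" where
  "viscosity_subsolution A f u \<longleftrightarrow>
     usc_on space_time u \<and>
     (\<forall>p t \<phi>. (p, t) \<in> space_time \<longrightarrow> C2_near (p, t) \<phi> \<longrightarrow>
        (\<forall>\<^sub>F q in nhds (p, t). u q - \<phi> q \<le> u (p, t) - \<phi> (p, t)) \<longrightarrow>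
        parabolic_op A f \<phi> p t \<le> 0)"

definition viscosity_supersolution ::
  "real^2^2 \<Rightarrow> (heis \<Rightarrow> real^2 \<Rightarrow> real) \<Rightarrow> (heis \<times> real \<Rightarrow> real) \<Rightarrow> bool" where
  "viscosity_supersolution A f u \<longleftrightarrow>
     lsc_on space_time u \<and>
     (\<forall>p t \<phi>. (p, t) \<in> space_time \<longrightarrow> C2_near (p, t) \<phi> \<longrightarrow>
        (\<forall>\<^sub>F q in nhds (p, t). u q - \<phi> q \<ge> u (p, t) - \<phi> (p, t)) \<longrightarrow>
        parabolic_op A f \<phi> p t \<ge> 0)"

definition viscosity_solution ::
  "real^2^2 \<Rightarrow> (heis \<Rightarrow> real^2 \<Rightarrow> real) \<Rightarrow> (heis \<times> real \<Rightarrow> real) \<Rightarrow> bool" where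
  "viscosity_solution A f u \<longleftrightarrow>
     continuous_on space_time u \<and> viscosity_subsolution A f u \<and> viscosity_supersolution A f u"

end

theory Submission
  imports Defs
begin

text \<open>
  Concavity of \<open>f\<close> in the gradient variable replaces the theorem on sums. At a given point, a
  supergradient of \<open>f\<close> turns the inequality for the supersolution \<open>u\<close> into one for a linear
  left-invariant operator \<open>M\<close>, and linear left-invariant inequalities survive mollification by left
  translations. Hence a mollification of \<open>u\<close> is a classical supersolution up to a small error, and by
  the concavity of \<open>f\<close> so is the average of its translates by \<open>h\<close> and its inverse. This smooth
  function, corrected by an exponential weight, is then a legitimate test function for the subsolution
  \<open>u\<close>, which gives the comparison.

  That mollification preserves the linear viscosity inequality is shown through resolvents: if
  \<open>V = \<Lambda> (\<Lambda> - M\<^sub>\<tau>)\<^sup>-\<^sup>1 v\<close> for a finite-difference approximation \<open>M\<^sub>\<tau>\<close> of \<open>M\<close>, then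
  a mollification of \<open>V\<close> is a smooth almost-solution, so \<open>v\<close> lies above \<open>V\<close> up to \<open>o(1/\<Lambda>)\<close> by
  comparison with a smooth function. Testing \<open>\<Lambda> (v - V)\<close> against the kernel and letting
  \<open>\<tau> \<rightarrow> 0\<close> and then \<open>\<Lambda> \<rightarrow> \<infinity>\<close> gives the inequality for the mollification of \<open>v\<close>.
\<close>

text \<open>\<open>X1\<close> and \<open>X2\<close> commute with left translations. Both competitors
  \<open>u (h \<odot> p, t)\<close> and \<open>u (hinv h \<odot> p, t)\<close> are left translates
  and the mollifier averages left translates, so one operator serves them all. The difference
  operator is built from right translations and therefore commutes with translates and mollifier
  alike. The obstacle is degeneracy: \<open>A = 0\<close> is allowed, so neither smooth solutions
  nor interior regularity can be borrowed, and a pointwise viscosity inequality cannot be integrated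
  against a kernel directly. The resolvent equation is an identity between continuous functions,
  which can be mollified, and it is solved by contraction because averaging has norm one. Concavity
  linearizes on the side that a supersolution allows: an affine majorant of \<open>f\<close> that
  touches at the gradient of the mollified function at the point in question preserves the
  inequality and loses nothing at that point. The position in \<open>f\<close> is frozen at the
  price of a small error controlled by (A2).\<close>

section \<open>Twice continuously differentiable functions\<close>

text \<open>\<open>C2_on\<close> hides its derivatives under an existential quantifier; here they
  are arguments, so that differential operators can be applied to them.\<close>

definition C2_with ::
  "'a::real_normed_vector set \<Rightarrow> ('a \<Rightarrow> real) \<Rightarrow> ('a \<Rightarrow> 'a \<Rightarrow>\<^sub>L real) \<Rightarrow>
    ('a \<Rightarrow> 'a \<Rightarrow>\<^sub>L 'a \<Rightarrow>\<^sub>L real) \<Rightarrow> bool" where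
  "C2_with U \<phi> D1 D2 \<longleftrightarrow>
     (\<forall>x\<in>U. (\<phi> has_derivative blinfun_apply (D1 x)) (at x)) \<and>
     (\<forall>x\<in>U. (D1 has_derivative blinfun_apply (D2 x)) (at x)) \<and>
     continuous_on U D2"

lemma C2_on_iff: "C2_on U \<phi> \<longleftrightarrow> (\<exists>D1 D2. C2_with U \<phi> D1 D2)"
  by (simp add: C2_on_def C2_with_def)

lemma C2_withD:
  assumes "C2_with U \<phi> D1 D2"
  shows "x \<in> U \<Longrightarrow> (\<phi> has_derivative blinfun_apply (D1 x)) (at x)"
    and "x \<in> U \<Longrightarrow> (D1 has_derivative blinfun_apply (D2 x)) (at x)"
    and "continuous_on U D2" "continuous_on U D1" "continuous_on U \<phi>"
proof -
  show "x \<in> U \<Longrightarrow> (\<phi> has_derivative blinfun_apply (D1 x)) (at x)"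
    "x \<in> U \<Longrightarrow> (D1 has_derivative blinfun_apply (D2 x)) (at x)"
    "continuous_on U D2"
    using assms by (auto simp: C2_with_def)
  show "continuous_on U D1" "continuous_on U \<phi>"
    using assms unfolding C2_with_def
    by (meson continuous_at_imp_continuous_on has_derivative_continuous)+
qed

lemma C2_with_subset: "C2_with U \<phi> D1 D2 \<Longrightarrow> V \<subseteq> U \<Longrightarrow> C2_with V \<phi> D1 D2"
  unfolding C2_with_def by (meson continuous_on_subset subset_iff)

lemma C2_with_near: "C2_with U \<phi> D1 D2 \<Longrightarrow> open U \<Longrightarrow> x \<in> U \<Longrightarrow> C2_near x \<phi>"
  unfolding C2_near_def C2_on_iff by blast

lemma C2_with_transform:
  assumes "C2_with U \<phi> D1 D2" "open U" "\<And>x. x \<in> U \<Longrightarrow> \<phi> x = \<psi> x"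
  shows "C2_with U \<psi> D1 D2"
  using assms unfolding C2_with_def by (metis has_derivative_transform_within_open)

lemma C2_with_const: "C2_with U (\<lambda>x. c) (\<lambda>x. 0) (\<lambda>x. 0)"
  unfolding C2_with_def by (auto simp: zero_blinfun.rep_eq)

lemma C2_with_linear: "C2_with U (blinfun_apply l) (\<lambda>x. l) (\<lambda>x. 0)"
  unfolding C2_with_def
  by (auto simp: zero_blinfun.rep_eq intro: bounded_linear_imp_has_derivative blinfun.bounded_linear_right)

lemma C2_with_add:
  assumes "C2_with U \<phi> D1 D2" "C2_with U \<psi> E1 E2"
  shows "C2_with U (\<lambda>x. \<phi> x + \<psi> x) (\<lambda>x. D1 x + E1 x) (\<lambda>x. D2 x + E2 x)"
  using assms unfolding C2_with_def
  by (auto simp: plus_blinfun.rep_eq intro!: has_derivative_add continuous_on_add)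

lemma C2_with_scale:
  assumes "C2_with U \<phi> D1 D2"
  shows "C2_with U (\<lambda>x. c * \<phi> x) (\<lambda>x. c *\<^sub>R D1 x) (\<lambda>x. c *\<^sub>R D2 x)"
  using assms unfolding C2_with_def
  by (auto simp: scaleR_blinfun.rep_eq intro!: has_derivative_mult_right has_derivative_scaleR_right
      continuous_intros)

lemma C2_with_diff:
  assumes "C2_with U \<phi> D1 D2" "C2_with U \<psi> E1 E2"
  shows "C2_with U (\<lambda>x. \<phi> x - \<psi> x) (\<lambda>x. D1 x - E1 x) (\<lambda>x. D2 x - E2 x)"
  using assms unfolding C2_with_def
  by (auto simp: minus_blinfun.rep_eq intro!: has_derivative_diff continuous_on_diff)

text \<open>The derivatives are spelled out because for the cube of a positive part they must be
  seen to vanish where the inner function is nonpositive; the barrier depends on it.\<close>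

lemma C2_with_compose_real:
  assumes f: "C2_with U f D1 D2"
    and h1: "\<And>x. x \<in> U \<Longrightarrow> (h has_field_derivative h1 (f x)) (at (f x))"
    and h2: "\<And>x. x \<in> U \<Longrightarrow> (h1 has_field_derivative h2 (f x)) (at (f x))"
    and h2c: "continuous_on (f ` U) h2"
  shows "C2_with U (\<lambda>x. h (f x)) (\<lambda>x. h1 (f x) *\<^sub>R D1 x)
    (\<lambda>x. h1 (f x) *\<^sub>R D2 x + h2 (f x) *\<^sub>R (blinfun_scaleR_left (D1 x) o\<^sub>L D1 x))"
  unfolding C2_with_def
proof (intro conjI ballI)
  fix x assume x: "x \<in> U"
  note df = C2_withD(1)[OF f x] and d2f = C2_withD(2)[OF f x]
  show "((\<lambda>x. h (f x)) has_derivative blinfun_apply (h1 (f x) *\<^sub>R D1 x)) (at x)"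
    using has_derivative_compose[OF df h1[OF x, unfolded has_field_derivative_def]]
    by (simp add: scaleR_blinfun.rep_eq)
  have "((\<lambda>x. h1 (f x)) has_derivative (\<lambda>v. h2 (f x) * D1 x v)) (at x)"
    using has_derivative_compose[OF df h2[OF x, unfolded has_field_derivative_def]] by simp
  from has_derivative_scaleR[OF this d2f]
  show "((\<lambda>x. h1 (f x) *\<^sub>R D1 x) has_derivative blinfun_apply (h1 (f x) *\<^sub>R D2 x +
          h2 (f x) *\<^sub>R (blinfun_scaleR_left (D1 x) o\<^sub>L D1 x))) (at x)"
    by (simp add: scaleR_blinfun.rep_eq plus_blinfun.rep_eq)
next
  have 1: "continuous_on U (\<lambda>x. h1 (f x))"
  proof (rule continuous_at_imp_continuous_on, rule ballI)
    fix x assume x: "x \<in> U"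
    show "isCont (\<lambda>x. h1 (f x)) x"
      using isCont_o2[OF has_derivative_continuous[OF C2_withD(1)[OF f x]] DERIV_isCont[OF h2[OF x]]] .
  qed
  have 2: "continuous_on U (\<lambda>x. h2 (f x))"
    using continuous_on_compose2[OF h2c C2_withD(5)[OF f]] by auto
  show "continuous_on U (\<lambda>x. h1 (f x) *\<^sub>R D2 x +
           h2 (f x) *\<^sub>R (blinfun_scaleR_left (D1 x) o\<^sub>L D1 x))"
    by (intro continuous_intros 1 2 C2_withD[OF f]
        bounded_linear.continuous_on[OF bounded_linear_blinfun_scaleR_left])
qed

section \<open>Closure properties of twice continuously differentiable functions\<close>

lemma C2_on_const: "C2_on U (\<lambda>x. c)"
  using C2_with_const C2_on_iff by blast

lemma C2_on_linear: "bounded_linear l \<Longrightarrow> C2_on U l"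
  using C2_with_linear[of U "Blinfun l"] C2_on_iff by (metis bounded_linear_Blinfun_apply)

lemma C2_on_add: "C2_on U \<phi> \<Longrightarrow> C2_on U \<psi> \<Longrightarrow> C2_on U (\<lambda>x. \<phi> x + \<psi> x)"
  unfolding C2_on_iff by (blast intro: C2_with_add)

lemma C2_on_diff: "C2_on U \<phi> \<Longrightarrow> C2_on U \<psi> \<Longrightarrow> C2_on U (\<lambda>x. \<phi> x - \<psi> x)"
  unfolding C2_on_iff by (blast intro: C2_with_diff)

lemma C2_on_scale: "C2_on U \<phi> \<Longrightarrow> C2_on U (\<lambda>x. c * \<phi> x)"
  unfolding C2_on_iff by (blast intro: C2_with_scale)

lemma C2_on_compose_real:
  assumes "C2_on U f"
    and "\<And>x. x \<in> U \<Longrightarrow> (h has_field_derivative h1 (f x)) (at (f x))"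
    and "\<And>x. x \<in> U \<Longrightarrow> (h1 has_field_derivative h2 (f x)) (at (f x))"
    and "continuous_on (f ` U) h2"
  shows "C2_on U (\<lambda>x. h (f x))"
proof -
  obtain D1 D2 where "C2_with U f D1 D2"
    using assms(1) C2_on_iff by blast
  from C2_with_compose_real[OF this assms(2-4)] show ?thesis
    unfolding C2_on_iff by blast
qed

lemma C2_on_power2: "C2_on U f \<Longrightarrow> C2_on U (\<lambda>x. (f x)\<^sup>2)"
  by (rule C2_on_compose_real[where h="\<lambda>s. s\<^sup>2" and ?h1.0="\<lambda>s. 2 * s" and ?h2.0="\<lambda>s. 2"])
    (auto intro!: derivative_eq_intros)

lemma C2_on_mult:
  assumes "C2_on U f" "C2_on U g"
  shows "C2_on U (\<lambda>x. f x * g x)"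
proof -
  \<comment> \<open>Polarization reduces the product to squares, which are compositions with a
    function of one real variable.\<close>
  have "C2_on U (\<lambda>x. (1/4) * (f x + g x)\<^sup>2 - (1/4) * (f x - g x)\<^sup>2)"
    using assms by (intro C2_on_diff C2_on_scale C2_on_power2 C2_on_add)
  then show ?thesis
    by (simp add: power2_eq_square algebra_simps)
qed

lemma C2_on_power:
  assumes "C2_on U f"
  shows "C2_on U (\<lambda>x. f x ^ n)"
  by (induction n) (simp_all add: assms C2_on_const C2_on_mult)

lemmas C2_intros = C2_on_const C2_on_add C2_on_diff C2_on_scale C2_on_power C2_on_mult

text \<open>Reads the first and second derivative in a direction off a one-variable formula, without
  computing \<open>D1\<close> and \<open>D2\<close>. Integral curves of the invariant fields are
  straight lines, so this evaluates the horizontal derivatives of the growth weight.\<close>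

lemma derivs_along_line:
  assumes "C2_with U \<phi> D1 D2" "open U" "x \<in> U"
    and g: "\<And>s. x + s *\<^sub>R v \<in> U \<Longrightarrow> \<phi> (x + s *\<^sub>R v) = g s"
    and g1: "\<And>s. x + s *\<^sub>R v \<in> U \<Longrightarrow> (g has_field_derivative g' s) (at s)"
    and g2: "(g' has_field_derivative g'') (at 0)"
  shows "D1 x v = g' 0" "D2 x v v = g''"
proof -
  define S where "S = (\<lambda>s. x + s *\<^sub>R v) -` U"
  have S: "open S" "0 \<in> S"
    unfolding S_def using assms(2,3)
    by (auto intro!: open_vimage continuous_intros)
  have line: "((\<lambda>s. x + s *\<^sub>R v) has_derivative (\<lambda>r. r *\<^sub>R v)) (at s)" for s
    by (auto intro!: derivative_eq_intros)
  have D1: "D1 (x + s *\<^sub>R v) v = g' s" if "s \<in> S" for s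
  proof -
    have "((\<lambda>s. \<phi> (x + s *\<^sub>R v)) has_derivative (\<lambda>r. D1 (x + s *\<^sub>R v) (r *\<^sub>R v))) (at s)"
      using has_derivative_compose[OF line C2_withD(1)[OF assms(1)]] that by (simp add: S_def)
    then have "(g has_derivative (\<lambda>r. D1 (x + s *\<^sub>R v) (r *\<^sub>R v))) (at s)"
      by (rule has_derivative_transform_within_open[OF _ S(1) that]) (auto simp: S_def g)
    then have "(g has_field_derivative D1 (x + s *\<^sub>R v) v) (at s)"
      unfolding has_field_derivative_def by (rule has_derivative_eq_rhs) (simp add: blinfun.scaleR_right fun_eq_iff)
    then show ?thesis
      by (rule DERIV_unique) (use g1 that in \<open>simp add: S_def\<close>)
  qed
  from D1[OF S(2)] show "D1 x v = g' 0" by simp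
  have D: "(D1 has_derivative blinfun_apply (D2 (x + 0 *\<^sub>R v))) (at (x + 0 *\<^sub>R v))"
    using C2_withD(2)[OF assms(1,3)] by simp
  have "((\<lambda>s. D1 (x + s *\<^sub>R v) v) has_derivative (\<lambda>r. D2 x (r *\<^sub>R v) v)) (at 0)"
    using bounded_linear.has_derivative[OF blinfun.bounded_linear_left has_derivative_compose[OF line D]]
    by simp
  then have "(g' has_derivative (\<lambda>r. D2 x (r *\<^sub>R v) v)) (at 0)"
    by (rule has_derivative_transform_within_open[OF _ S]) (rule D1)
  then have "(g' has_field_derivative D2 x v v) (at 0)"
    unfolding has_field_derivative_def
    by (rule has_derivative_eq_rhs) (simp add: blinfun.scaleR_right blinfun.scaleR_left fun_eq_iff)
  then show "D2 x v v = g''"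
    using DERIV_unique g2 by blast
qed


text \<open>Joint continuity in both variables is what allows differentiation under an integral over
  the second one; the main instance is the mollification kernel.\<close>

definition C2_param :: "('a::real_normed_vector \<Rightarrow> 'b::topological_space \<Rightarrow> real) \<Rightarrow>
    ('a \<Rightarrow> 'b \<Rightarrow> 'a \<Rightarrow>\<^sub>L real) \<Rightarrow> ('a \<Rightarrow> 'b \<Rightarrow> 'a \<Rightarrow>\<^sub>L 'a \<Rightarrow>\<^sub>L real) \<Rightarrow> bool" where
  "C2_param F d1 d2 \<longleftrightarrow>
     (\<forall>Q. C2_with UNIV (\<lambda>P. F P Q) (\<lambda>P. d1 P Q) (\<lambda>P. d2 P Q)) \<and>
     continuous_on UNIV (\<lambda>(P, Q). F P Q) \<and>
     continuous_on UNIV (\<lambda>(P, Q). d1 P Q) \<and>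
     continuous_on UNIV (\<lambda>(P, Q). d2 P Q)"

lemma C2_on_product_param:
  fixes F :: "'a::real_normed_vector \<times> 'b::real_normed_vector \<Rightarrow> real"
  assumes "C2_on UNIV F"
  obtains d1 d2 where "C2_param (\<lambda>P Q. F (P, Q)) d1 d2"
proof -
  obtain D1 D2 where D: "C2_with UNIV F D1 D2"
    using assms C2_on_iff by blast
  \<comment> \<open>Partial derivatives in the first variable are total derivatives composed with
    the inclusion \<open>h \<mapsto> (h, 0)\<close>; \<open>c\<close> performs this composition on
    the values of \<open>D1\<close>.\<close>
  define i :: "'a \<Rightarrow>\<^sub>L ('a \<times> 'b)" where "i = Blinfun (\<lambda>h. (h, 0))"
  have i: "blinfun_apply i h = (h, 0)" for h
    unfolding i_def by (subst bounded_linear_Blinfun_apply) (auto intro!: bounded_linear_intros)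
  define c :: "(('a \<times> 'b) \<Rightarrow>\<^sub>L real) \<Rightarrow>\<^sub>L ('a \<Rightarrow>\<^sub>L real)" where "c = Blinfun (\<lambda>D. D o\<^sub>L i)"
  have c: "blinfun_apply c D = D o\<^sub>L i" for D
    unfolding c_def by (subst bounded_linear_Blinfun_apply) (auto intro!: bounded_linear_intros)
  define d1 where "d1 = (\<lambda>P Q. D1 (P, Q) o\<^sub>L i)"
  define d2 where "d2 = (\<lambda>P Q. c o\<^sub>L D2 (P, Q) o\<^sub>L i)"
  have inj: "((\<lambda>P. (P, Q)) has_derivative blinfun_apply i) (at P)" for P :: 'a and Q :: 'b
    unfolding i[abs_def] by (auto intro!: derivative_eq_intros)
  have "C2_with UNIV (\<lambda>P. F (P, Q)) (\<lambda>P. d1 P Q) (\<lambda>P. d2 P Q)" for Q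
    unfolding C2_with_def
  proof (intro conjI ballI)
    fix P :: 'a
    show "((\<lambda>P. F (P, Q)) has_derivative blinfun_apply (d1 P Q)) (at P)"
      using has_derivative_compose[OF inj C2_withD(1)[OF D]]
      by (simp add: d1_def blinfun_apply_blinfun_compose[abs_def] o_def fun_eq_iff)
    have "((\<lambda>P. c (D1 (P, Q))) has_derivative (\<lambda>h. c (D2 (P, Q) (i h)))) (at P)"
      using bounded_linear.has_derivative[OF blinfun.bounded_linear_right
          has_derivative_compose[OF inj C2_withD(2)[OF D]]] by simp
    then show "((\<lambda>P. d1 P Q) has_derivative blinfun_apply (d2 P Q)) (at P)"
      by (simp add: d1_def d2_def c o_def blinfun_apply_blinfun_compose[abs_def])
  next
    show "continuous_on UNIV (\<lambda>P. d2 P Q)"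
      unfolding d2_def
      by (intro continuous_intros continuous_on_compose2[OF C2_withD(3)[OF D]]) auto
  qed
  moreover have "continuous_on UNIV (\<lambda>(P, Q). F (P, Q))"
    using C2_withD(5)[OF D] by simp
  moreover have "continuous_on UNIV (\<lambda>(P, Q). d1 P Q)"
    unfolding d1_def split_beta
    by (intro continuous_intros continuous_on_compose2[OF C2_withD(4)[OF D]]) auto
  moreover have "continuous_on UNIV (\<lambda>(P, Q). d2 P Q)"
    unfolding d2_def split_beta
    by (intro continuous_intros continuous_on_compose2[OF C2_withD(3)[OF D]]) auto
  ultimately show ?thesis
    by (intro that[of d1 d2]) (auto simp: C2_param_def)
qed

section \<open>Integrals depending on a parameter\<close>

lemma C2_with_integral:
  fixes F :: "'a::euclidean_space \<Rightarrow> 'b::euclidean_space \<Rightarrow> real"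
  assumes F: "C2_param F d1 d2" and w: "continuous_on UNIV w"
  shows "C2_with UNIV (\<lambda>P. integral (cbox a b) (\<lambda>Q. w Q * F P Q))
    (\<lambda>P. integral (cbox a b) (\<lambda>Q. w Q *\<^sub>R d1 P Q))
    (\<lambda>P. integral (cbox a b) (\<lambda>Q. w Q *\<^sub>R d2 P Q))"
proof -
  have D: "\<And>Q. C2_with UNIV (\<lambda>P. F P Q) (\<lambda>P. d1 P Q) (\<lambda>P. d2 P Q)"
    and cont: "continuous_on UNIV (\<lambda>(P, Q). F P Q)" "continuous_on UNIV (\<lambda>(P, Q). d1 P Q)"
      "continuous_on UNIV (\<lambda>(P, Q). d2 P Q)"
    using F by (auto simp: C2_param_def)
  have w': "continuous_on S (\<lambda>x. w (g x))" if "continuous_on S g" for g and S :: "'c::topological_space set"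
    using continuous_on_compose2[OF w that] by auto
  have cF: "continuous_on S (\<lambda>x. F (g x) (h x))" if "continuous_on S g" "continuous_on S h"
    for g h and S :: "'c::topological_space set"
    using continuous_on_compose2[OF cont(1) continuous_on_Pair[OF that]] by auto
  have c1: "continuous_on S (\<lambda>x. d1 (g x) (h x))" if "continuous_on S g" "continuous_on S h"
    for g h and S :: "'c::topological_space set"
    using continuous_on_compose2[OF cont(2) continuous_on_Pair[OF that]] by auto
  have c2: "continuous_on S (\<lambda>x. d2 (g x) (h x))" if "continuous_on S g" "continuous_on S h"
    for g h and S :: "'c::topological_space set"
    using continuous_on_compose2[OF cont(3) continuous_on_Pair[OF that]] by auto
  show ?thesis
    unfolding C2_with_def
  proof (intro conjI ballI)
    fix P :: 'a
    have "((\<lambda>P. integral (cbox a b) (\<lambda>Q. w Q * F P Q)) has_derivative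
        integral (cbox a b) (\<lambda>Q. w Q *\<^sub>R d1 P Q)) (at P within UNIV)"
      by (rule leibniz_rule)
        (auto simp: scaleR_blinfun.rep_eq split_beta intro!: has_derivative_mult_right
          C2_withD(1)[OF D] integrable_continuous continuous_intros w' cF c1)
    then show "((\<lambda>P. integral (cbox a b) (\<lambda>Q. w Q * F P Q)) has_derivative
        blinfun_apply (integral (cbox a b) (\<lambda>Q. w Q *\<^sub>R d1 P Q))) (at P)"
      by simp
    have "((\<lambda>P. integral (cbox a b) (\<lambda>Q. w Q *\<^sub>R d1 P Q)) has_derivative
        integral (cbox a b) (\<lambda>Q. w Q *\<^sub>R d2 P Q)) (at P within UNIV)"
      by (rule leibniz_rule)
        (auto simp: scaleR_blinfun.rep_eq split_beta intro!: has_derivative_scaleR_right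
          C2_withD(2)[OF D] integrable_continuous continuous_intros w' c1 c2)
    then show "((\<lambda>P. integral (cbox a b) (\<lambda>Q. w Q *\<^sub>R d1 P Q)) has_derivative
        blinfun_apply (integral (cbox a b) (\<lambda>Q. w Q *\<^sub>R d2 P Q))) (at P)"
      by simp
  next
    show "continuous_on UNIV (\<lambda>P. integral (cbox a b) (\<lambda>Q. w Q *\<^sub>R d2 P Q))"
      by (rule integral_continuous_on_param)
        (auto simp: split_beta intro!: continuous_intros w' c2)
  qed
qed

section \<open>The group of space-time points\<close>

definition gmul :: "heis \<times> real \<Rightarrow> heis \<times> real \<Rightarrow> heis \<times> real" where
  "gmul P Q = (fst P \<odot> fst Q, snd P + snd Q)"

definition ginv :: "heis \<times> real \<Rightarrow> heis \<times> real" where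
  "ginv P = (hinv (fst P), - snd P)"

lemma gmul_simp: "gmul ((x, y, z), t) ((x', y', z'), t') =
    ((x + x', y + y', z + z' + (x * y' - x' * y) / 2), t + t')"
  by (simp add: gmul_def)

lemma ginv_simp: "ginv ((x, y, z), t) = ((- x, - y, - z), - t)"
  by (simp add: ginv_def)

lemma st_cases:
  fixes P :: "heis \<times> real"
  obtains x y z t where "P = ((x, y, z), t)"
  by (metis prod.exhaust)

lemma gmul_assoc: "gmul (gmul P Q) S = gmul P (gmul Q S)"
  by (rule st_cases[of P], rule st_cases[of Q], rule st_cases[of S])
    (simp add: gmul_simp field_simps)

lemma gmul_ginv [simp]: "gmul P (ginv P) = 0" "gmul (ginv P) P = 0"
  by (rule st_cases[of P], simp add: gmul_simp ginv_simp zero_prod_def)+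

lemma gmul_0 [simp]: "gmul 0 P = P" "gmul P 0 = P"
  by (rule st_cases[of P], simp add: gmul_simp zero_prod_def)+

lemma ginv_gmul: "ginv (gmul P Q) = gmul (ginv Q) (ginv P)"
  by (rule st_cases[of P], rule st_cases[of Q]) (simp add: gmul_simp ginv_simp field_simps)

lemma ginv_ginv [simp]: "ginv (ginv P) = P"
  by (rule st_cases[of P]) (simp add: ginv_simp)

lemma norm_st: "norm ((x, y, z), t :: real) = sqrt (x\<^sup>2 + y\<^sup>2 + z\<^sup>2 + t\<^sup>2)" for x y z :: real
  by (simp add: norm_Pair algebra_simps)

lemma norm_ginv [simp]: "norm (ginv P) = norm P"
  by (rule st_cases[of P]) (simp add: ginv_simp norm_st)

text \<open>
  The left-invariant field with horizontal components \<open>a\<close>, \<open>b\<close> and time component \<open>s\<close>: its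
  integral curves are the straight lines \<open>P + r fld (a, b, s) P\<close>.
\<close>

fun fld :: "real \<times> real \<times> real \<Rightarrow> heis \<times> real \<Rightarrow> heis \<times> real" where
  "fld (a, b, s) ((x, y, z), t) = ((a, b, (x * b - y * a) / 2), s)"

fun gvec :: "real \<times> real \<times> real \<Rightarrow> heis \<times> real" where
  "gvec (a, b, s) = ((a, b, 0), s)"

text \<open>The bridge between group and calculus: right translations flow along left-invariant
  fields, so difference quotients made of right translations approximate the fields and still
  commute with left translations.\<close>

lemma gmul_gvec: "gmul P (gvec (r *\<^sub>R g)) = P + r *\<^sub>R fld g P"
  by (cases g; rule st_cases[of P]) (simp add: gmul_simp algebra_simps)

lemma continuous_on_fld [continuous_intros]:
  assumes "continuous_on S f"
  shows "continuous_on S (\<lambda>x. fld g (f x))"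
proof -
  obtain a b s where g: "g = (a, b, s)" by (cases g)
  have "fld g = (\<lambda>P. ((a, b, (fst (fst P) * b - fst (snd (fst P)) * a) / 2), s))"
    by (auto simp: fun_eq_iff g)
  then show ?thesis
    using assms by (auto intro!: continuous_intros)
qed

lemma continuous_on_gmul [continuous_intros]:
  assumes "continuous_on S f" "continuous_on S g"
  shows "continuous_on S (\<lambda>x. gmul (f x) (g x))"
proof -
  have "gmul P Q = ((fst (fst P) + fst (fst Q), fst (snd (fst P)) + fst (snd (fst Q)),
     snd (snd (fst P)) + snd (snd (fst Q)) +
       (fst (fst P) * fst (snd (fst Q)) - fst (fst Q) * fst (snd (fst P))) / 2), snd P + snd Q)" for P Q
    by (rule st_cases[of P], rule st_cases[of Q]) (simp add: gmul_simp)
  then show ?thesis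
    using assms by (auto intro!: continuous_intros)
qed

lemma continuous_on_ginv [continuous_intros]:
  assumes "continuous_on S f"
  shows "continuous_on S (\<lambda>x. ginv (f x))"
proof -
  have "ginv = uminus"
    by (auto simp: fun_eq_iff ginv_def)
  then show ?thesis
    using assms by (auto intro!: continuous_intros)
qed

text \<open>The nonlinear part of the displacement is half the determinant of the horizontal parts,
  and Lagrange's identity bounds it. Left translation by a small element is thus Euclidean-small
  only up to the factor \<open>1 + norm X\<close>, which reappears in the support estimates
  below.\<close>

lemma norm_gmul_diff: "norm (gmul K X - X) \<le> norm K * (1 + norm X)"
proof (rule st_cases[of K], rule st_cases[of X])
  fix k1 k2 k3 k4 x y z t :: real
  assume K: "K = ((k1, k2, k3), k4)" and X: "X = ((x, y, z), t)"
  define c where "c = k1 * y - x * k2"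
  have "c\<^sup>2 \<le> (k1\<^sup>2 + k2\<^sup>2) * (x\<^sup>2 + y\<^sup>2)"
  proof -
    have "(k1\<^sup>2 + k2\<^sup>2) * (x\<^sup>2 + y\<^sup>2) - c\<^sup>2 = (k1 * x + k2 * y)\<^sup>2"
      by (simp add: c_def power2_eq_square algebra_simps)
    then show ?thesis by (smt (verit) zero_le_power2)
  qed
  also have "\<dots> \<le> (norm K)\<^sup>2 * (norm X)\<^sup>2"
    unfolding K X norm_st by (intro mult_mono) auto
  finally have "\<bar>c\<bar> \<le> norm K * norm X"
    by (metis abs_le_square_iff abs_mult abs_norm_cancel power_mult_distrib)
  then have "norm (((0, 0, c / 2), 0) :: heis \<times> real) \<le> norm K * norm X"
    by (simp add: norm_Pair)
  moreover have "gmul K X - X = K + ((0, 0, c / 2), 0)"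
    by (simp add: K X gmul_simp c_def)
  ultimately have "norm (gmul K X - X) \<le> norm K + norm K * norm X"
    using norm_triangle_ineq[of K "((0, 0, c / 2), 0)"] by simp
  then show ?thesis by (simp add: algebra_simps)
qed

lemma gmul_ginv_cancel: "gmul (gmul P Q) (ginv Q) = P" "gmul (gmul P (ginv Q)) Q = P"
  "gmul (ginv P) (gmul P Q) = Q" "gmul P (gmul (ginv P) Q) = Q"
  by (metis gmul_assoc gmul_ginv gmul_0)+

lemma dist_gmul_ginv:
  assumes "norm (gmul P (ginv Q)) \<le> \<eta>"
  shows "dist P Q \<le> \<eta> * (1 + norm P)"
proof -
  have "Q = gmul (ginv (gmul P (ginv Q))) P"
    by (simp add: ginv_gmul gmul_assoc)
  then have "dist P Q = norm (gmul (ginv (gmul P (ginv Q))) P - P)"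
    by (metis dist_commute dist_norm)
  also have "\<dots> \<le> norm (gmul P (ginv Q)) * (1 + norm P)"
    using norm_gmul_diff norm_ginv by metis
  also have "\<dots> \<le> \<eta> * (1 + norm P)"
    using assms by (intro mult_right_mono) auto
  finally show ?thesis .
qed

section \<open>Invariant mollification\<close>

text \<open>Powers of the positive part serve as cutoff profiles; the cube is already
  \<open>C\<^sup>2\<close>. The exponent is written with two successors because differentiability at
  0 requires it to be at least two.\<close>

lemma DERIV_max_power:
  "((\<lambda>s. (max 0 s) ^ (Suc (Suc n))) has_field_derivative real (Suc (Suc n)) * (max 0 s) ^ Suc n) (at (s :: real))"
proof (cases s "0 :: real" rule: linorder_cases)
  case less
  have "((\<lambda>s. 0) has_field_derivative real (Suc (Suc n)) * (max 0 s) ^ Suc n) (at s)"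
    using less by simp
  then show ?thesis
    by (rule has_field_derivative_transform_within_open[where S="{..<0}"]) (use less in auto)
next
  case greater
  have "((\<lambda>s. s ^ Suc (Suc n)) has_field_derivative real (Suc (Suc n)) * (max 0 s) ^ Suc n) (at s)"
    using greater DERIV_pow[of "Suc (Suc n)" s UNIV] by (simp add: max_def)
  then show ?thesis
    by (rule has_field_derivative_transform_within_open[where S="{0<..}"]) (use greater in auto)
next
  case equal
  have "((\<lambda>h. (max 0 h) ^ (Suc (Suc n)) / h) \<longlongrightarrow> 0) (at (0::real))"
  proof (rule Lim_null_comparison)
    have "norm ((max 0 h) ^ (Suc (Suc n)) / h) \<le> \<bar>h\<bar> ^ Suc n" for h :: real
    proof (cases "h > 0")
      case True
      then have "(max 0 h) ^ (Suc (Suc n)) / h = h ^ Suc n" by (simp add: max_def)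
      with True show ?thesis by simp
    next
      case False
      then have "max 0 h = 0" by simp
      moreover have "0 \<le> \<bar>h\<bar> ^ Suc n" by simp
      ultimately show ?thesis by (simp del: power_Suc)
    qed
    then show "\<forall>\<^sub>F h in at 0. norm ((max 0 h) ^ (Suc (Suc n)) / h) \<le> \<bar>h\<bar> ^ Suc n"
      by simp
    have "isCont (\<lambda>h. \<bar>h\<bar> ^ Suc n) (0::real)" by (intro continuous_intros)
    then show "((\<lambda>h. \<bar>h\<bar> ^ Suc n) \<longlongrightarrow> 0) (at (0::real))"
      by (simp add: isCont_def)
  qed
  then show ?thesis
    unfolding equal has_field_derivative_iff by (simp del: power_Suc of_nat_Suc)
qed

lemma C2_on_pos_cube:
  assumes "C2_on U f"
  shows "C2_on U (\<lambda>x. (max 0 (f x)) ^ 3)"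
proof (rule C2_on_compose_real[OF assms])
  show "((\<lambda>s. (max 0 s) ^ 3) has_field_derivative 3 * (max 0 (f x)) ^ 2) (at (f x))" for x
    using DERIV_max_power[of 1 "f x"] by (simp add: numeral_eq_Suc)
  show "((\<lambda>s. 3 * (max 0 s) ^ 2) has_field_derivative 3 * (2 * max 0 (f x))) (at (f x))" for x
    using DERIV_cmult[OF DERIV_max_power[of 0 "f x"], of 3] by (simp add: numeral_eq_Suc)
  show "continuous_on (f ` U) (\<lambda>s. 3 * (2 * max 0 s))"
    by (intro continuous_intros)
qed

section \<open>The kernel and its mollification\<close>

definition bump :: "real \<Rightarrow> heis \<times> real \<Rightarrow> real" where
  "bump \<eta> X = (max 0 (\<eta>\<^sup>2 - (norm X)\<^sup>2)) ^ 3"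

text \<open>A function of \<open>P Q^-1\<close> alone, hence unchanged when both points are
  translated on the right. With \<open>Q = K^-1 P\<close>, integration over \<open>Q\<close>
  averages left translates, the form that left-invariant operators respect. The mass is taken of
  \<open>bump \<eta> (ginv Y)\<close> because this is what the unnormalized kernel becomes after
  \<open>Q\<close> is replaced by \<open>Q P\<close>.\<close>

definition kern :: "real \<Rightarrow> heis \<times> real \<Rightarrow> heis \<times> real \<Rightarrow> real" where
  "kern \<eta> P Q = bump \<eta> (gmul P (ginv Q)) / (LINT Y|lborel. bump \<eta> (ginv Y))"

definition mol :: "real \<Rightarrow> (heis \<times> real \<Rightarrow> real) \<Rightarrow> heis \<times> real \<Rightarrow> real" where
  "mol \<eta> w P = (LINT Q|lborel. w Q * kern \<eta> P Q)"

lemma bump_nonneg: "0 \<le> bump \<eta> X"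
  by (simp add: bump_def)

lemma bump_eq_0: "0 < \<eta> \<Longrightarrow> \<eta> \<le> norm X \<Longrightarrow> bump \<eta> X = 0"
  by (simp add: bump_def power_mono)

lemma continuous_on_bump [continuous_intros]:
  "continuous_on S f \<Longrightarrow> continuous_on S (\<lambda>x. bump \<eta> (f x))"
  unfolding bump_def by (intro continuous_intros)

lemma C2_on_norm_sq: "C2_on U (\<lambda>P :: heis \<times> real. (norm (P - P0))\<^sup>2)"
proof -
  have eq: "(norm (P - P0))\<^sup>2 = (fst (fst P) - fst (fst P0))^2 + (fst (snd (fst P)) - fst (snd (fst P0)))^2 +
    (snd (snd (fst P)) - snd (snd (fst P0)))^2 + (snd P - snd P0)^2" for P :: "heis \<times> real"
    by (rule st_cases[of P], rule st_cases[of P0]) (simp add: norm_st)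
  show ?thesis
    unfolding eq
    by (intro C2_intros C2_on_linear bounded_linear_intros bounded_linear_fst_comp bounded_linear_snd_comp)
qed

lemma C2_on_kern: "C2_on UNIV (\<lambda>PQ. kern \<eta> (fst PQ) (snd PQ))"
proof -
  let ?x = "\<lambda>P :: heis \<times> real. fst (fst P)" and ?y = "\<lambda>P :: heis \<times> real. fst (snd (fst P))"
    and ?z = "\<lambda>P :: heis \<times> real. snd (snd (fst P))" and ?t = "\<lambda>P :: heis \<times> real. snd P"
  have eq: "(norm (gmul P (ginv Q)))\<^sup>2 = (?x P - ?x Q)^2 + (?y P - ?y Q)^2 +
    (?z P - ?z Q + (1/2) * (?x Q * ?y P - ?x P * ?y Q))^2 + (?t P - ?t Q)^2" for P Q
    by (rule st_cases[of P], rule st_cases[of Q])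
      (simp add: gmul_simp ginv_simp norm_st add_divide_distrib diff_divide_distrib algebra_simps)
  have "C2_on UNIV (\<lambda>PQ. (1 / (LINT Y|lborel. bump \<eta> (ginv Y))) *
      (max 0 (\<eta>\<^sup>2 - (norm (gmul (fst PQ) (ginv (snd PQ))))\<^sup>2)) ^ 3)"
    unfolding eq
    by (intro C2_on_pos_cube C2_intros C2_on_linear bounded_linear_intros
        bounded_linear_fst_comp bounded_linear_snd_comp)
  then show ?thesis
    by (simp add: kern_def bump_def)
qed

text \<open>In coordinates right translation is triangular: \<open>x\<close>, \<open>y\<close> and
  \<open>t\<close> are shifted by constants and \<open>z\<close> by an amount depending on
  \<open>x\<close> and \<open>y\<close> only. Tonelli's theorem with the order \<open>t\<close>,
  \<open>z\<close>, \<open>y\<close>, \<open>x\<close> from the inside outwards turns each layer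
  into a translation of the real line.\<close>

lemma distr_gmul_lborel: "distr lborel borel (\<lambda>Q. gmul Q \<gamma>) = (lborel :: (heis \<times> real) measure)"
proof (rule measure_eqI)
  have meas [measurable]: "(\<lambda>Q. gmul Q \<gamma>) \<in> borel_measurable borel"
    by (intro borel_measurable_continuous_onI continuous_intros)
  obtain a b c s where \<gamma>: "\<gamma> = ((a, b, c), s)" by (rule st_cases)
  show "sets (distr lborel borel (\<lambda>Q. gmul Q \<gamma>)) = sets lborel"
    by simp
  fix A assume A: "A \<in> sets (distr lborel borel (\<lambda>Q. gmul Q \<gamma>))"
  then have [measurable]: "A \<in> sets borel" by simp
  define f :: "heis \<times> real \<Rightarrow> ennreal" where "f = indicator A"
  have f [measurable]: "f \<in> borel_measurable borel"
    unfolding f_def by measurable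
  have iter: "(\<integral>\<^sup>+Q. g Q \<partial>lborel) = (\<integral>\<^sup>+x. \<integral>\<^sup>+y. \<integral>\<^sup>+z. \<integral>\<^sup>+t. g ((x, y, z), t) \<partial>lborel \<partial>lborel \<partial>lborel \<partial>lborel)"
    if g: "g \<in> borel_measurable borel" for g :: "heis \<times> real \<Rightarrow> ennreal"
  proof -
    have g1 [measurable]: "g \<in> borel_measurable ((lborel :: heis measure) \<Otimes>\<^sub>M (lborel :: real measure))"
      using g by (simp add: lborel_prod)
    define G where "G p = (\<integral>\<^sup>+t. g (p, t) \<partial>lborel)" for p
    have G: "G \<in> borel_measurable (lborel :: heis measure)"
      unfolding G_def by measurable
    have G1 [measurable]: "G \<in> borel_measurable ((lborel :: real measure) \<Otimes>\<^sub>M (lborel :: (real \<times> real) measure))"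
      using G by (simp add: lborel_prod)
    define H where "H x w = G (x, w)" for x w
    have H [measurable]: "H x \<in> borel_measurable ((lborel :: real measure) \<Otimes>\<^sub>M (lborel :: real measure))" for x
    proof -
      have "H x \<in> borel_measurable (lborel :: (real \<times> real) measure)"
        unfolding H_def by measurable
      then show ?thesis by (simp add: lborel_prod)
    qed
    have "(\<integral>\<^sup>+Q. g Q \<partial>lborel) = (\<integral>\<^sup>+p. G p \<partial>lborel)"
      unfolding G_def by (subst lborel.nn_integral_fst[OF g1]) (simp add: lborel_prod)
    also have "\<dots> = (\<integral>\<^sup>+x. \<integral>\<^sup>+w. H x w \<partial>lborel \<partial>lborel)"
      unfolding H_def by (subst lborel.nn_integral_fst[OF G1]) (simp add: lborel_prod)
    also have "\<dots> = (\<integral>\<^sup>+x. \<integral>\<^sup>+y. \<integral>\<^sup>+z. H x (y, z) \<partial>lborel \<partial>lborel \<partial>lborel)"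
      by (subst lborel.nn_integral_fst[OF H]) (simp add: lborel_prod)
    finally show ?thesis
      by (simp add: H_def G_def)
  qed
  have tr: "(\<integral>\<^sup>+x. g (x + r) \<partial>lborel) = (\<integral>\<^sup>+x. g x \<partial>lborel)"
    if [measurable]: "g \<in> borel_measurable borel" for g :: "real \<Rightarrow> ennreal" and r
    using nn_integral_real_affine[OF that, of 1 r] by (simp add: add.commute)
  have p1: "(\<lambda>t. f ((x, y, z), t)) \<in> borel_measurable borel" for x y z
    by (intro measurable_compose[OF _ f] borel_measurable_continuous_onI continuous_intros)
  have p4: "(\<lambda>v. \<integral>\<^sup>+t. f (h v, t) \<partial>lborel) \<in> borel_measurable borel"
    if h: "continuous_on UNIV h" for h :: "real \<Rightarrow> heis"
  proof -
    have "(\<lambda>(v, t). f (h v, t)) \<in> borel_measurable (lborel \<Otimes>\<^sub>M lborel)"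
      unfolding lborel_prod split_beta
      by (simp, intro measurable_compose[OF _ f] borel_measurable_continuous_onI continuous_intros
          continuous_on_compose2[OF h]) auto
    from lborel.borel_measurable_nn_integral[OF this] show ?thesis
      by simp
  qed
  define G where "G p = (\<integral>\<^sup>+t. f (p, t) \<partial>lborel)" for p
  have G: "G \<in> borel_measurable borel"
  proof -
    have "f \<in> borel_measurable ((lborel :: heis measure) \<Otimes>\<^sub>M (lborel :: real measure))"
      using f by (simp add: lborel_prod)
    then show ?thesis
      unfolding G_def using lborel.borel_measurable_nn_integral_fst by fastforce
  qed
  define H where "H x y = (\<integral>\<^sup>+z. G (x, y, z) \<partial>lborel)" for x y
  have H: "H x \<in> borel_measurable borel" for x
  proof -
    have "(\<lambda>(y, z). G (x, y, z)) \<in> borel_measurable (lborel \<Otimes>\<^sub>M lborel)"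
      unfolding lborel_prod split_beta
      by (simp, intro measurable_compose[OF _ G] borel_measurable_continuous_onI continuous_intros)
    from lborel.borel_measurable_nn_integral[OF this] show ?thesis
      unfolding H_def by simp
  qed
  have Gz: "(\<lambda>z. G (x, y, z)) \<in> borel_measurable borel" for x y
    by (intro measurable_compose[OF _ G] borel_measurable_continuous_onI continuous_intros)
  define J where "J x = (\<integral>\<^sup>+y. H x y \<partial>lborel)" for x
  have J: "J \<in> borel_measurable borel"
  proof -
    have *: "(\<lambda>((x, y), z). G (x, y, z)) \<in> borel_measurable ((lborel :: (real \<times> real) measure) \<Otimes>\<^sub>M (lborel :: real measure))"
      unfolding lborel_prod split_beta
      by (simp, intro measurable_compose[OF _ G] borel_measurable_continuous_onI continuous_intros)
    have "(\<lambda>(x, y). H x y) \<in> borel_measurable (lborel \<Otimes>\<^sub>M lborel)"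
      using lborel.borel_measurable_nn_integral_fst[OF *]
      by (simp add: lborel_prod H_def split_beta)
    from lborel.borel_measurable_nn_integral[OF this] show ?thesis
      unfolding J_def by simp
  qed
  have "emeasure (distr lborel borel (\<lambda>Q. gmul Q \<gamma>)) A = (\<integral>\<^sup>+Q. f (gmul Q \<gamma>) \<partial>lborel)"
  proof -
    have "emeasure (distr lborel borel (\<lambda>Q. gmul Q \<gamma>)) A = (\<integral>\<^sup>+Q. f Q \<partial>distr lborel borel (\<lambda>Q. gmul Q \<gamma>))"
      unfolding f_def by simp
    also have "\<dots> = (\<integral>\<^sup>+Q. f (gmul Q \<gamma>) \<partial>lborel)"
      by (rule nn_integral_distr) auto
    finally show ?thesis .
  qed
  also have "\<dots> = (\<integral>\<^sup>+x. \<integral>\<^sup>+y. \<integral>\<^sup>+z. \<integral>\<^sup>+t.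
      f ((x + a, y + b, z + c + (x * b - a * y) / 2), t + s) \<partial>lborel \<partial>lborel \<partial>lborel \<partial>lborel)"
    using iter[OF measurable_compose[OF meas f]] by (simp add: \<gamma> gmul_simp)
  also have "\<dots> = (\<integral>\<^sup>+x. \<integral>\<^sup>+y. \<integral>\<^sup>+z. G (x + a, y + b, z + c + (x * b - a * y) / 2) \<partial>lborel \<partial>lborel \<partial>lborel)"
    unfolding G_def
    by (rule nn_integral_cong, rule nn_integral_cong, rule nn_integral_cong, rule tr[OF p1])
  also have "\<dots> = (\<integral>\<^sup>+x. \<integral>\<^sup>+y. H (x + a) (y + b) \<partial>lborel \<partial>lborel)"
    unfolding H_def
  proof (rule nn_integral_cong, rule nn_integral_cong)
    fix x y :: real
    show "(\<integral>\<^sup>+z. G (x + a, y + b, z + c + (x * b - a * y) / 2) \<partial>lborel) = (\<integral>\<^sup>+z. G (x + a, y + b, z) \<partial>lborel)"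
      using tr[OF Gz, of "x + a" "y + b" "c + (x * b - a * y) / 2"] by (simp add: add.assoc)
  qed
  also have "\<dots> = (\<integral>\<^sup>+x. J (x + a) \<partial>lborel)"
    unfolding J_def by (rule nn_integral_cong, rule tr[OF H])
  also have "\<dots> = (\<integral>\<^sup>+x. J x \<partial>lborel)"
    by (rule tr[OF J])
  also have "\<dots> = (\<integral>\<^sup>+Q. f Q \<partial>lborel)"
    unfolding iter[OF f] J_def H_def G_def ..
  also have "\<dots> = emeasure lborel A"
    unfolding f_def by simp
  finally show "emeasure (distr lborel borel (\<lambda>Q. gmul Q \<gamma>)) A = emeasure lborel A" .
qed

lemma integral_gmul_right:
  fixes F :: "heis \<times> real \<Rightarrow> real"
  assumes "continuous_on UNIV F"
  shows "(LINT Q|lborel. F (gmul Q \<gamma>)) = (LINT Q|lborel. F Q)"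
proof -
  have "(LINT Q|lborel. F Q) = (LINT Q|distr lborel borel (\<lambda>Q. gmul Q \<gamma>). F Q)"
    by (simp add: distr_gmul_lborel)
  also have "\<dots> = (LINT Q|lborel. F (gmul Q \<gamma>))"
    by (rule integral_distr)
      (use assms in \<open>auto intro!: borel_measurable_continuous_onI continuous_intros\<close>)
  finally show ?thesis ..
qed

lemma integrable_compact_support:
  fixes F :: "'a::euclidean_space \<Rightarrow> real"
  assumes F: "continuous_on UNIV F" and 0: "\<And>x. x \<notin> K \<Longrightarrow> F x = 0" and K: "compact K"
  shows "integrable lborel F"
proof -
  have "(\<lambda>x. indicator K x *\<^sub>R F x) = F"
    using 0 by (auto simp: fun_eq_iff indicator_def)
  with borel_integrable_compact[OF K continuous_on_subset[OF F]] show ?thesis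
    by simp
qed

lemma bump_mass_pos:
  assumes \<eta>: "0 < \<eta>"
  shows "0 < (LINT Y|lborel. bump \<eta> (ginv Y))"
proof -
  \<comment> \<open>On the ball of radius \<open>\<eta> / 2\<close> the difference of squares in
    \<open>bump\<close> is at least three quarters of \<open>\<eta>\<^sup>2\<close>.\<close>
  define c where "c = (3/4 * \<eta>\<^sup>2) ^ 3"
  define B where "B = cball (0 :: heis \<times> real) (\<eta> / 2)"
  have c: "0 < c" using \<eta> by (simp add: c_def)
  have "c * indicator B Y \<le> bump \<eta> (ginv Y)" for Y
  proof (cases "Y \<in> B")
    case True
    then have "(norm Y)\<^sup>2 \<le> (\<eta> / 2)\<^sup>2"
      by (intro power_mono) (auto simp: B_def)
    then have "3/4 * \<eta>\<^sup>2 \<le> max 0 (\<eta>\<^sup>2 - (norm Y)\<^sup>2)"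
      by (simp add: power_divide le_max_iff_disj)
    then show ?thesis
      using True by (auto simp: bump_def c_def intro!: power_mono)
  qed (simp add: bump_nonneg)
  moreover have int: "integrable lborel (\<lambda>Y. bump \<eta> (ginv Y))"
    by (rule integrable_compact_support[where K="cball 0 \<eta>"])
      (use \<eta> in \<open>auto intro!: continuous_intros bump_eq_0\<close>)
  moreover have int2: "integrable lborel (\<lambda>Y. c * indicator B Y)"
    by (rule integrable_mult_right, rule integrable_real_indicator)
      (simp_all add: B_def emeasure_lborel_cball_finite del: infinity_ennreal_def)
  ultimately have "(LINT Y|lborel. c * indicator B Y) \<le> (LINT Y|lborel. bump \<eta> (ginv Y))"
    by (intro integral_mono) auto
  moreover have "(LINT Y|lborel. c * indicator B Y) = c * measure lborel B"
    by simp
  moreover have "0 < measure lborel B"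
    using content_cball_pos[of "\<eta>/2" "0 :: heis \<times> real"] \<eta> by (simp add: B_def)
  ultimately show ?thesis
    using c by (smt (verit) mult_pos_pos)
qed

section \<open>Elementary properties of kernel and mollification\<close>

lemma kern_nonneg: "0 < \<eta> \<Longrightarrow> 0 \<le> kern \<eta> P Q"
  using bump_mass_pos[of \<eta>] by (simp add: kern_def bump_nonneg)

lemma kern_support:
  assumes "0 < \<eta>" "kern \<eta> P Q \<noteq> 0"
  shows "norm (gmul P (ginv Q)) < \<eta>" "dist P Q \<le> \<eta> * (1 + norm P)"
proof -
  show *: "norm (gmul P (ginv Q)) < \<eta>"
    using assms bump_eq_0[of \<eta> "gmul P (ginv Q)"] by (force simp: kern_def)
  show "dist P Q \<le> \<eta> * (1 + norm P)"
    using dist_gmul_ginv * by simp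
qed

lemma continuous_on_kern [continuous_intros]:
  "continuous_on S f \<Longrightarrow> continuous_on S g \<Longrightarrow> continuous_on S (\<lambda>x. kern \<eta> (f x) (g x))"
  unfolding kern_def divide_inverse by (intro continuous_intros)

lemma kern_gmul: "kern \<eta> (gmul P \<gamma>) (gmul Q \<gamma>) = kern \<eta> P Q"
  by (simp add: kern_def ginv_gmul gmul_assoc flip: gmul_assoc[of \<gamma>])

lemma kern_integrable:
  assumes "0 < \<eta>" "continuous_on UNIV w"
  shows "integrable lborel (\<lambda>Q. w Q * kern \<eta> P Q)"
proof (rule integrable_compact_support)
  show "continuous_on UNIV (\<lambda>Q. w Q * kern \<eta> P Q)"
    by (intro continuous_intros assms)
  show "w Q * kern \<eta> P Q = 0" if "Q \<notin> cball P (\<eta> * (1 + norm P))" for Q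
    using that kern_support(2)[OF assms(1), of P Q] by auto
qed simp

lemma kern_integral: 
  assumes "0 < \<eta>"
  shows "(LINT Q|lborel. kern \<eta> P Q) = 1"
proof -
  have "(LINT Q|lborel. kern \<eta> P Q) = (LINT Q|lborel. kern \<eta> P (gmul Q P))"
    by (rule integral_gmul_right[symmetric]) (intro continuous_intros)
  also have "\<dots> = (LINT Q|lborel. bump \<eta> (ginv Q) / (LINT Y|lborel. bump \<eta> (ginv Y)))"
    by (simp add: kern_def ginv_gmul flip: gmul_assoc)
  also have "\<dots> = 1"
    using bump_mass_pos[OF assms] by simp
  finally show ?thesis .
qed

text \<open>Substituting \<open>Q \<gamma>\<close> for \<open>Q\<close> changes neither the kernel
  (\<open>kern_gmul\<close>) nor Lebesgue measure (\<open>integral_gmul_right\<close>). This is why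
  mollification commutes with the averages over right translates below.\<close>

lemma mol_gmul:
  assumes "continuous_on UNIV w"
  shows "mol \<eta> (\<lambda>Q. w (gmul Q \<gamma>)) P = mol \<eta> w (gmul P \<gamma>)"
proof -
  have "mol \<eta> (\<lambda>Q. w (gmul Q \<gamma>)) P = (LINT Q|lborel. w (gmul Q \<gamma>) * kern \<eta> (gmul P \<gamma>) (gmul Q \<gamma>))"
    by (simp add: mol_def kern_gmul)
  also have "\<dots> = mol \<eta> w (gmul P \<gamma>)"
    unfolding mol_def
    by (rule integral_gmul_right[where F="\<lambda>Q. w Q * kern \<eta> (gmul P \<gamma>) Q"])
      (intro continuous_intros assms)
  finally show ?thesis .
qed

lemma mol_const: "0 < \<eta> \<Longrightarrow> mol \<eta> (\<lambda>Q. c) P = c"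
  by (simp add: mol_def kern_integral)

lemma mol_scale: "mol \<eta> (\<lambda>Q. c * w Q) P = c * mol \<eta> w P"
  by (simp add: mol_def mult.assoc)

lemma mol_add:
  assumes "0 < \<eta>" "continuous_on UNIV w" "continuous_on UNIV w'"
  shows "mol \<eta> (\<lambda>Q. w Q + w' Q) P = mol \<eta> w P + mol \<eta> w' P"
  unfolding mol_def using assms by (simp add: distrib_right kern_integrable)

lemma mol_mono:
  assumes "0 < \<eta>" "continuous_on UNIV w" "continuous_on UNIV w'"
    and "\<And>Q. norm (gmul P (ginv Q)) < \<eta> \<Longrightarrow> dist P Q \<le> \<eta> * (1 + norm P) \<Longrightarrow> w Q \<le> w' Q"
  shows "mol \<eta> w P \<le> mol \<eta> w' P"
  unfolding mol_def
proof (rule integral_mono)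
  fix Q
  show "w Q * kern \<eta> P Q \<le> w' Q * kern \<eta> P Q"
    using assms(4) kern_support[OF assms(1), of P Q] kern_nonneg[OF assms(1), of P Q]
    by (cases "kern \<eta> P Q = 0") (auto intro: mult_right_mono)
qed (use assms kern_integrable in auto)

lemma mol_cong:
  assumes "0 < \<eta>"
    and "\<And>Q. dist P Q \<le> \<eta> * (1 + norm P) \<Longrightarrow> w Q = w' Q"
  shows "mol \<eta> w P = mol \<eta> w' P"
  unfolding mol_def
proof (rule Bochner_Integration.integral_cong)
  show "w Q * kern \<eta> P Q = w' Q * kern \<eta> P Q" for Q
    using assms(2)[of Q] kern_support(2)[OF assms(1), of P Q] by auto
qed simp

lemma mol_near:
  assumes "0 < \<eta>" "continuous_on UNIV w"
    and "\<And>Q. norm (gmul P (ginv Q)) < \<eta> \<Longrightarrow> dist P Q \<le> \<eta> * (1 + norm P) \<Longrightarrow> \<bar>w Q - c\<bar> \<le> d"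
  shows "\<bar>mol \<eta> w P - c\<bar> \<le> d"
proof -
  have "mol \<eta> w P \<le> mol \<eta> (\<lambda>Q. c + d) P"
    by (rule mol_mono) (use assms in \<open>force intro!: continuous_intros\<close>)+
  moreover have "mol \<eta> (\<lambda>Q. c - d) P \<le> mol \<eta> w P"
    by (rule mol_mono) (use assms in \<open>force intro!: continuous_intros\<close>)+
  ultimately show ?thesis
    using assms(1) by (simp add: mol_const)
qed

lemma mol_eq_integral:
  assumes "0 < \<eta>" "continuous_on UNIV w" "cball P (\<eta> * (1 + norm P)) \<subseteq> cbox a b"
  shows "mol \<eta> w P = integral (cbox a b) (\<lambda>Q. w Q * kern \<eta> P Q)"
proof -
  have 0: "w Q * kern \<eta> P Q = 0" if "Q \<notin> cbox a b" for Q
    using that assms(3) kern_support[OF assms(1), of P Q] by force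
  have "integral UNIV (\<lambda>Q. w Q * kern \<eta> P Q) = mol \<eta> w P"
    unfolding mol_def by (rule integral_lborel[OF kern_integrable[OF assms(1,2)]])
  moreover have "integral UNIV (\<lambda>Q. w Q * kern \<eta> P Q) =
      integral UNIV (\<lambda>Q. if Q \<in> cbox a b then w Q * kern \<eta> P Q else 0)"
    by (rule arg_cong[where f="integral UNIV"]) (use 0 in auto)
  ultimately show ?thesis
    by (simp add: integral_restrict_UNIV)
qed

lemma kern_C2_param: obtains d1 d2 where "C2_param (kern \<eta>) d1 d2"
  using C2_on_product_param[OF C2_on_kern, of \<eta>] by auto

text \<open>The support of the kernel seen from \<open>P\<close> grows with \<open>P\<close>; a
  single box for a whole ball of points is needed to differentiate under the integral.\<close>

lemma mol_box:
  assumes "0 < \<eta>" "norm P < R" "cball 0 (R + \<eta> * (1 + R)) \<subseteq> cbox a b"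
  shows "cball P (\<eta> * (1 + norm P)) \<subseteq> cbox a b"
proof -
  have *: "\<eta> * (1 + norm P) \<le> \<eta> * (1 + R)"
    using assms by (intro mult_left_mono) auto
  have "norm Q \<le> R + \<eta> * (1 + R)" if "dist P Q \<le> \<eta> * (1 + norm P)" for Q
    using that * assms(2) norm_triangle_sub[of Q P] by (simp add: dist_norm norm_minus_commute)
  then have "cball P (\<eta> * (1 + norm P)) \<subseteq> cball 0 (R + \<eta> * (1 + R))"
    by auto
  with assms(3) show ?thesis by blast
qed

lemma mol_C2_with:
  assumes \<eta>: "0 < \<eta>" and w: "continuous_on UNIV w" and d: "C2_param (kern \<eta>) d1 d2"
    and ab: "cball 0 (R + \<eta> * (1 + R)) \<subseteq> cbox a b"
  shows "C2_with (ball 0 R) (mol \<eta> w)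
    (\<lambda>P. integral (cbox a b) (\<lambda>Q. w Q *\<^sub>R d1 P Q))
    (\<lambda>P. integral (cbox a b) (\<lambda>Q. w Q *\<^sub>R d2 P Q))"
proof (rule C2_with_transform[OF C2_with_subset[OF C2_with_integral[OF d w]]])
  show "integral (cbox a b) (\<lambda>Q. w Q * kern \<eta> P Q) = mol \<eta> w P" if "P \<in> ball 0 R" for P
    using that by (intro mol_eq_integral[OF \<eta> w mol_box[OF \<eta> _ ab], symmetric]) simp
qed simp_all

lemma mol_C2:
  assumes "0 < \<eta>" "continuous_on UNIV w"
  obtains D1 D2 where "C2_with (ball 0 R) (mol \<eta> w) D1 D2"
proof -
  obtain d1 d2 where d: "C2_param (kern \<eta>) d1 d2"
    by (rule kern_C2_param)
  obtain a where "cball 0 (R + \<eta> * (1 + R)) \<subseteq> cbox (- a) (a :: heis \<times> real)"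
    using bounded_subset_cbox_symmetric[OF bounded_cball] by blast
  from mol_C2_with[OF assms d this] that show ?thesis by blast
qed

lemma mol_continuous:
  assumes "0 < \<eta>" "continuous_on UNIV w"
  shows "continuous_on UNIV (mol \<eta> w)"
proof (rule continuous_at_imp_continuous_on, rule ballI)
  fix P :: "heis \<times> real"
  obtain D1 D2 where "C2_with (ball 0 (norm P + 1)) (mol \<eta> w) D1 D2"
    using mol_C2[OF assms] by blast
  from C2_withD(1)[OF this, of P] show "isCont (mol \<eta> w) P"
    by (simp add: has_derivative_continuous)
qed

section \<open>Finite-difference approximation of left-invariant operators\<close>

text \<open>The common shape of the smallness choices below: \<open>s\<close> is a perturbation (a
  step, a group element, a time) and its effect is to be small uniformly over a compact set of
  points.\<close>

lemma uniform_at_0: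
  fixes H :: "'c::euclidean_space \<times> 'd::euclidean_space \<Rightarrow> real"
  assumes "continuous_on UNIV H" "compact K" "0 < e"
  obtains \<delta> where "0 < \<delta>" "\<And>s x. norm s < \<delta> \<Longrightarrow> x \<in> K \<Longrightarrow> \<bar>H (s, x) - H (0, x)\<bar> < e"
proof -
  have "uniformly_continuous_on (cball 0 1 \<times> K) H"
    by (intro compact_uniformly_continuous compact_Times continuous_on_subset[OF assms(1)] assms)
      auto
  then obtain \<delta> where \<delta>: "\<delta> > 0" "\<And>X Y. X \<in> cball 0 1 \<times> K \<Longrightarrow> Y \<in> cball 0 1 \<times> K \<Longrightarrow> dist Y X < \<delta> \<Longrightarrow> dist (H Y) (H X) < e"
    unfolding uniformly_continuous_on_def using \<open>0 < e\<close> by metis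
  show ?thesis
  proof (rule that[of "min \<delta> 1"])
    fix s :: 'c and x assume "norm s < min \<delta> 1" "x \<in> K"
    then show "\<bar>H (s, x) - H (0, x)\<bar> < e"
      using \<delta>(2)[of "(0, x)" "(s, x)"] by (simp add: dist_Pair_Pair dist_real_def)
  qed (use \<delta> in auto)
qed

lemma norm_fld: "norm (fld g P) \<le> norm g * (1 + norm P)"
proof -
  obtain a b s where g: "g = (a, b, s)" by (cases g)
  obtain x y z t where P: "P = ((x, y, z), t)" by (rule st_cases)
  \<comment> \<open>The field at \<open>P\<close> is the displacement of \<open>ginv P\<close> under
    left translation by \<open>gvec g\<close>, so the bound for the group applies.\<close>
  have "fld g P = gmul (gvec g) (ginv P) - ginv P"
    by (simp add: g P gmul_simp ginv_simp)
  moreover have "norm (gvec g) = norm g"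
    by (simp add: g norm_Pair algebra_simps)
  ultimately show ?thesis
    using norm_gmul_diff[of "gvec g" "ginv P"] by simp
qed

context
  fixes g1 g2 g3 :: "real \<times> real \<times> real"
begin

text \<open>
  \<open>mop\<close> acts on the first and second derivatives \<open>D1\<close>, \<open>D2\<close> of a function. Its approximation
  \<open>dop \<tau>\<close> acts on the function itself and is a multiple of \<open>avg \<tau> - id\<close>, where \<open>avg \<tau>\<close> averages
  over right translates. Hence it commutes with left translations and has a maximum principle.
\<close>

definition mop :: "(heis \<times> real \<Rightarrow> (heis \<times> real) \<Rightarrow>\<^sub>L real) \<Rightarrow>
    (heis \<times> real \<Rightarrow> (heis \<times> real) \<Rightarrow>\<^sub>L (heis \<times> real) \<Rightarrow>\<^sub>L real) \<Rightarrow> heis \<times> real \<Rightarrow> real" where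
  "mop D1 D2 P = D2 P (fld g1 P) (fld g1 P) + D2 P (fld g2 P) (fld g2 P) + D1 P (fld g3 P)"

definition avg :: "real \<Rightarrow> (heis \<times> real \<Rightarrow> real) \<Rightarrow> heis \<times> real \<Rightarrow> real" where
  "avg \<tau> \<phi> P = (\<phi> (gmul P (gvec (\<tau> *\<^sub>R g1))) + \<phi> (gmul P (gvec ((- \<tau>) *\<^sub>R g1))) +
     \<phi> (gmul P (gvec (\<tau> *\<^sub>R g2))) + \<phi> (gmul P (gvec ((- \<tau>) *\<^sub>R g2))) +
     \<phi> (gmul P (gvec (\<tau>\<^sup>2 *\<^sub>R g3)))) / 5"

definition dop :: "real \<Rightarrow> (heis \<times> real \<Rightarrow> real) \<Rightarrow> heis \<times> real \<Rightarrow> real" where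
  "dop \<tau> \<phi> P = 5 / \<tau>\<^sup>2 * (avg \<tau> \<phi> P - \<phi> P)"

text \<open>Steps of size \<open>\<tau>\<close> for the two second-order directions and of size
  \<open>\<tau>\<^sup>2\<close> for the first-order one bring all three quotients to the same
  denominator. Equal coefficients are what make the sum a multiple of an average minus the
  identity.\<close>

lemma dop_eq: "dop \<tau> \<phi> P =
    (\<phi> (P + \<tau> *\<^sub>R fld g1 P) + \<phi> (P - \<tau> *\<^sub>R fld g1 P) - 2 * \<phi> P) / \<tau>\<^sup>2 +
    (\<phi> (P + \<tau> *\<^sub>R fld g2 P) + \<phi> (P - \<tau> *\<^sub>R fld g2 P) - 2 * \<phi> P) / \<tau>\<^sup>2 +
    (\<phi> (P + \<tau>\<^sup>2 *\<^sub>R fld g3 P) - \<phi> P) / \<tau>\<^sup>2"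
  unfolding dop_def avg_def gmul_gvec
  by (cases "\<tau> = 0") (simp_all add: field_simps)

text \<open>The symmetrized restriction to the line is even, so its first derivative at 0 vanishes.
  Taylor's formula with Lagrange remainder then expresses the quotient as the mean of two exact
  second derivatives at intermediate points, and the error is the oscillation of
  \<open>D2\<close>.\<close>

lemma second_difference:
  fixes D1 :: "'a::real_normed_vector \<Rightarrow> 'a \<Rightarrow>\<^sub>L real"
  assumes D: "C2_with UNIV \<phi> D1 D2" and "0 < \<tau>"
    and near: "\<And>s. \<bar>s\<bar> \<le> \<tau> \<Longrightarrow> \<bar>D2 (P + s *\<^sub>R \<xi>) \<xi> \<xi> - D2 P \<xi> \<xi>\<bar> \<le> e"
  shows "\<bar>(\<phi> (P + \<tau> *\<^sub>R \<xi>) + \<phi> (P - \<tau> *\<^sub>R \<xi>) - 2 * \<phi> P) / \<tau>\<^sup>2 - D2 P \<xi> \<xi>\<bar> \<le> e"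
proof -
  have midpoint_dev: "\<bar>a - c\<bar> \<le> e \<Longrightarrow> \<bar>b - c\<bar> \<le> e \<Longrightarrow> \<bar>(a + b) / 2 - c\<bar> \<le> e" for a b c :: real
    by (simp add: abs_le_iff field_simps)
  define g where "g = (\<lambda>s. \<phi> (P + s *\<^sub>R \<xi>) + \<phi> (P + (- s) *\<^sub>R \<xi>))"
  define g' where "g' = (\<lambda>s. D1 (P + s *\<^sub>R \<xi>) \<xi> - D1 (P + (- s) *\<^sub>R \<xi>) \<xi>)"
  define g'' where "g'' = (\<lambda>s. D2 (P + s *\<^sub>R \<xi>) \<xi> \<xi> + D2 (P + (- s) *\<^sub>R \<xi>) \<xi> \<xi>)"
  have l1: "((\<lambda>s. P + s *\<^sub>R \<xi>) has_derivative (\<lambda>r. r *\<^sub>R \<xi>)) (at s)" for s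
    by (auto intro!: derivative_eq_intros)
  have l2: "((\<lambda>s. P + (- s) *\<^sub>R \<xi>) has_derivative (\<lambda>r. (- r) *\<^sub>R \<xi>)) (at s)" for s
    by (auto intro!: derivative_eq_intros)
  have "(g has_derivative (\<lambda>r. D1 (P + s *\<^sub>R \<xi>) (r *\<^sub>R \<xi>) + D1 (P + (- s) *\<^sub>R \<xi>) ((- r) *\<^sub>R \<xi>))) (at s)" for s
    unfolding g_def
    by (intro has_derivative_add has_derivative_compose[OF l1 C2_withD(1)[OF D]]
        has_derivative_compose[OF l2 C2_withD(1)[OF D]]) auto
  then have dg: "(g has_real_derivative g' s) (at s)" for s
    unfolding has_field_derivative_def
    by (rule has_derivative_eq_rhs)
      (simp add: g'_def fun_eq_iff blinfun.scaleR_right blinfun.minus_right algebra_simps)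
  have "(g' has_derivative (\<lambda>r. D2 (P + s *\<^sub>R \<xi>) (r *\<^sub>R \<xi>) \<xi> - D2 (P + (- s) *\<^sub>R \<xi>) ((- r) *\<^sub>R \<xi>) \<xi>)) (at s)" for s
    unfolding g'_def
    by (intro has_derivative_diff bounded_linear.has_derivative[OF blinfun.bounded_linear_left]
        has_derivative_compose[OF l1 C2_withD(2)[OF D]]
        has_derivative_compose[OF l2 C2_withD(2)[OF D]]) auto
  then have dg': "(g' has_real_derivative g'' s) (at s)" for s
    unfolding has_field_derivative_def
    by (rule has_derivative_eq_rhs)
      (simp add: g''_def fun_eq_iff blinfun.scaleR_right blinfun.minus_right
        blinfun.scaleR_left blinfun.minus_left algebra_simps)
  define diff :: "nat \<Rightarrow> real \<Rightarrow> real" where "diff = (\<lambda>n. if n = 0 then g else if n = 1 then g' else g'')"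
  have "\<exists>t>0. t < \<tau> \<and> g \<tau> = (\<Sum>m<2. diff m 0 / fact m * \<tau> ^ m) + diff 2 t / fact 2 * \<tau> ^ 2"
    by (rule Maclaurin) (use \<open>0 < \<tau>\<close> dg dg' in \<open>auto simp: diff_def less_2_cases_iff\<close>)
  then obtain t where t: "0 < t" "t < \<tau>"
    and eq: "g \<tau> = (\<Sum>m<2. diff m 0 / fact m * \<tau> ^ m) + diff 2 t / fact 2 * \<tau> ^ 2"
    by blast
  have "g \<tau> = 2 * \<phi> P + g'' t / 2 * \<tau>\<^sup>2"
    using eq by (simp add: diff_def numeral_2_eq_2 g_def g'_def)
  then have "(\<phi> (P + \<tau> *\<^sub>R \<xi>) + \<phi> (P - \<tau> *\<^sub>R \<xi>) - 2 * \<phi> P) / \<tau>\<^sup>2 = g'' t / 2"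
    using \<open>0 < \<tau>\<close> by (simp add: g_def field_simps)
  moreover have "\<bar>D2 (P + t *\<^sub>R \<xi>) \<xi> \<xi> - D2 P \<xi> \<xi>\<bar> \<le> e"
    "\<bar>D2 (P + (- t) *\<^sub>R \<xi>) \<xi> \<xi> - D2 P \<xi> \<xi>\<bar> \<le> e"
    using near[of t] near[of "- t"] t by auto
  then have "\<bar>g'' t / 2 - D2 P \<xi> \<xi>\<bar> \<le> e"
    using midpoint_dev unfolding g''_def by blast
  ultimately show ?thesis
    by (simp only:)
qed

lemma first_difference:
  fixes D1 :: "'a::real_normed_vector \<Rightarrow> 'a \<Rightarrow>\<^sub>L real"
  assumes D: "C2_with UNIV \<phi> D1 D2" and "0 < r"
    and near: "\<And>s. \<bar>s\<bar> \<le> r \<Longrightarrow> \<bar>D1 (P + s *\<^sub>R \<xi>) \<xi> - D1 P \<xi>\<bar> \<le> e"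
  shows "\<bar>(\<phi> (P + r *\<^sub>R \<xi>) - \<phi> P) / r - D1 P \<xi>\<bar> \<le> e"
proof -
  have l1: "((\<lambda>s. P + s *\<^sub>R \<xi>) has_derivative (\<lambda>r. r *\<^sub>R \<xi>)) (at s)" for s
    by (auto intro!: derivative_eq_intros)
  have "((\<lambda>s. \<phi> (P + s *\<^sub>R \<xi>)) has_derivative (\<lambda>r. D1 (P + s *\<^sub>R \<xi>) (r *\<^sub>R \<xi>))) (at s)" for s
    by (intro has_derivative_compose[OF l1 C2_withD(1)[OF D]]) auto
  then have dg: "((\<lambda>s. \<phi> (P + s *\<^sub>R \<xi>)) has_real_derivative D1 (P + s *\<^sub>R \<xi>) \<xi>) (at s)" for s
    unfolding has_field_derivative_def
    by (rule has_derivative_eq_rhs) (simp add: fun_eq_iff blinfun.scaleR_right)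
  obtain t where "0 < t" "t < r" and eq: "\<phi> (P + r *\<^sub>R \<xi>) - \<phi> (P + 0 *\<^sub>R \<xi>) = (r - 0) * D1 (P + t *\<^sub>R \<xi>) \<xi>"
    using MVT2[OF \<open>0 < r\<close> dg] by blast
  then show ?thesis
    using near[of t] \<open>0 < r\<close> by simp
qed

text \<open>Uniformity in \<open>Q\<close> is the point: \<open>F\<close> will be the kernel and
  \<open>Q\<close> its integration variable, so the estimate can be integrated.\<close>

lemma dop_tendsto_mop:
  fixes F :: "heis \<times> real \<Rightarrow> heis \<times> real \<Rightarrow> real"
  assumes F: "C2_param F d1 d2" and K: "compact K" "compact K'" and "0 < e"
  obtains \<tau>0 where "0 < \<tau>0" "\<And>\<tau> P Q. 0 < \<tau> \<Longrightarrow> \<tau> < \<tau>0 \<Longrightarrow> P \<in> K \<Longrightarrow> Q \<in> K' \<Longrightarrow>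
    \<bar>dop \<tau> (\<lambda>P. F P Q) P - mop (\<lambda>P. d1 P Q) (\<lambda>P. d2 P Q) P\<bar> \<le> e"
proof -
  have D: "\<And>Q. C2_with UNIV (\<lambda>P. F P Q) (\<lambda>P. d1 P Q) (\<lambda>P. d2 P Q)"
    and cont: "continuous_on UNIV (\<lambda>(P, Q). d1 P Q)" "continuous_on UNIV (\<lambda>(P, Q). d2 P Q)"
    using F by (auto simp: C2_param_def)
  have c1: "continuous_on S (\<lambda>x. d1 (g x) (h x))" if "continuous_on S g" "continuous_on S h"
    for g h and S :: "'c::topological_space set"
    using continuous_on_compose2[OF cont(1) continuous_on_Pair[OF that]] by auto
  have c2: "continuous_on S (\<lambda>x. d2 (g x) (h x))" if "continuous_on S g" "continuous_on S h"
    for g h and S :: "'c::topological_space set"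
    using continuous_on_compose2[OF cont(2) continuous_on_Pair[OF that]] by auto
  have e3: "0 < e / 3" using \<open>0 < e\<close> by simp
  define H where "H g = (\<lambda>(s, P, Q). d2 (P + s *\<^sub>R fld g P) Q (fld g P) (fld g P))" for g :: "real \<times> real \<times> real"
  define H3 where "H3 = (\<lambda>(s, P, Q). d1 (P + s *\<^sub>R fld g3 P) Q (fld g3 P))"
  have H: "continuous_on UNIV (H g)" for g
    unfolding H_def split_beta by (intro continuous_intros c2)
  have H3: "continuous_on UNIV H3"
    unfolding H3_def split_beta by (intro continuous_intros c1)
  note KK = compact_Times[OF K]
  obtain \<delta>1 where d1: "0 < \<delta>1" "\<And>s X. norm s < \<delta>1 \<Longrightarrow> X \<in> K \<times> K' \<Longrightarrow> \<bar>H g1 (s, X) - H g1 (0, X)\<bar> < e / 3"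
    using uniform_at_0[OF H KK e3] by blast
  obtain \<delta>2 where d2: "0 < \<delta>2" "\<And>s X. norm s < \<delta>2 \<Longrightarrow> X \<in> K \<times> K' \<Longrightarrow> \<bar>H g2 (s, X) - H g2 (0, X)\<bar> < e / 3"
    using uniform_at_0[OF H KK e3] by blast
  obtain \<delta>3 where d3: "0 < \<delta>3" "\<And>s X. norm s < \<delta>3 \<Longrightarrow> X \<in> K \<times> K' \<Longrightarrow> \<bar>H3 (s, X) - H3 (0, X)\<bar> < e / 3"
    using uniform_at_0[OF H3 KK e3] by blast
  show ?thesis
  proof (rule that[of "min 1 (min \<delta>1 (min \<delta>2 \<delta>3))"])
    fix \<tau> and P Q :: "heis \<times> real"
    assume \<tau>: "0 < \<tau>" "\<tau> < min 1 (min \<delta>1 (min \<delta>2 \<delta>3))" and P: "P \<in> K" and Q: "Q \<in> K'"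
    have \<tau>2: "\<tau>\<^sup>2 \<le> \<tau>" "0 < \<tau>\<^sup>2"
      using \<tau> by (auto simp: power2_eq_square mult_le_cancel_right1)
    have 1: "\<bar>(F (P + \<tau> *\<^sub>R fld g1 P) Q + F (P - \<tau> *\<^sub>R fld g1 P) Q - 2 * F P Q) / \<tau>\<^sup>2 - d2 P Q (fld g1 P) (fld g1 P)\<bar> \<le> e / 3"
      by (rule second_difference[OF D \<tau>(1)])
        (use d1(2)[of _ "(P, Q)", unfolded H_def split_conv] \<tau> P Q in \<open>fastforce intro: less_imp_le\<close>)
    have 2: "\<bar>(F (P + \<tau> *\<^sub>R fld g2 P) Q + F (P - \<tau> *\<^sub>R fld g2 P) Q - 2 * F P Q) / \<tau>\<^sup>2 - d2 P Q (fld g2 P) (fld g2 P)\<bar> \<le> e / 3"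
      by (rule second_difference[OF D \<tau>(1)])
        (use d2(2)[of _ "(P, Q)", unfolded H_def split_conv] \<tau> P Q in \<open>fastforce intro: less_imp_le\<close>)
    have 3: "\<bar>(F (P + \<tau>\<^sup>2 *\<^sub>R fld g3 P) Q - F P Q) / \<tau>\<^sup>2 - d1 P Q (fld g3 P)\<bar> \<le> e / 3"
      by (rule first_difference[OF D \<tau>2(2)])
        (use d3(2)[of _ "(P, Q)", unfolded H3_def split_conv] \<tau> \<tau>2 P Q in \<open>fastforce intro: less_imp_le\<close>)
    show "\<bar>dop \<tau> (\<lambda>P. F P Q) P - mop (\<lambda>P. d1 P Q) (\<lambda>P. d2 P Q) P\<bar> \<le> e"
      using 1 2 3 unfolding dop_eq mop_def by linarith
  qed (use d1 d2 d3 in auto)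
qed

text \<open>The displacement along a field grows linearly with the point, so a far point could jump
  back into the support; a small step excludes this for all far points at once.\<close>

lemma dop_vanish:
  assumes F: "\<And>P. \<rho> < norm P \<Longrightarrow> F P = 0" and "0 \<le> \<rho>"
  obtains \<tau>0 where "0 < \<tau>0" "\<And>\<tau> P. 0 < \<tau> \<Longrightarrow> \<tau> < \<tau>0 \<Longrightarrow> 2 * \<rho> + 2 < norm P \<Longrightarrow> dop \<tau> F P = 0"
proof -
  define m where "m = 1 + norm g1 + norm g2 + norm g3"
  have m: "1 \<le> m" "norm g1 \<le> m" "norm g2 \<le> m" "norm g3 \<le> m"
    unfolding m_def by auto
  show ?thesis
  \<comment> \<open>With this step a point moves by at most a quarter of \<open>1 + norm P\<close>,
    which cannot carry it from outside radius \<open>2 * \<rho> + 2\<close> into radius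
    \<open>\<rho>\<close>.\<close>
  proof (rule that[of "1 / (4 * m)"])
    fix \<tau> and P :: "heis \<times> real"
    assume \<tau>: "0 < \<tau>" "\<tau> < 1 / (4 * m)" and P: "2 * \<rho> + 2 < norm P"
    have \<tau>m: "\<tau> * m \<le> 1/4" 
      using \<tau> m by (simp add: field_simps)
    have "\<tau> * 1 \<le> \<tau> * m" using \<tau> m by (intro mult_left_mono) auto
    then have "\<tau> \<le> 1" using \<tau>m by linarith
    then have \<tau>2: "\<tau>\<^sup>2 \<le> \<tau>" using \<tau> by (simp add: power2_eq_square mult_le_cancel_right1)
    have far: "F (P + r *\<^sub>R fld g P) = 0" if "norm g \<le> m" "\<bar>r\<bar> \<le> \<tau>" for r g
    proof (rule F)
      have "\<bar>r\<bar> * norm (fld g P) \<le> \<tau> * (m * (1 + norm P))"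
        using that \<tau> by (intro mult_mono order_trans[OF norm_fld] mult_right_mono) auto
      also have "\<dots> = (\<tau> * m) * (1 + norm P)" by simp
      also have "\<dots> \<le> 1/4 * (1 + norm P)"
        using \<tau>m by (intro mult_right_mono) auto
      finally have "norm (r *\<^sub>R fld g P) \<le> 1/4 * (1 + norm P)" by simp
      moreover have "norm P \<le> norm (P + r *\<^sub>R fld g P) + norm (r *\<^sub>R fld g P)"
        by (metis add_diff_cancel_right' norm_triangle_ineq4)
      moreover have "a \<le> 1/4 * (1 + n) \<Longrightarrow> n \<le> b + a \<Longrightarrow> 2 * \<rho> + 2 < n \<Longrightarrow> \<rho> < b" for a b n :: real
        using \<open>0 \<le> \<rho>\<close> by (simp add: field_simps)
      ultimately show "\<rho> < norm (P + r *\<^sub>R fld g P)"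
        using P by blast
    qed
    have "F (P + \<tau> *\<^sub>R fld g P) = 0" "F (P - \<tau> *\<^sub>R fld g P) = 0" if "norm g \<le> m" for g
      using far[OF that, of \<tau>] far[OF that, of "- \<tau>"] \<tau> by auto
    moreover have "F (P + \<tau>\<^sup>2 *\<^sub>R fld g3 P) = 0"
      using far[OF m(4), of "\<tau>\<^sup>2"] \<tau>2 by auto
    moreover have "F P = 0"
      using F P \<open>0 \<le> \<rho>\<close> by auto
    ultimately show "dop \<tau> F P = 0"
      unfolding dop_eq using m by simp
  qed (use m in auto)
qed

section \<open>Averages, their maximum principle and their resolvent\<close>

lemma avg_mono: "(\<And>P. W P \<le> W' P) \<Longrightarrow> avg \<tau> W P \<le> avg \<tau> W' P"
  unfolding avg_def by (intro divide_right_mono add_mono) auto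

lemma avg_const: "avg \<tau> (\<lambda>P. c) P = c"
  by (simp add: avg_def)

lemma avg_diff: "avg \<tau> (\<lambda>P. W P - W' P) P = avg \<tau> W P - avg \<tau> W' P"
  by (simp add: avg_def diff_divide_distrib add_divide_distrib)

lemma avg_left: "avg \<tau> (\<lambda>P. W (gmul K P)) P = avg \<tau> W (gmul K P)"
  by (simp add: avg_def gmul_assoc)

lemma continuous_on_avg:
  assumes "continuous_on UNIV W"
  shows "continuous_on UNIV (avg \<tau> W)"
  unfolding avg_def by (intro continuous_intros continuous_on_compose2[OF assms]) auto

lemma mol_avg:
  assumes "0 < \<eta>" "continuous_on UNIV W"
  shows "mol \<eta> (avg \<tau> W) P = avg \<tau> (mol \<eta> W) P"
proof -
  have c: "continuous_on UNIV (\<lambda>P. W (gmul P \<gamma>))" for \<gamma>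
    by (intro continuous_intros continuous_on_compose2[OF assms(2)]) auto
  have eq: "avg \<tau> W = (\<lambda>P. (1/5) * (W (gmul P (gvec (\<tau> *\<^sub>R g1))) + W (gmul P (gvec ((- \<tau>) *\<^sub>R g1))) +
     W (gmul P (gvec (\<tau> *\<^sub>R g2))) + W (gmul P (gvec ((- \<tau>) *\<^sub>R g2))) +
     W (gmul P (gvec (\<tau>\<^sup>2 *\<^sub>R g3)))))"
    by (simp add: avg_def fun_eq_iff)
  show ?thesis
    unfolding eq mol_scale using assms by (simp add: mol_add c continuous_on_add mol_gmul avg_def)
qed

text \<open>The supremum \<open>S\<close> need not be attained: averages stay below
  \<open>S\<close>, so taking the supremum on both sides gives
  \<open>S \<le> \<theta> * S + (1 - \<theta>) * M\<close>, and boundedness allows solving for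
  \<open>S\<close>.\<close>

lemma discrete_max_principle:
  assumes "\<And>P. W P \<le> B" "0 \<le> \<theta>" "\<theta> < 1"
    and W: "\<And>P. W P \<le> \<theta> * avg \<tau> W P + (1 - \<theta>) * M"
  shows "W P \<le> M"
proof -
  define S where "S = (SUP P. W P)"
  have bdd: "bdd_above (range W)"
    using assms(1) by (meson bdd_above.I2)
  have S: "W P \<le> S" for P
    unfolding S_def using bdd by (simp add: cSUP_upper)
  have "W P \<le> \<theta> * S + (1 - \<theta>) * M" for P
  proof -
    have "avg \<tau> W P \<le> S"
      using avg_mono[of W "\<lambda>_. S" \<tau> P] S by (simp add: avg_const)
    then show ?thesis
      using W[of P] mult_left_mono[OF _ \<open>0 \<le> \<theta>\<close>] by fastforce
  qed
  then have "S \<le> \<theta> * S + (1 - \<theta>) * M"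
    unfolding S_def by (intro cSUP_least) auto
  then have "(1 - \<theta>) * S \<le> (1 - \<theta>) * M"
    by (simp add: algebra_simps)
  with \<open>\<theta> < 1\<close> have "S \<le> M" by simp
  with S[of P] show ?thesis by linarith
qed

text \<open>Averaging has norm one, so the right-hand side is a contraction with factor
  \<open>\<theta>\<close> on the complete space of bounded continuous functions. The sharp bound
  \<open>B\<close> then comes from the maximum principle, applied to the fixed point and to its
  negative.\<close>

lemma resolvent_exists:
  assumes w: "continuous_on UNIV w" and B: "\<And>P. \<bar>w P\<bar> \<le> B" and \<theta>: "0 \<le> \<theta>" "\<theta> < 1"
  obtains V where "continuous_on UNIV V" "\<And>P. \<bar>V P\<bar> \<le> B"
    "\<And>P. V P = \<theta> * avg \<tau> V P + (1 - \<theta>) * w P"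
proof -
  define T where "T V = Bcontfun (\<lambda>P. \<theta> * avg \<tau> (apply_bcontfun V) P + (1 - \<theta>) * w P)"
    for V :: "(heis \<times> real) \<Rightarrow>\<^sub>C real"
  have avg_bd: "\<bar>avg \<tau> (apply_bcontfun V) P\<bar> \<le> norm V" for V :: "(heis \<times> real) \<Rightarrow>\<^sub>C real" and P
  proof -
    have "- norm V \<le> V P \<and> V P \<le> norm V" for P
      using norm_bounded[of V P] by auto
    then show ?thesis
      using avg_mono[of "apply_bcontfun V" "\<lambda>_. norm V" \<tau> P]
        avg_mono[of "\<lambda>_. - norm V" "apply_bcontfun V" \<tau> P] by (auto simp: avg_const)
  qed
  have T: "apply_bcontfun (T V) = (\<lambda>P. \<theta> * avg \<tau> (apply_bcontfun V) P + (1 - \<theta>) * w P)" for V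
    unfolding T_def
  proof (rule Bcontfun_inverse, rule bcontfun_normI)
    show "continuous_on UNIV (\<lambda>P. \<theta> * avg \<tau> (apply_bcontfun V) P + (1 - \<theta>) * w P)"
      by (intro continuous_intros w continuous_on_avg) auto
    show "norm (\<theta> * avg \<tau> (apply_bcontfun V) P + (1 - \<theta>) * w P) \<le> \<theta> * norm V + (1 - \<theta>) * B" for P
    proof -
      have "\<bar>\<theta> * avg \<tau> (apply_bcontfun V) P\<bar> \<le> \<theta> * norm V"
        using \<theta> avg_bd by (simp add: abs_mult mult_left_mono)
      moreover have "\<bar>(1 - \<theta>) * w P\<bar> \<le> (1 - \<theta>) * B"
        using \<theta> B by (simp add: abs_mult mult_left_mono)
      ultimately show ?thesis by (simp add: abs_le_iff)
    qed
  qed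
  have "dist (T V) (T V') \<le> \<theta> * dist V V'" for V V'
  proof (rule dist_bound)
    fix P
    have "T V P - T V' P = \<theta> * avg \<tau> (apply_bcontfun (V - V')) P"
      by (simp add: T minus_bcontfun.rep_eq avg_diff algebra_simps)
    then have "\<bar>T V P - T V' P\<bar> = \<theta> * \<bar>avg \<tau> (apply_bcontfun (V - V')) P\<bar>"
      using \<theta> by (simp add: abs_mult)
    also have "\<dots> \<le> \<theta> * norm (V - V')"
      by (intro mult_left_mono avg_bd \<theta>)
    finally show "dist (T V P) (T V' P) \<le> \<theta> * dist V V'"
      by (simp add: dist_norm)
  qed
  then obtain V where V: "T V = V"
    using banach_fix_type[OF \<theta>, of T] by auto
  have eq: "V P = \<theta> * avg \<tau> (apply_bcontfun V) P + (1 - \<theta>) * w P" for P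
    using fun_cong[OF T[of V], of P] unfolding V .
  have "V P \<le> B" for P
  proof (rule discrete_max_principle[OF _ \<theta>])
    show "V P \<le> norm V" for P
      using norm_bounded[of V P] by auto
    show "V P \<le> \<theta> * avg \<tau> (apply_bcontfun V) P + (1 - \<theta>) * B" for P
    proof -
      have "(1 - \<theta>) * w P \<le> (1 - \<theta>) * B"
        using \<theta> B[of P] by (intro mult_left_mono) auto
      then show ?thesis using eq[of P] by linarith
    qed
  qed
  moreover have "- V P \<le> B" for P
  proof (rule discrete_max_principle[OF _ \<theta>])
    show "- V P \<le> norm V" for P
      using norm_bounded[of V P] by auto
    have *: "(1 - \<theta>) * - w P \<le> (1 - \<theta>) * B" for P
      using \<theta> B[of P] by (intro mult_left_mono) auto
    show "- V P \<le> \<theta> * avg \<tau> (\<lambda>P. - V P) P + (1 - \<theta>) * B" for P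
      using eq[of P] *[of P] avg_diff[of \<tau> "\<lambda>_. 0" "apply_bcontfun V" P] by (simp add: avg_const algebra_simps)
  qed
  ultimately show ?thesis
    by (intro that[of "apply_bcontfun V"] eq continuous_on_apply_bcontfun) (simp add: abs_le_iff)
qed

end

section \<open>Linear supersolutions are preserved by mollification\<close>

lemma C2_with_unique:
  assumes "C2_with U \<phi> D1 D2" "C2_with V \<phi> E1 E2" "open U" "open V" "x \<in> U" "x \<in> V"
  shows "D1 x = E1 x" "D2 x = E2 x"
proof -
  have 1: "D1 y = E1 y" if "y \<in> U \<inter> V" for y
    using has_derivative_unique[OF C2_withD(1)[OF assms(1)] C2_withD(1)[OF assms(2)]] that
    by (simp add: blinfun_apply_inject)
  then show "D1 x = E1 x" using assms by blast
  have "(E1 has_derivative blinfun_apply (D2 x)) (at x)"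
    by (rule has_derivative_transform_within_open[OF C2_withD(2)[OF assms(1,5)], of "U \<inter> V"])
      (use assms 1 in auto)
  then show "D2 x = E2 x"
    using has_derivative_unique[OF _ C2_withD(2)[OF assms(2,6)]] blinfun_apply_inject by blast
qed

lemma continuous_on_mop:
  assumes "C2_with U \<phi> D1 D2"
  shows "continuous_on U (mop g1 g2 g3 D1 D2)"
  unfolding mop_def by (intro continuous_intros C2_withD(3,4)[OF assms])

section \<open>Symmetries, comparison and resolvent for the difference operator\<close>

lemma dop_mol:
  assumes "0 < \<eta>" "continuous_on UNIV W"
  shows "mol \<eta> (dop g1 g2 g3 \<tau> W) P = dop g1 g2 g3 \<tau> (mol \<eta> W) P"
proof -
  have "dop g1 g2 g3 \<tau> W = (\<lambda>P. 5 / \<tau>\<^sup>2 * (avg g1 g2 g3 \<tau> W P + (- 1) * W P))"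
    by (simp add: dop_def fun_eq_iff)
  then show ?thesis
    using assms mol_scale[of \<eta> "- 1" W P]
    by (simp only: mol_scale mol_add continuous_on_avg continuous_on_mult continuous_on_const mol_avg)
      (simp add: dop_def)
qed

lemma dop_left: "dop g1 g2 g3 \<tau> (\<lambda>P. W (gmul K P)) P = dop g1 g2 g3 \<tau> W (gmul K P)"
  by (simp add: dop_def avg_left)

lemma dop_diff: "dop g1 g2 g3 \<tau> (\<lambda>P. W P - W' P) P = dop g1 g2 g3 \<tau> W P - dop g1 g2 g3 \<tau> W' P"
proof -
  define c where "c = 5 / \<tau>\<^sup>2"
  show ?thesis
    by (simp add: dop_def avg_diff algebra_simps flip: c_def)
qed

lemma dop_affine: "dop g1 g2 g3 \<tau> (\<lambda>P. W P + a * W' P + b) P = dop g1 g2 g3 \<tau> W P + a * dop g1 g2 g3 \<tau> W' P"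
proof -
  define c where "c = 5 / \<tau>\<^sup>2"
  have "avg g1 g2 g3 \<tau> (\<lambda>P. W P + a * W' P + b) P = avg g1 g2 g3 \<tau> W P + a * avg g1 g2 g3 \<tau> W' P + b"
    by (simp add: avg_def field_simps)
  then show ?thesis
    by (simp add: dop_def algebra_simps flip: c_def)
qed

lemma dop_max_principle:
  assumes "\<And>P. W P \<le> B" "0 < \<Lambda>" "0 < \<tau>"
    and W: "\<And>P. \<Lambda> * (W P - M) \<le> dop g1 g2 g3 \<tau> W P"
  shows "W P \<le> M"
proof (rule discrete_max_principle[where W=W and \<tau>=\<tau> and B=B])
  define c where "c = 5 / \<tau>\<^sup>2"
  have c: "0 < c" using assms by (simp add: c_def)
  \<comment> \<open>Collecting the terms in \<open>W P\<close> gives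
    \<open>(\<Lambda> + c) * W P\<close> on the left; division by \<open>\<Lambda> + c\<close>
    yields the form of the discrete principle with this factor as \<open>\<theta>\<close>.\<close>
  show "0 \<le> c / (\<Lambda> + c)" "c / (\<Lambda> + c) < 1" 
    using c assms by (auto simp: field_simps)
  fix P
  have eq: "1 - c / (\<Lambda> + c) = \<Lambda> / (\<Lambda> + c)"
    using c assms by (simp add: field_simps)
  have "(\<Lambda> + c) * W P \<le> c * avg g1 g2 g3 \<tau> W P + \<Lambda> * M"
    using W[of P] by (simp add: dop_def algebra_simps flip: c_def)
  then show "W P \<le> c / (\<Lambda> + c) * avg g1 g2 g3 \<tau> W P + (1 - c / (\<Lambda> + c)) * M"
    unfolding eq times_divide_eq_left add_divide_distrib[symmetric]
    using c assms by (simp add: pos_le_divide_eq mult.commute)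
qed (use assms in auto)

lemma dop_resolvent:
  assumes "continuous_on UNIV w" "\<And>P. \<bar>w P\<bar> \<le> B" "0 < \<Lambda>" "0 < \<tau>"
  obtains V where "continuous_on UNIV V" "\<And>P. \<bar>V P\<bar> \<le> B"
    "\<And>P. \<Lambda> * (V P - w P) = dop g1 g2 g3 \<tau> V P"
proof -
  define c where "c = 5 / \<tau>\<^sup>2"
  have c: "0 < c" using assms by (simp add: c_def)
  have eq: "1 - c / (\<Lambda> + c) = \<Lambda> / (\<Lambda> + c)"
    using c assms by (simp add: field_simps)
  have \<theta>: "0 \<le> c / (\<Lambda> + c)" "c / (\<Lambda> + c) < 1" 
    using c assms by (auto simp: field_simps)
  obtain V where V: "continuous_on UNIV V" "\<And>P. \<bar>V P\<bar> \<le> B"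
    "\<And>P. V P = c / (\<Lambda> + c) * avg g1 g2 g3 \<tau> V P + (1 - c / (\<Lambda> + c)) * w P"
    using resolvent_exists[OF assms(1,2) \<theta>, where ?g1.0=g1 and ?g2.0=g2 and ?g3.0=g3 and \<tau>=\<tau>] by blast
  have "\<Lambda> * (V P - w P) = dop g1 g2 g3 \<tau> V P" for P
  proof -
    have "(\<Lambda> + c) * V P = c * avg g1 g2 g3 \<tau> V P + \<Lambda> * w P"
    proof -
      have "V P = (c * avg g1 g2 g3 \<tau> V P + \<Lambda> * w P) / (\<Lambda> + c)"
        using V(3)[of P] unfolding eq by (simp add: add_divide_distrib)
      then show ?thesis
        using c assms by (simp add: nonzero_eq_divide_eq mult.commute)
    qed
    then show ?thesis
      by (simp add: dop_def algebra_simps flip: c_def)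
  qed
  with V that show ?thesis by blast
qed

lemma dop_tendsto_single:
  assumes D: "C2_with UNIV \<phi> D1 D2" and K: "compact K" and "0 < e"
  obtains \<tau>0 where "0 < \<tau>0" "\<And>\<tau> P. 0 < \<tau> \<Longrightarrow> \<tau> < \<tau>0 \<Longrightarrow> P \<in> K \<Longrightarrow>
    \<bar>dop g1 g2 g3 \<tau> \<phi> P - mop g1 g2 g3 D1 D2 P\<bar> \<le> e"
proof -
  have "C2_param (\<lambda>P Q :: heis \<times> real. \<phi> P) (\<lambda>P Q. D1 P) (\<lambda>P Q. D2 P)"
    unfolding C2_param_def split_beta
    using D by (auto intro!: continuous_on_compose2[OF C2_withD(3)[OF D]]
        continuous_on_compose2[OF C2_withD(4)[OF D]] continuous_on_compose2[OF C2_withD(5)[OF D]]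
        continuous_on_fst)
  then show ?thesis
  proof (rule dop_tendsto_mop[OF _ K compact_sing[of 0] \<open>0 < e\<close>])
    fix \<tau>0 :: real
    assume "0 < \<tau>0" "\<And>\<tau> P Q. 0 < \<tau> \<Longrightarrow> \<tau> < \<tau>0 \<Longrightarrow> P \<in> K \<Longrightarrow> Q \<in> {0 :: heis \<times> real} \<Longrightarrow>
      \<bar>dop g1 g2 g3 \<tau> \<phi> P - mop g1 g2 g3 D1 D2 P\<bar> \<le> e"
    then show thesis by (intro that[of \<tau>0]) auto
  qed
qed

lemma C2_with_pos_cube:
  assumes "C2_with U f D1 D2"
  obtains E1 E2 where "C2_with U (\<lambda>x. (max 0 (f x)) ^ 3) E1 E2"
    "\<And>x. f x \<le> 0 \<Longrightarrow> E1 x = 0 \<and> E2 x = 0"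
proof -
  have 1: "((\<lambda>s. (max 0 s) ^ 3) has_field_derivative 3 * (max 0 (f x)) ^ 2) (at (f x))" for x
    using DERIV_max_power[of 1 "f x"] by (simp add: numeral_eq_Suc)
  have 2: "((\<lambda>s. 3 * (max 0 s) ^ 2) has_field_derivative 3 * (2 * max 0 (f x))) (at (f x))" for x
    using DERIV_cmult[OF DERIV_max_power[of 0 "f x"], of 3] by (simp add: numeral_eq_Suc)
  have 3: "continuous_on (f ` U) (\<lambda>s. 3 * (2 * max 0 s))"
    by (intro continuous_intros)
  show ?thesis
    by (rule that[OF C2_with_compose_real[OF assms 1 2 3]]) simp
qed

text \<open>
  The barrier pays a fixed price \<open>M\<close> at distance \<open>r3\<close> but only \<open>O(\<Lambda>\<^sup>-\<^sup>2)\<close> within distance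
  \<open>r1\<close>, which is negligible against the resolvent parameter \<open>\<Lambda>\<close>.
\<close>

lemma barrier_exists:
  assumes r: "0 < r1" "r1 < r2" "r2 < r3" and "0 \<le> M"
  obtains C where "0 \<le> C" "\<And>\<Lambda>. 0 < \<Lambda> \<Longrightarrow> \<exists>b E1 E2. C2_with UNIV b E1 E2 \<and>
    (\<forall>P. dist P P0 = r3 \<longrightarrow> M \<le> b P) \<and> (\<forall>P. dist P P0 \<le> r1 \<longrightarrow> b P \<le> C / \<Lambda>\<^sup>2) \<and>
    (\<forall>P. dist P P0 \<le> r3 \<longrightarrow> mop g1 g2 g3 E1 E2 P \<le> \<Lambda> * b P)"
proof -
  define \<kappa> where "\<kappa> r P = (max 0 ((norm (P - P0))\<^sup>2 - r\<^sup>2)) ^ 3" for r and P :: "heis \<times> real"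
  have "\<exists>E1 E2. C2_with UNIV (\<kappa> r) E1 E2 \<and> (\<forall>P. (norm (P - P0))\<^sup>2 - r\<^sup>2 \<le> 0 \<longrightarrow> E1 P = 0 \<and> E2 P = 0)" for r
  proof -
    have "C2_on UNIV (\<lambda>P. (norm (P - P0))\<^sup>2 - r\<^sup>2)"
      by (intro C2_intros C2_on_norm_sq)
    then obtain D1 D2 where "C2_with UNIV (\<lambda>P. (norm (P - P0))\<^sup>2 - r\<^sup>2) D1 D2"
      using C2_on_iff by blast
    from C2_with_pos_cube[OF this] show ?thesis
      unfolding \<kappa>_def by metis
  qed
  then obtain A1 A2 B1 B2 where A: "C2_with UNIV (\<kappa> r2) A1 A2"
    and A0: "\<And>P. (norm (P - P0))\<^sup>2 - r2\<^sup>2 \<le> 0 \<Longrightarrow> A1 P = 0 \<and> A2 P = 0"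
    and B: "C2_with UNIV (\<kappa> r1) B1 B2"
    by metis
  have "\<exists>c\<ge>0. \<forall>P\<in>cball P0 r3. \<bar>mop g1 g2 g3 E1 E2 P\<bar> \<le> c"
    if "C2_with UNIV f E1 E2" for f E1 E2
  proof -
    have "compact (mop g1 g2 g3 E1 E2 ` cball P0 r3)"
      by (intro compact_continuous_image continuous_on_subset[OF continuous_on_mop[OF that]]) auto
    then obtain c where "\<forall>y\<in>mop g1 g2 g3 E1 E2 ` cball P0 r3. norm y \<le> c"
      using compact_imp_bounded bounded_iff by metis
    then have "\<bar>mop g1 g2 g3 E1 E2 P\<bar> \<le> max 0 c" if "P \<in> cball P0 r3" for P
      using that by (auto simp: le_max_iff_disj)
    then show ?thesis by (intro exI[of _ "max 0 c"]) auto
  qed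
  then obtain a b where a: "0 \<le> a" "\<And>P. P \<in> cball P0 r3 \<Longrightarrow> \<bar>mop g1 g2 g3 A1 A2 P\<bar> \<le> a"
    and b: "0 \<le> b" "\<And>P. P \<in> cball P0 r3 \<Longrightarrow> \<bar>mop g1 g2 g3 B1 B2 P\<bar> \<le> b"
    using A B by meson
  \<comment> \<open>A lower bound for \<open>\<kappa> r1\<close> outside the ball of radius
    \<open>r2\<close>, that is, wherever the operator applied to \<open>\<kappa> r2\<close> can be
    nonzero.\<close>
  define s where "s = (r2\<^sup>2 - r1\<^sup>2) ^ 3"
  have s: "0 < s" using r by (simp add: s_def power_strict_mono)
  define q where "q = (r3\<^sup>2 - r2\<^sup>2) ^ 3"
  have q: "0 < q" using r by (simp add: q_def power_strict_mono)
  define N where "N = M / q"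
  have N: "0 \<le> N" using q \<open>0 \<le> M\<close> by (simp add: N_def)
  define C1 where "C1 = N * a / s"
  have C1: "0 \<le> C1" using N a s by (simp add: C1_def)
  have \<kappa>0: "0 \<le> \<kappa> r P" for r P by (simp add: \<kappa>_def)
  show ?thesis
  proof (rule that[of "C1 * b"])
    show "0 \<le> C1 * b" using C1 b by simp
    fix \<Lambda> :: real assume \<Lambda>: "0 < \<Lambda>"
    \<comment> \<open>A cascade of three terms. The first reaches \<open>M\<close> at radius
      \<open>r3\<close>; its image under the operator is absorbed by \<open>\<Lambda>\<close> times
      the second, whose image is absorbed by \<open>\<Lambda>\<close> times the constant. Each stage
      gains a factor \<open>1 / \<Lambda>\<close>, and only the constant survives within
      \<open>r1\<close>.\<close>
    define \<beta> where "\<beta> P = N * \<kappa> r2 P + (C1 / \<Lambda>) * \<kappa> r1 P + C1 * b / \<Lambda>\<^sup>2" for P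
    define E1 where "E1 P = N *\<^sub>R A1 P + (C1 / \<Lambda>) *\<^sub>R B1 P + 0" for P
    define E2 where "E2 P = N *\<^sub>R A2 P + (C1 / \<Lambda>) *\<^sub>R B2 P + 0" for P
    have \<beta>C2: "C2_with UNIV \<beta> E1 E2"
      unfolding \<beta>_def E1_def E2_def
      by (intro C2_with_add C2_with_scale A B C2_with_const)
    have mop: "mop g1 g2 g3 E1 E2 P = N * mop g1 g2 g3 A1 A2 P + (C1 / \<Lambda>) * mop g1 g2 g3 B1 B2 P" for P
      by (simp add: mop_def E1_def E2_def blinfun.bilinear_simps algebra_simps)
    have "M \<le> \<beta> P" if "dist P P0 = r3" for P
    proof -
      have "\<kappa> r2 P = q"
        using that r by (simp add: \<kappa>_def q_def dist_norm)
      then have "N * \<kappa> r2 P = M" using q by (simp add: N_def)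
      moreover have "0 \<le> (C1 / \<Lambda>) * \<kappa> r1 P" "0 \<le> C1 * b / \<Lambda>\<^sup>2"
        using C1 \<Lambda> \<kappa>0 b by auto
      ultimately show ?thesis unfolding \<beta>_def by linarith
    qed
    moreover have "\<beta> P \<le> C1 * b / \<Lambda>\<^sup>2" if "dist P P0 \<le> r1" for P
    proof -
      have 1: "(norm (P - P0))\<^sup>2 \<le> r1\<^sup>2"
        using that by (intro power_mono) (auto simp: dist_norm)
      moreover have "r1\<^sup>2 \<le> r2\<^sup>2" using r by (intro power_mono) auto
      ultimately have "(norm (P - P0))\<^sup>2 \<le> r2\<^sup>2" by linarith
      with 1 show ?thesis by (simp add: \<beta>_def \<kappa>_def)
    qed
    moreover have "mop g1 g2 g3 E1 E2 P \<le> \<Lambda> * \<beta> P" if P: "dist P P0 \<le> r3" for P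
    proof -
      have P': "P \<in> cball P0 r3" using P by (simp add: dist_commute)
      have "N * mop g1 g2 g3 A1 A2 P \<le> C1 * \<kappa> r1 P"
      proof (cases "(norm (P - P0))\<^sup>2 - r2\<^sup>2 \<le> 0")
        case True
        then have "mop g1 g2 g3 A1 A2 P = 0"
          using A0 by (simp add: mop_def)
        then show ?thesis using C1 \<kappa>0 by simp
      next
        case False
        have "s \<le> \<kappa> r1 P"
          unfolding s_def \<kappa>_def using False r by (intro power_mono) (auto simp: power_mono)
        then have "C1 * s \<le> C1 * \<kappa> r1 P"
          using C1 by (intro mult_left_mono)
        moreover have "N * mop g1 g2 g3 A1 A2 P \<le> N * a"
          using a(2)[OF P'] N by (intro mult_left_mono) auto
        ultimately show ?thesis using s by (simp add: C1_def)
      qed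
      moreover have "(C1 / \<Lambda>) * mop g1 g2 g3 B1 B2 P \<le> (C1 / \<Lambda>) * b"
        using b(2)[OF P'] C1 \<Lambda> by (intro mult_left_mono) auto
      moreover have "0 \<le> \<Lambda> * (N * \<kappa> r2 P)" using N \<Lambda> \<kappa>0 by simp
      moreover have "\<Lambda> * \<beta> P = \<Lambda> * (N * \<kappa> r2 P) + C1 * \<kappa> r1 P + (C1 / \<Lambda>) * b"
        using \<Lambda> by (simp add: \<beta>_def field_simps power2_eq_square)
      ultimately show ?thesis unfolding mop by linarith
    qed
    ultimately have "C2_with UNIV \<beta> E1 E2 \<and>
      (\<forall>P. dist P P0 = r3 \<longrightarrow> M \<le> \<beta> P) \<and> (\<forall>P. dist P P0 \<le> r1 \<longrightarrow> \<beta> P \<le> (C1 * b) / \<Lambda>\<^sup>2) \<and>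
      (\<forall>P. dist P P0 \<le> r3 \<longrightarrow> mop g1 g2 g3 E1 E2 P \<le> \<Lambda> * \<beta> P)"
      using \<beta>C2 by blast
    then show "\<exists>\<beta> E1 E2. C2_with UNIV \<beta> E1 E2 \<and>
      (\<forall>P. dist P P0 = r3 \<longrightarrow> M \<le> \<beta> P) \<and> (\<forall>P. dist P P0 \<le> r1 \<longrightarrow> \<beta> P \<le> (C1 * b) / \<Lambda>\<^sup>2) \<and>
      (\<forall>P. dist P P0 \<le> r3 \<longrightarrow> mop g1 g2 g3 E1 E2 P \<le> \<Lambda> * \<beta> P)"
      by blast
  qed
qed

section \<open>Moduli of continuity under left translation\<close>

lemma left_modulus:
  fixes w :: "heis \<times> real \<Rightarrow> real"
  assumes w: "continuous_on UNIV w" and 0: "\<And>P. \<rho> < norm P \<Longrightarrow> w P = 0" and "0 \<le> \<rho>" "0 < \<delta>"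
  obtains \<eta> where "0 < \<eta>" "\<And>K X. norm K < \<eta> \<Longrightarrow> \<bar>w (gmul K X) - w X\<bar> \<le> \<delta>"
proof -
  define H where "H = (\<lambda>(K, X). w (gmul K X))"
  have H: "continuous_on UNIV H"
    unfolding H_def split_beta by (intro continuous_on_compose2[OF w] continuous_intros) auto
  \<comment> \<open>An element of norm below 1 moves a point of norm at most \<open>\<rho>\<close>
    to norm at most \<open>2 * \<rho> + 1\<close>; hence beyond that radius both values of
    \<open>w\<close> vanish.\<close>
  obtain d where d: "0 < d" "\<And>K X. norm K < d \<Longrightarrow> X \<in> cball 0 (2 * \<rho> + 1) \<Longrightarrow> \<bar>H (K, X) - H (0, X)\<bar> < \<delta>"
    using uniform_at_0[OF H compact_cball[of 0 "2 * \<rho> + 1"] \<open>0 < \<delta>\<close>] by blast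
  show ?thesis
  proof (rule that[of "min d 1"])
    fix K X :: "heis \<times> real" assume K: "norm K < min d 1"
    show "\<bar>w (gmul K X) - w X\<bar> \<le> \<delta>"
    proof (cases "norm X \<le> 2 * \<rho> + 1")
      case True
      then show ?thesis using d(2)[of K X] K by (simp add: H_def)
    next
      case False
      have "\<rho> < norm (gmul K X)"
      proof (rule ccontr)
        assume "\<not> \<rho> < norm (gmul K X)"
        then have le: "norm (gmul K X) \<le> \<rho>" by simp
        have "norm (X - gmul K X) \<le> norm K * (1 + norm (gmul K X))"
          using norm_gmul_diff[of "ginv K" "gmul K X"] by (simp add: gmul_ginv_cancel)
        also have "\<dots> \<le> 1 * (1 + \<rho>)"
          using K le \<open>0 \<le> \<rho>\<close> by (intro mult_mono) auto
        finally have "norm (X - gmul K X) \<le> 1 + \<rho>" by simp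
        then have "norm X \<le> 2 * \<rho> + 1"
          using norm_triangle_sub[of X "gmul K X"] le by linarith
        with False show False by simp
      qed
      then show ?thesis using 0 False \<open>0 \<le> \<rho>\<close> \<open>0 < \<delta>\<close> by simp
    qed
  qed (use d in auto)
qed

text \<open>The difference operator commutes with left translation, so
  \<open>V (gmul K X) - V X\<close> solves the resolvent equation with datum
  \<open>w (gmul K X) - w X\<close>, and the maximum principle passes the bound on. The modulus does
  not depend on \<open>\<tau>\<close> or \<open>\<Lambda>\<close>, so the mollification scale can be
  fixed before \<open>\<tau>\<close>.\<close>

lemma resolvent_left_modulus:
  assumes V: "\<And>P. \<bar>V P\<bar> \<le> B" "\<And>P. \<Lambda> * (V P - w P) = dop g1 g2 g3 \<tau> V P"
    and "0 < \<Lambda>" "0 < \<tau>"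
    and w: "\<And>X. \<bar>w (gmul K X) - w X\<bar> \<le> \<delta>"
  shows "\<bar>V (gmul K X) - V X\<bar> \<le> \<delta>"
proof -
  have bd: "V (gmul K P) - V P \<le> 2 * B" "V P - V (gmul K P) \<le> 2 * B" for P
    using V(1)[of P] V(1)[of "gmul K P"] by linarith+
  have "V (gmul K X) - V X \<le> \<delta>"
  proof (rule dop_max_principle[OF bd(1) \<open>0 < \<Lambda>\<close> \<open>0 < \<tau>\<close>])
    fix P
    have "\<Lambda> * (w (gmul K P) - w P) \<le> \<Lambda> * \<delta>"
      using w[of P] \<open>0 < \<Lambda>\<close> by (intro mult_left_mono) auto
    then show "\<Lambda> * (V (gmul K P) - V P - \<delta>) \<le> dop g1 g2 g3 \<tau> (\<lambda>P. V (gmul K P) - V P) P"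
      using V(2)[of P] V(2)[of "gmul K P"] by (simp add: dop_diff dop_left algebra_simps)
  qed
  moreover have "V X - V (gmul K X) \<le> \<delta>"
  proof (rule dop_max_principle[OF bd(2) \<open>0 < \<Lambda>\<close> \<open>0 < \<tau>\<close>])
    fix P
    have "\<Lambda> * (w P - w (gmul K P)) \<le> \<Lambda> * \<delta>"
      using w[of P] \<open>0 < \<Lambda>\<close> by (intro mult_left_mono) auto
    then show "\<Lambda> * (V P - V (gmul K P) - \<delta>) \<le> dop g1 g2 g3 \<tau> (\<lambda>P. V P - V (gmul K P)) P"
      using V(2)[of P] V(2)[of "gmul K P"] by (simp add: dop_diff dop_left algebra_simps)
  qed
  ultimately show ?thesis by linarith
qed

lemma mol_near_modulus:
  assumes "0 < \<eta>" "continuous_on UNIV W" "\<And>K X. norm K < \<eta> \<Longrightarrow> \<bar>W (gmul K X) - W X\<bar> \<le> \<delta>"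
  shows "\<bar>mol \<eta> W P - W P\<bar> \<le> \<delta>"
proof (rule mol_near[OF assms(1,2)])
  fix Q assume "norm (gmul P (ginv Q)) < \<eta>"
  from assms(3)[OF this, of Q] show "\<bar>W Q - W P\<bar> \<le> \<delta>"
    by (simp add: gmul_ginv_cancel abs_minus_commute)
qed

text \<open>The threshold depends on \<open>V\<close> only through its bound \<open>B\<close>. This
  is indispensable because the resolvent \<open>V\<close> to which it is applied itself varies with
  \<open>\<tau>\<close>. It holds because all derivatives fall on the kernel.\<close>

lemma mol_dop_mop:
  fixes g1 g2 g3 :: "real \<times> real \<times> real"
  assumes \<eta>: "0 < \<eta>" and B: "0 \<le> B" and e: "0 < e" and R: "0 \<le> R"
  obtains \<tau>0 where "0 < \<tau>0"
    "\<And>V \<tau>. continuous_on UNIV V \<Longrightarrow> (\<And>P. \<bar>V P\<bar> \<le> B) \<Longrightarrow> 0 < \<tau> \<Longrightarrow> \<tau> < \<tau>0 \<Longrightarrow>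
       \<exists>D1 D2. C2_with (ball 0 (R + 1)) (mol \<eta> V) D1 D2 \<and>
         (\<forall>P. norm P \<le> R \<longrightarrow> \<bar>dop g1 g2 g3 \<tau> (mol \<eta> V) P - mop g1 g2 g3 D1 D2 P\<bar> \<le> e)"
proof -
  obtain d1 d2 where d: "C2_param (kern \<eta>) d1 d2"
    by (rule kern_C2_param)
  have cont: "continuous_on UNIV (\<lambda>(P, Q). d1 P Q)" "continuous_on UNIV (\<lambda>(P, Q). d2 P Q)"
    using d by (auto simp: C2_param_def)
  have c1: "continuous_on S (\<lambda>Q. d1 P Q)" for S P
    using continuous_on_compose2[OF cont(1) continuous_on_Pair[OF continuous_on_const continuous_on_id]] by auto
  have c2: "continuous_on S (\<lambda>Q. d2 P Q)" for S P
    using continuous_on_compose2[OF cont(2) continuous_on_Pair[OF continuous_on_const continuous_on_id]] by auto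
  obtain a where a: "cball 0 ((R + 1) + \<eta> * (1 + (R + 1))) \<subseteq> cbox (- a) (a :: heis \<times> real)"
    using bounded_subset_cbox_symmetric[OF bounded_cball] by blast
  define C where "C = measure lborel (cbox (- a) a)"
  have C: "0 \<le> C" by (simp add: C_def)
  \<comment> \<open>Integrating a kernel error \<open>e'\<close> against \<open>V\<close> over the
    box costs a factor \<open>B * C\<close>; the added 1 avoids division by zero.\<close>
  define e' where "e' = e / (1 + B * C)"
  have BC: "0 < 1 + B * C" using B C by (simp add: add_pos_nonneg)
  have e': "0 < e'" using e BC by (simp add: e'_def)
  obtain \<tau>1 where \<tau>1: "0 < \<tau>1" "\<And>\<tau> P Q. 0 < \<tau> \<Longrightarrow> \<tau> < \<tau>1 \<Longrightarrow> P \<in> cball 0 R \<Longrightarrow> Q \<in> cbox (- a) a \<Longrightarrow>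
    \<bar>dop g1 g2 g3 \<tau> (\<lambda>P. kern \<eta> P Q) P - mop g1 g2 g3 (\<lambda>P. d1 P Q) (\<lambda>P. d2 P Q) P\<bar> \<le> e'"
    using dop_tendsto_mop[OF d compact_cball compact_cbox e'] by metis
  define m where "m = 1 + norm g1 + norm g2 + norm g3"
  have m: "1 \<le> m" "norm g1 \<le> m" "norm g2 \<le> m" "norm g3 \<le> m"
    unfolding m_def by auto
  \<comment> \<open>Keeps all points of the difference stencil inside radius \<open>R + 1\<close>,
    where the mollification is an integral over the chosen box.\<close>
  define \<tau>2 where "\<tau>2 = 1 / (m * (1 + R))"
  have mR: "1 \<le> m * (1 + R)" using mult_mono[of 1 m 1 "1 + R"] m R by simp
  show ?thesis
  proof (rule that[of "min \<tau>1 \<tau>2"])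
    show "0 < min \<tau>1 \<tau>2" using \<tau>1 m R by (simp add: \<tau>2_def)
    fix V :: "heis \<times> real \<Rightarrow> real" and \<tau>
    assume V: "continuous_on UNIV V" and VB: "\<And>P. \<bar>V P\<bar> \<le> B" and \<tau>: "0 < \<tau>" "\<tau> < min \<tau>1 \<tau>2"
    define D1 where "D1 = (\<lambda>P. integral (cbox (- a) a) (\<lambda>Q. V Q *\<^sub>R d1 P Q))"
    define D2 where "D2 = (\<lambda>P. integral (cbox (- a) a) (\<lambda>Q. V Q *\<^sub>R d2 P Q))"
    have D: "C2_with (ball 0 (R + 1)) (mol \<eta> V) D1 D2"
      unfolding D1_def D2_def by (rule mol_C2_with[OF \<eta> V d a])
    have Vc: "continuous_on S V" for S using V continuous_on_subset by blast
    have int: "((\<lambda>Q. V Q * kern \<eta> X Q) has_integral mol \<eta> V X) (cbox (- a) a)" if "norm X < R + 1" for X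
      unfolding mol_eq_integral[OF \<eta> V mol_box[OF \<eta> that a]]
      by (intro integrable_integral integrable_continuous continuous_intros Vc)
    have D1i: "((\<lambda>Q. V Q * d1 P Q \<xi>) has_integral D1 P \<xi>) (cbox (- a) a)" for P \<xi>
    proof -
      have "((\<lambda>Q. V Q *\<^sub>R d1 P Q) has_integral D1 P) (cbox (- a) a)"
        unfolding D1_def by (intro integrable_integral integrable_continuous continuous_intros Vc c1)
      from has_integral_linear[OF this blinfun.bounded_linear_left, of \<xi>] show ?thesis
        by (simp add: o_def scaleR_blinfun.rep_eq)
    qed
    have D2i: "((\<lambda>Q. V Q * d2 P Q \<xi> \<zeta>) has_integral D2 P \<xi> \<zeta>) (cbox (- a) a)" for P \<xi> \<zeta>
    proof -
      have "((\<lambda>Q. V Q *\<^sub>R d2 P Q) has_integral D2 P) (cbox (- a) a)"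
        unfolding D2_def by (intro integrable_integral integrable_continuous continuous_intros Vc c2)
      from has_integral_linear[OF has_integral_linear[OF this blinfun.bounded_linear_left, of \<xi>]
          blinfun.bounded_linear_left, of \<zeta>] show ?thesis
        by (simp add: o_def scaleR_blinfun.rep_eq)
    qed
    have "\<bar>dop g1 g2 g3 \<tau> (mol \<eta> V) P - mop g1 g2 g3 D1 D2 P\<bar> \<le> e" if P: "norm P \<le> R" for P
    proof -
      have "\<tau> * (m * (1 + R)) < 1"
        using \<tau> mR by (simp add: \<tau>2_def field_simps)
      moreover have "\<tau> * 1 \<le> \<tau> * (m * (1 + R))"
        using \<tau> mR by (intro mult_left_mono) auto
      ultimately have "\<tau> \<le> 1" by linarith
      then have \<tau>2': "\<tau>\<^sup>2 \<le> \<tau>" using \<tau> by (simp add: power2_eq_square mult_le_cancel_right1)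
      have near: "norm (P + r *\<^sub>R fld g P) < R + 1" if "norm g \<le> m" "\<bar>r\<bar> \<le> \<tau>" for r g
      proof -
        have "\<bar>r\<bar> * norm (fld g P) \<le> \<tau> * (m * (1 + norm P))"
          using that \<tau> by (intro mult_mono order_trans[OF norm_fld] mult_right_mono) auto
        also have "\<dots> \<le> \<tau> * (m * (1 + R))"
          using \<tau> m P by (intro mult_left_mono) auto
        finally have "norm (r *\<^sub>R fld g P) < 1"
          using \<open>\<tau> * (m * (1 + R)) < 1\<close> by simp
        then show ?thesis
          using norm_triangle_ineq[of P "r *\<^sub>R fld g P"] P by linarith
      qed
      have near': "norm (P + \<tau> *\<^sub>R fld g P) < R + 1" "norm (P - \<tau> *\<^sub>R fld g P) < R + 1"
        if "norm g \<le> m" for g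
        using near[OF that, of \<tau>] near[OF that, of "- \<tau>"] \<tau> by auto
      have near3: "norm (P + \<tau>\<^sup>2 *\<^sub>R fld g3 P) < R + 1" "norm P < R + 1"
        using near[OF m(4), of "\<tau>\<^sup>2"] \<tau>2' P by auto
      have 1: "((\<lambda>Q. V Q * dop g1 g2 g3 \<tau> (\<lambda>P. kern \<eta> P Q) P) has_integral dop g1 g2 g3 \<tau> (mol \<eta> V) P) (cbox (- a) a)"
      proof (rule has_integral_eq_rhs)
        show "((\<lambda>Q. V Q * dop g1 g2 g3 \<tau> (\<lambda>P. kern \<eta> P Q) P) has_integral
          ((mol \<eta> V (P + \<tau> *\<^sub>R fld g1 P) + mol \<eta> V (P - \<tau> *\<^sub>R fld g1 P) - 2 * mol \<eta> V P) * (1 / \<tau>\<^sup>2) +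
    (mol \<eta> V (P + \<tau> *\<^sub>R fld g2 P) + mol \<eta> V (P - \<tau> *\<^sub>R fld g2 P) - 2 * mol \<eta> V P) * (1 / \<tau>\<^sup>2) +
    (mol \<eta> V (P + \<tau>\<^sup>2 *\<^sub>R fld g3 P) - mol \<eta> V P) * (1 / \<tau>\<^sup>2))) (cbox (- a) a)"
        proof (rule has_integral_eq[rotated])
          show "((\<lambda>Q. (V Q * kern \<eta> (P + \<tau> *\<^sub>R fld g1 P) Q + V Q * kern \<eta> (P - \<tau> *\<^sub>R fld g1 P) Q - 2 * (V Q * kern \<eta> P Q)) * (1 / \<tau>\<^sup>2) +
    (V Q * kern \<eta> (P + \<tau> *\<^sub>R fld g2 P) Q + V Q * kern \<eta> (P - \<tau> *\<^sub>R fld g2 P) Q - 2 * (V Q * kern \<eta> P Q)) * (1 / \<tau>\<^sup>2) +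
    (V Q * kern \<eta> (P + \<tau>\<^sup>2 *\<^sub>R fld g3 P) Q - V Q * kern \<eta> P Q) * (1 / \<tau>\<^sup>2)) has_integral
          ((mol \<eta> V (P + \<tau> *\<^sub>R fld g1 P) + mol \<eta> V (P - \<tau> *\<^sub>R fld g1 P) - 2 * mol \<eta> V P) * (1 / \<tau>\<^sup>2) +
    (mol \<eta> V (P + \<tau> *\<^sub>R fld g2 P) + mol \<eta> V (P - \<tau> *\<^sub>R fld g2 P) - 2 * mol \<eta> V P) * (1 / \<tau>\<^sup>2) +
    (mol \<eta> V (P + \<tau>\<^sup>2 *\<^sub>R fld g3 P) - mol \<eta> V P) * (1 / \<tau>\<^sup>2))) (cbox (- a) a)"
            by (intro has_integral_add has_integral_diff has_integral_mult_left has_integral_mult_right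
                int near' near3 m)
        qed (simp add: dop_eq algebra_simps add_divide_distrib diff_divide_distrib)
      qed (simp add: dop_eq)
      have 2: "((\<lambda>Q. V Q * mop g1 g2 g3 (\<lambda>P. d1 P Q) (\<lambda>P. d2 P Q) P) has_integral mop g1 g2 g3 D1 D2 P) (cbox (- a) a)"
      proof -
        have "((\<lambda>Q. V Q * d2 P Q (fld g1 P) (fld g1 P) + V Q * d2 P Q (fld g2 P) (fld g2 P) + V Q * d1 P Q (fld g3 P))
          has_integral mop g1 g2 g3 D1 D2 P) (cbox (- a) a)"
          unfolding mop_def by (intro has_integral_add D1i D2i)
        then show ?thesis by (simp add: mop_def algebra_simps)
      qed
      have "norm (dop g1 g2 g3 \<tau> (mol \<eta> V) P - mop g1 g2 g3 D1 D2 P) \<le> (B * e') * C"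
        unfolding C_def
      proof (rule has_integral_bound[OF _ has_integral_diff[OF 1 2]])
        show "0 \<le> B * e'" using B e' by simp
        fix Q assume Q: "Q \<in> cbox (- a) a"
        have "norm (V Q * dop g1 g2 g3 \<tau> (\<lambda>P. kern \<eta> P Q) P - V Q * mop g1 g2 g3 (\<lambda>P. d1 P Q) (\<lambda>P. d2 P Q) P) =
          \<bar>V Q\<bar> * \<bar>dop g1 g2 g3 \<tau> (\<lambda>P. kern \<eta> P Q) P - mop g1 g2 g3 (\<lambda>P. d1 P Q) (\<lambda>P. d2 P Q) P\<bar>"
          by (simp flip: right_diff_distrib abs_mult)
        also have "\<dots> \<le> B * e'"
          using \<tau>1(2)[of \<tau> P Q] \<tau> P Q VB B by (intro mult_mono) auto
        finally show "norm (V Q * dop g1 g2 g3 \<tau> (\<lambda>P. kern \<eta> P Q) P - V Q * mop g1 g2 g3 (\<lambda>P. d1 P Q) (\<lambda>P. d2 P Q) P) \<le> B * e'" .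
      qed
      also have "(B * e') * C = e * (B * C / (1 + B * C))"
        by (simp add: e'_def)
      also have "\<dots> \<le> e * 1"
        using e BC by (intro mult_left_mono) auto
      finally show ?thesis by simp
    qed
    with D show "\<exists>D1 D2. C2_with (ball 0 (R + 1)) (mol \<eta> V) D1 D2 \<and>
         (\<forall>P. norm P \<le> R \<longrightarrow> \<bar>dop g1 g2 g3 \<tau> (mol \<eta> V) P - mop g1 g2 g3 D1 D2 P\<bar> \<le> e)"
      by blast
  qed
qed

lemma C2_with_compact_support_dop:
  assumes D: "C2_with UNIV \<phi> D1 D2" and 0: "\<And>P. \<rho> < norm P \<Longrightarrow> \<phi> P = 0" and \<rho>: "0 \<le> \<rho>" and "0 < e"
  obtains \<tau>0 where "0 < \<tau>0"
    "\<And>\<tau> P. 0 < \<tau> \<Longrightarrow> \<tau> < \<tau>0 \<Longrightarrow> norm P \<le> 2 * \<rho> + 2 \<Longrightarrow> \<bar>dop g1 g2 g3 \<tau> \<phi> P - mop g1 g2 g3 D1 D2 P\<bar> \<le> e"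
    "\<And>\<tau> P. 0 < \<tau> \<Longrightarrow> \<tau> < \<tau>0 \<Longrightarrow> 2 * \<rho> + 2 < norm P \<Longrightarrow> dop g1 g2 g3 \<tau> \<phi> P = 0"
proof -
  obtain a where "0 < a" "\<And>\<tau> P. 0 < \<tau> \<Longrightarrow> \<tau> < a \<Longrightarrow> P \<in> cball 0 (2 * \<rho> + 2) \<Longrightarrow> \<bar>dop g1 g2 g3 \<tau> \<phi> P - mop g1 g2 g3 D1 D2 P\<bar> \<le> e"
    by (rule dop_tendsto_single[OF D compact_cball[of 0 "2 * \<rho> + 2"] \<open>0 < e\<close>]) blast
  moreover obtain b where "0 < b" "\<And>\<tau> P. 0 < \<tau> \<Longrightarrow> \<tau> < b \<Longrightarrow> 2 * \<rho> + 2 < norm P \<Longrightarrow> dop g1 g2 g3 \<tau> \<phi> P = 0"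
    by (rule dop_vanish[OF 0 \<rho>]) blast+
  ultimately show ?thesis by (intro that[of "min a b"]) auto
qed

lemma mop_bounded:
  assumes "C2_with UNIV \<phi> D1 D2"
  obtains c where "0 \<le> c" "\<And>P. norm P \<le> R \<Longrightarrow> \<bar>mop g1 g2 g3 D1 D2 P\<bar> \<le> c"
proof -
  have "compact (mop g1 g2 g3 D1 D2 ` cball 0 R)"
    by (intro compact_continuous_image continuous_on_subset[OF continuous_on_mop[OF assms]]) auto
  then obtain c where c: "\<forall>y\<in>mop g1 g2 g3 D1 D2 ` cball 0 R. norm y \<le> c"
    using compact_imp_bounded bounded_iff by metis
  then have "\<bar>mop g1 g2 g3 D1 D2 P\<bar> \<le> max 0 c" if "norm P \<le> R" for P
    using that by (auto simp: le_max_iff_disj)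
  then show ?thesis by (intro that[of "max 0 c"]) auto
qed

text \<open>The expansion of the resolvent to first order in \<open>1 / \<Lambda>\<close>: for
  smooth \<open>\<Gamma>\<close> it is \<open>\<Gamma>\<close> plus \<open>1 / \<Lambda>\<close>
  times the operator applied to \<open>\<Gamma>\<close>. Only a lower bound of the operator at one
  point is given, so the comparison function is localized there by a bump. \<open>C\<close> and
  \<open>\<tau>0\<close> are independent of \<open>\<Lambda>\<close>.\<close>

lemma resolvent_lower_bound:
  assumes \<Gamma>: "C2_with UNIV \<Gamma> \<gamma>1 \<gamma>2" and \<Gamma>0: "\<And>P. \<rho> < norm P \<Longrightarrow> \<Gamma> P = 0" and "0 \<le> \<rho>"
    and \<Gamma>G: "\<And>P. \<Gamma> P \<le> G"
    and \<mu>: "\<mu> < mop g1 g2 g3 \<gamma>1 \<gamma>2 P0"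
  obtains C \<tau>0 where "0 \<le> C" "0 < \<tau>0" "\<And>\<Lambda> \<tau> Y. 0 < \<Lambda> \<Longrightarrow> 0 < \<tau> \<Longrightarrow> \<tau> < \<tau>0 \<Longrightarrow> (\<And>P. \<bar>Y P\<bar> \<le> B) \<Longrightarrow>
    (\<And>P. \<Lambda> * (Y P - \<Gamma> P) = dop g1 g2 g3 \<tau> Y P) \<Longrightarrow> \<Gamma> P0 + \<mu> / \<Lambda> - C / \<Lambda>\<^sup>2 \<le> Y P0"
proof -
  \<comment> \<open>Half of the gap pays for the variation of the operator near \<open>P0\<close>,
    the other half for the discretization.\<close>
  define e where "e = (mop g1 g2 g3 \<gamma>1 \<gamma>2 P0 - \<mu>) / 2"
  have e: "0 < e" using \<mu> by (simp add: e_def)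
  define \<rho>' where "\<rho>' = max \<rho> (norm P0 + 1)"
  have \<rho>': "0 \<le> \<rho>'" "\<rho> \<le> \<rho>'" "norm P0 + 1 \<le> \<rho>'" using \<open>0 \<le> \<rho>\<close> by (auto simp: \<rho>'_def)
  define \<psi> where "\<psi> P = (max 0 (1 - (norm (P - P0))\<^sup>2)) ^ 3" for P
  have \<psi>01: "0 \<le> \<psi> P" "\<psi> P \<le> 1" for P
    by (auto simp: \<psi>_def intro!: power_le_one)
  have "C2_on UNIV \<psi>"
    unfolding \<psi>_def by (intro C2_on_pos_cube C2_intros C2_on_norm_sq)
  then obtain \<psi>1 \<psi>2 where \<psi>: "C2_with UNIV \<psi> \<psi>1 \<psi>2"
    using C2_on_iff by blast
  have \<psi>0: "\<psi> P = 0" if "\<rho>' < norm P" for P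
  proof -
    have "1 \<le> norm (P - P0)"
      using that \<rho>' norm_triangle_sub[of P P0] by linarith
    then have "1 \<le> (norm (P - P0))\<^sup>2" by simp
    then show ?thesis by (simp add: \<psi>_def)
  qed
  have \<Gamma>0': "\<Gamma> P = 0" if "\<rho>' < norm P" for P
    using \<Gamma>0 that \<rho>' by auto
  obtain \<tau>1 where \<tau>1: "0 < \<tau>1"
    "\<And>\<tau> P. 0 < \<tau> \<Longrightarrow> \<tau> < \<tau>1 \<Longrightarrow> norm P \<le> 2 * \<rho>' + 2 \<Longrightarrow> \<bar>dop g1 g2 g3 \<tau> \<Gamma> P - mop g1 g2 g3 \<gamma>1 \<gamma>2 P\<bar> \<le> e"
    "\<And>\<tau> P. 0 < \<tau> \<Longrightarrow> \<tau> < \<tau>1 \<Longrightarrow> 2 * \<rho>' + 2 < norm P \<Longrightarrow> dop g1 g2 g3 \<tau> \<Gamma> P = 0"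
    by (rule C2_with_compact_support_dop[OF \<Gamma> \<Gamma>0' \<rho>'(1) e]) blast+
  obtain \<tau>2 where \<tau>2: "0 < \<tau>2"
    "\<And>\<tau> P. 0 < \<tau> \<Longrightarrow> \<tau> < \<tau>2 \<Longrightarrow> norm P \<le> 2 * \<rho>' + 2 \<Longrightarrow> \<bar>dop g1 g2 g3 \<tau> \<psi> P - mop g1 g2 g3 \<psi>1 \<psi>2 P\<bar> \<le> 1"
    "\<And>\<tau> P. 0 < \<tau> \<Longrightarrow> \<tau> < \<tau>2 \<Longrightarrow> 2 * \<rho>' + 2 < norm P \<Longrightarrow> dop g1 g2 g3 \<tau> \<psi> P = 0"
    by (rule C2_with_compact_support_dop[OF \<psi> \<psi>0 \<rho>'(1) zero_less_one]) blast+
  obtain c where c: "0 \<le> c" "\<And>P. norm P \<le> 2 * \<rho>' + 2 \<Longrightarrow> \<bar>mop g1 g2 g3 \<gamma>1 \<gamma>2 P\<bar> \<le> c"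
    by (rule mop_bounded[OF \<Gamma>]) blast
  obtain c' where c': "0 \<le> c'" "\<And>P. norm P \<le> 2 * \<rho>' + 2 \<Longrightarrow> \<bar>mop g1 g2 g3 \<psi>1 \<psi>2 P\<bar> \<le> c'"
    by (rule mop_bounded[OF \<psi>]) blast
  have "isCont (mop g1 g2 g3 \<gamma>1 \<gamma>2) P0"
    using continuous_on_mop[OF \<Gamma>, of g1 g2 g3] continuous_on_eq_continuous_at[OF open_UNIV] by blast
  then obtain s where s: "0 < s" "\<And>P. dist P P0 < s \<Longrightarrow> dist (mop g1 g2 g3 \<gamma>1 \<gamma>2 P) (mop g1 g2 g3 \<gamma>1 \<gamma>2 P0) < e"
    using e unfolding continuous_at_eps_delta by metis
  define k where "k = 1 - (max 0 (1 - s\<^sup>2)) ^ 3"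
  have k: "0 < k"
  proof -
    have "max 0 (1 - s\<^sup>2) < 1" using s by simp
    then have "(max 0 (1 - s\<^sup>2)) ^ 3 < 1" using power_strict_mono[of "max 0 (1 - s\<^sup>2)" 1 3] by simp
    then show ?thesis by (simp add: k_def)
  qed
  have \<psi>k: "\<psi> P \<le> 1 - k" if "s \<le> dist P P0" for P
  proof -
    have "s\<^sup>2 \<le> (norm (P - P0))\<^sup>2"
      using that s by (intro power_mono) (auto simp: dist_norm)
    then show ?thesis
      unfolding \<psi>_def k_def by (simp add: power_mono)
  qed
  \<comment> \<open>Away from \<open>P0\<close>, where \<open>1 - \<psi> P\<close> is at least
    \<open>k\<close>, this pushes \<open>\<mu> - C * (1 - \<psi> P)\<close> below
    \<open>- c - e\<close>, a lower bound for the discretized operator on \<open>\<Gamma>\<close>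
    everywhere.\<close>
  define C where "C = (c + e + \<bar>\<mu>\<bar>) / k"
  have C: "0 \<le> C" using c e k by (simp add: C_def)
  have Ck: "C * k = c + e + \<bar>\<mu>\<bar>" using k by (simp add: C_def)
  show ?thesis
  proof (rule that[of "C * (c' + 1)" "min \<tau>1 \<tau>2"])
    show "0 \<le> C * (c' + 1)" using C c' by simp
    show "0 < min \<tau>1 \<tau>2" using \<tau>1 \<tau>2 by simp
    fix \<Lambda> \<tau> Y
    assume \<Lambda>: "0 < \<Lambda>" and \<tau>: "0 < \<tau>" "\<tau> < min \<tau>1 \<tau>2" and Y: "\<And>P. \<bar>Y P\<bar> \<le> B"
      and Yeq: "\<And>P. \<Lambda> * (Y P - \<Gamma> P) = dop g1 g2 g3 \<tau> Y P"
    \<comment> \<open>A discrete subsolution of the resolvent equation. Since \<open>\<psi>\<close>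
      equals 1 at \<open>P0\<close>, the two terms in \<open>C / \<Lambda>\<close> cancel there; the
      last constant pays for the operator acting on the bump.\<close>
    define Z where "Z P = \<Gamma> P + (C / \<Lambda>) * \<psi> P + ((\<mu> - C) / \<Lambda> - C * (c' + 1) / \<Lambda>\<^sup>2)" for P
    have dZ: "dop g1 g2 g3 \<tau> Z P = dop g1 g2 g3 \<tau> \<Gamma> P + (C / \<Lambda>) * dop g1 g2 g3 \<tau> \<psi> P" for P
      unfolding Z_def by (rule dop_affine)
    have d\<Gamma>: "\<mu> - C * (1 - \<psi> P) \<le> dop g1 g2 g3 \<tau> \<Gamma> P" for P
    proof (cases "dist P P0 < s \<and> norm P \<le> 2 * \<rho>' + 2")
      case True
      have "\<bar>mop g1 g2 g3 \<gamma>1 \<gamma>2 P - mop g1 g2 g3 \<gamma>1 \<gamma>2 P0\<bar> < e"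
        using s(2)[of P] True by (simp add: dist_real_def)
      moreover have "\<bar>dop g1 g2 g3 \<tau> \<Gamma> P - mop g1 g2 g3 \<gamma>1 \<gamma>2 P\<bar> \<le> e"
        using \<tau>1(2) \<tau> True by simp
      moreover have "mop g1 g2 g3 \<gamma>1 \<gamma>2 P0 = \<mu> + 2 * e" by (simp add: e_def field_simps)
      moreover have "0 \<le> C * (1 - \<psi> P)" using C \<psi>01 by simp
      ultimately show ?thesis by linarith
    next
      case False
      have "k \<le> 1 - \<psi> P"
      proof (cases "s \<le> dist P P0")
        case True
        then show ?thesis using \<psi>k[of P] by simp
      next
        case False': False
        then have "\<psi> P = 0" using False \<psi>0[of P] \<rho>' by auto
        moreover have "k \<le> 1" by (simp add: k_def)
        ultimately show ?thesis by simp
      qed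
      then have "C * k \<le> C * (1 - \<psi> P)" using C by (rule mult_left_mono)
      then have le: "\<mu> - C * (1 - \<psi> P) \<le> - c - e" unfolding Ck by linarith
      show ?thesis
      proof (cases "norm P \<le> 2 * \<rho>' + 2")
        case True
        have "\<bar>dop g1 g2 g3 \<tau> \<Gamma> P - mop g1 g2 g3 \<gamma>1 \<gamma>2 P\<bar> \<le> e"
          using \<tau>1(2) \<tau> True by simp
        with c(2)[OF True] le show ?thesis by linarith
      next
        case False
        then have "dop g1 g2 g3 \<tau> \<Gamma> P = 0" using \<tau>1(3) \<tau> by simp
        with le c e show ?thesis by linarith
      qed
    qed
    have d\<psi>: "- (c' + 1) \<le> dop g1 g2 g3 \<tau> \<psi> P" for P
    proof (cases "norm P \<le> 2 * \<rho>' + 2")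
      case True
      have "\<bar>dop g1 g2 g3 \<tau> \<psi> P - mop g1 g2 g3 \<psi>1 \<psi>2 P\<bar> \<le> 1"
        using \<tau>2(2) \<tau> True by simp
      with c'(2)[OF True] show ?thesis by linarith
    next
      case False
      then have "dop g1 g2 g3 \<tau> \<psi> P = 0" using \<tau>2(3) \<tau> by simp
      with c' show ?thesis by simp
    qed
    have "Z P0 - Y P0 \<le> 0"
    proof (rule dop_max_principle[OF _ \<Lambda> \<tau>(1)])
      fix P
      have "(C / \<Lambda>) * \<psi> P \<le> (C / \<Lambda>) * 1"
        using C \<Lambda> \<psi>01 by (intro mult_left_mono) auto
      then show "Z P - Y P \<le> G + C / \<Lambda> + ((\<mu> - C) / \<Lambda> - C * (c' + 1) / \<Lambda>\<^sup>2) + B"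
        using \<Gamma>G[of P] Y[of P] unfolding Z_def by linarith
      have "(C / \<Lambda>) * - (c' + 1) \<le> (C / \<Lambda>) * dop g1 g2 g3 \<tau> \<psi> P"
        using C \<Lambda> d\<psi> by (intro mult_left_mono) auto
      moreover have "\<Lambda> * (Z P - \<Gamma> P) = \<mu> - C * (1 - \<psi> P) + (C / \<Lambda>) * - (c' + 1)"
        using \<Lambda> by (simp add: Z_def field_simps power2_eq_square)
      ultimately have "\<Lambda> * (Z P - \<Gamma> P) \<le> dop g1 g2 g3 \<tau> Z P"
        unfolding dZ using d\<Gamma>[of P] by linarith
      then show "\<Lambda> * (Z P - Y P - 0) \<le> dop g1 g2 g3 \<tau> (\<lambda>P. Z P - Y P) P"
        using Yeq[of P] unfolding dop_diff by (simp add: algebra_simps)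
    qed
    moreover have "Z P0 = \<Gamma> P0 + \<mu> / \<Lambda> - C * (c' + 1) / \<Lambda>\<^sup>2"
      by (simp add: Z_def \<psi>_def diff_divide_distrib)
    ultimately show "\<Gamma> P0 + \<mu> / \<Lambda> - C * (c' + 1) / \<Lambda>\<^sup>2 \<le> Y P0" by simp
  qed
qed

lemma mol_compact_support:
  assumes \<eta>: "0 < \<eta>" and w: "continuous_on UNIV w" and 0: "\<And>P. \<rho> < norm P \<Longrightarrow> w P = 0" and "0 \<le> \<rho>"
  obtains D1 D2 where "C2_with UNIV (mol \<eta> w) D1 D2"
    "\<And>P. \<rho> + \<eta> * (1 + \<rho>) < norm P \<Longrightarrow> mol \<eta> w P = 0"
proof -
  obtain d1 d2 where d: "C2_param (kern \<eta>) d1 d2"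
    by (rule kern_C2_param)
  obtain a where a: "cball 0 \<rho> \<subseteq> cbox (- a) (a :: heis \<times> real)"
    using bounded_subset_cbox_symmetric[OF bounded_cball] by blast
  have "integral (cbox (- a) a) (\<lambda>Q. w Q * kern \<eta> P Q) = mol \<eta> w P" for P
  proof -
    have w0: "w Q * kern \<eta> P Q = 0" if "Q \<notin> cbox (- a) a" for Q
    proof -
      have "Q \<notin> cball 0 \<rho>" using that a by blast
      then show ?thesis using 0[of Q] by simp
    qed
    have "integral UNIV (\<lambda>Q. w Q * kern \<eta> P Q) = mol \<eta> w P"
      unfolding mol_def by (rule integral_lborel[OF kern_integrable[OF \<eta> w]])
    moreover have "integral UNIV (\<lambda>Q. w Q * kern \<eta> P Q) =
        integral UNIV (\<lambda>Q. if Q \<in> cbox (- a) a then w Q * kern \<eta> P Q else 0)"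
      by (rule arg_cong[where f="integral UNIV"]) (use w0 in auto)
    ultimately show ?thesis
      by (simp add: integral_restrict_UNIV)
  qed
  with C2_with_integral[OF d w, of "- a" a]
  have D: "C2_with UNIV (mol \<eta> w) (\<lambda>P. integral (cbox (- a) a) (\<lambda>Q. w Q *\<^sub>R d1 P Q))
    (\<lambda>P. integral (cbox (- a) a) (\<lambda>Q. w Q *\<^sub>R d2 P Q))"
    by simp
  have "mol \<eta> w P = 0" if P: "\<rho> + \<eta> * (1 + \<rho>) < norm P" for P
  proof -
    have "\<bar>mol \<eta> w P - 0\<bar> \<le> 0"
    proof (rule mol_near[OF \<eta> w])
      fix Q assume Q: "norm (gmul P (ginv Q)) < \<eta>"
      have "\<rho> < norm Q"
      proof (rule ccontr)
        assume "\<not> \<rho> < norm Q"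
        then have le: "norm Q \<le> \<rho>" by simp
        have "norm (P - Q) \<le> norm (gmul P (ginv Q)) * (1 + norm Q)"
          using norm_gmul_diff[of "gmul P (ginv Q)" Q] by (simp add: gmul_ginv_cancel)
        also have "\<dots> \<le> \<eta> * (1 + \<rho>)"
          using Q le \<eta> by (intro mult_mono) auto
        finally show False
          using norm_triangle_sub[of P Q] P le by linarith
      qed
      then show "\<bar>w Q - 0\<bar> \<le> 0" using 0 by simp
    qed
    then show ?thesis by simp
  qed
  with D that show ?thesis by blast
qed

lemma resolvent_mol:
  assumes "0 < \<eta>" "continuous_on UNIV V" "continuous_on UNIV w"
    and "\<And>P. \<Lambda> * (V P - w P) = dop g1 g2 g3 \<tau> V P"
  shows "\<Lambda> * (mol \<eta> V P - mol \<eta> w P) = dop g1 g2 g3 \<tau> (mol \<eta> V) P"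
proof -
  have "dop g1 g2 g3 \<tau> V = (\<lambda>P. \<Lambda> * (V P + (- 1) * w P))"
    using assms(4) by (simp add: fun_eq_iff)
  then have "mol \<eta> (dop g1 g2 g3 \<tau> V) P = \<Lambda> * (mol \<eta> V P + (- 1) * mol \<eta> w P)"
    using assms(1-3)
    by (simp only: mol_scale mol_add continuous_on_mult continuous_on_const)
  then show ?thesis
    using dop_mol[OF assms(1,2), of g1 g2 g3 \<tau> P] by simp
qed

text \<open>Look at a minimum of \<open>v - \<Phi> + b\<close> on the closed ball. On the sphere the
  barrier term gives the bound. Inside, \<open>\<Phi> - b\<close> touches \<open>v\<close> from
  below up to a constant, and the viscosity inequality combined with the inequalities for
  \<open>\<Phi>\<close> and \<open>b\<close> bounds \<open>\<Phi> - v - \<kappa>\<close> by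
  \<open>b\<close> at that point.\<close>

lemma supersolution_ge_resolvent:
  fixes v :: "heis \<times> real \<Rightarrow> real"
  assumes v: "continuous_on UNIV v"
    and visc: "\<And>P U \<phi> D1 D2. dist P P0 < R \<Longrightarrow> open U \<Longrightarrow> P \<in> U \<Longrightarrow> C2_with U \<phi> D1 D2 \<Longrightarrow>
      (\<forall>\<^sub>F Q in nhds P. v P - \<phi> P \<le> v Q - \<phi> Q) \<Longrightarrow> mop g1 g2 g3 D1 D2 P \<le> l0"
    and r3: "0 < r3" "r3 < R"
    and \<Phi>: "C2_with (ball P0 R) \<Phi> D1 D2"
    and b: "C2_with UNIV b E1 E2" "\<And>P. dist P P0 \<le> r3 \<Longrightarrow> mop g1 g2 g3 E1 E2 P \<le> \<Lambda> * b P"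
    and bdry: "\<And>P. dist P P0 = r3 \<Longrightarrow> - \<kappa> \<le> v P - \<Phi> P + b P"
    and \<Lambda>: "0 < \<Lambda>"
    and \<Phi>eq: "\<And>P. dist P P0 \<le> r3 \<Longrightarrow> \<Lambda> * (\<Phi> P - v P - \<kappa>) + l0 \<le> mop g1 g2 g3 D1 D2 P"
    and P: "dist P P0 \<le> r3"
  shows "- \<kappa> \<le> v P - \<Phi> P + b P"
proof -
  have sub: "cball P0 r3 \<subseteq> ball P0 R" using r3 by auto
  have "continuous_on (cball P0 r3) (\<lambda>P. v P - \<Phi> P + b P)"
    by (intro continuous_intros continuous_on_subset[OF v] continuous_on_subset[OF C2_withD(5)[OF b(1)]]
        continuous_on_subset[OF C2_withD(5)[OF \<Phi>] sub]) auto
  then obtain X where X: "X \<in> cball P0 r3" and min: "\<And>Q. Q \<in> cball P0 r3 \<Longrightarrow> v X - \<Phi> X + b X \<le> v Q - \<Phi> Q + b Q"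
    using continuous_attains_inf[of "cball P0 r3" "\<lambda>P. v P - \<Phi> P + b P"] r3 by auto
  have "- \<kappa> \<le> v X - \<Phi> X + b X"
  proof (cases "dist X P0 = r3")
    case True
    then show ?thesis by (rule bdry)
  next
    case False
    then have lt: "dist X P0 < r3" using X by (simp add: dist_commute)
    have C2: "C2_with (ball P0 R) (\<lambda>P. \<Phi> P - b P) (\<lambda>P. D1 P - E1 P) (\<lambda>P. D2 P - E2 P)"
      by (intro C2_with_diff \<Phi> C2_with_subset[OF b(1)]) auto
    have "mop g1 g2 g3 (\<lambda>P. D1 P - E1 P) (\<lambda>P. D2 P - E2 P) X \<le> l0"
    proof (rule visc[OF _ open_ball _ C2])
      show "dist X P0 < R" "X \<in> ball P0 R" using lt r3 by (auto simp: dist_commute)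
      have "\<forall>\<^sub>F Q in nhds X. Q \<in> ball P0 r3"
        using lt by (intro eventually_nhds_in_open) (auto simp: dist_commute)
      then show "\<forall>\<^sub>F Q in nhds X. v X - (\<Phi> X - b X) \<le> v Q - (\<Phi> Q - b Q)"
      proof eventually_elim
        case (elim Q)
        then show ?case using min[of Q] by simp
      qed
    qed
    moreover have "mop g1 g2 g3 (\<lambda>P. D1 P - E1 P) (\<lambda>P. D2 P - E2 P) X = mop g1 g2 g3 D1 D2 X - mop g1 g2 g3 E1 E2 X"
      by (simp add: mop_def blinfun.bilinear_simps)
    ultimately have "\<Lambda> * (\<Phi> X - v X - \<kappa>) \<le> \<Lambda> * b X"
      using \<Phi>eq[of X] b(2)[of X] lt by simp
    then show ?thesis using \<Lambda> by simp
  qed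
  then show ?thesis using min[of P] P by (simp add: dist_commute)
qed

text \<open>The viscosity inequality is known only within \<open>R\<close> of \<open>P0\<close>, and
  the kernel seen from \<open>P0\<close> reaches only to \<open>r1 < R\<close>. The barrier makes
  the global resolvent comparison local, so values of \<open>v\<close> beyond \<open>R\<close> can
  be altered freely.\<close>

lemma mollified_supersolution:
  fixes v :: "heis \<times> real \<Rightarrow> real"
  assumes v: "continuous_on UNIV v"
    and r1: "0 < r1" "r1 < R" and \<eta>: "0 < \<eta>" "\<eta> * (1 + norm P0) \<le> r1"
    and visc: "\<And>P U \<phi> D1 D2. dist P P0 < R \<Longrightarrow> open U \<Longrightarrow> P \<in> U \<Longrightarrow> C2_with U \<phi> D1 D2 \<Longrightarrow>
      (\<forall>\<^sub>F Q in nhds P. v P - \<phi> P \<le> v Q - \<phi> Q) \<Longrightarrow> mop g1 g2 g3 D1 D2 P \<le> l0"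
    and G: "C2_with U0 (mol \<eta> v) E1 E2" "open U0" "P0 \<in> U0"
  shows "mop g1 g2 g3 E1 E2 P0 \<le> l0"
proof (rule dense_le)
  fix \<mu> assume \<mu>: "\<mu> < mop g1 g2 g3 E1 E2 P0"
  define \<rho> where "\<rho> = norm P0 + R"
  have \<rho>: "0 \<le> \<rho>" using r1 by (simp add: \<rho>_def)
  \<comment> \<open>A cutoff that agrees with \<open>v\<close> on the relevant ball. Bounded data
    are needed for the resolvent, compact support for a uniform modulus under left
    translation.\<close>
  define w where "w P = v P * max 0 (min 1 (\<rho> + 1 - norm P))" for P
  have w: "continuous_on UNIV w"
    unfolding w_def by (intro continuous_intros v)
  have wv: "w P = v P" if "dist P P0 < R" for P
  proof -
    have "norm P \<le> \<rho>"
      using that norm_triangle_sub[of P P0] by (simp add: \<rho>_def dist_norm)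
    then show ?thesis by (simp add: w_def)
  qed
  have w0: "w P = 0" if "\<rho> + 1 < norm P" for P
    using that by (simp add: w_def)
  obtain B where B: "0 \<le> B" "\<And>P. \<bar>w P\<bar> \<le> B"
  proof -
    have "compact (w ` cball 0 (\<rho> + 1))"
      by (intro compact_continuous_image continuous_on_subset[OF w]) auto
    then obtain c where c: "\<forall>y\<in>w ` cball 0 (\<rho> + 1). norm y \<le> c"
      using compact_imp_bounded bounded_iff by metis
    have "\<bar>w P\<bar> \<le> max 0 c" for P
    proof (cases "norm P \<le> \<rho> + 1")
      case True
      then show ?thesis using c by (auto simp: le_max_iff_disj)
    next
      case False
      then show ?thesis using w0[of P] by simp
    qed
    then show ?thesis by (intro that[of "max 0 c"]) auto
  qed
  have \<rho>1: "0 \<le> \<rho> + 1" using \<rho> by simp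
  obtain \<gamma>1 \<gamma>2 where \<Gamma>: "C2_with UNIV (mol \<eta> w) \<gamma>1 \<gamma>2"
    and \<Gamma>0: "\<And>P. (\<rho> + 1) + \<eta> * (1 + (\<rho> + 1)) < norm P \<Longrightarrow> mol \<eta> w P = 0"
    using mol_compact_support[OF \<eta>(1) w w0 \<rho>1] by metis
  have mol_bd: "\<bar>mol \<eta> f P\<bar> \<le> B" if "continuous_on UNIV f" "\<And>P. \<bar>f P\<bar> \<le> B" for f P
    using mol_near[OF \<eta>(1) that(1), of P 0 B] that(2) by simp
  have \<Gamma>B: "mol \<eta> w P \<le> B" for P
    using mol_bd[OF w B(2), of P] by linarith
  define N where "N = {P. dist P P0 + \<eta> * (1 + norm P) < R}"
  have N: "open N" "P0 \<in> N"
    unfolding N_def using \<eta> r1 by (auto intro!: open_Collect_less continuous_intros)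
  have mol_wv: "mol \<eta> v P = mol \<eta> w P" if "P \<in> N" for P
  proof (rule mol_cong[OF \<eta>(1)])
    fix Q assume "dist P Q \<le> \<eta> * (1 + norm P)"
    then have "dist Q P0 < R"
      using that dist_triangle[of Q P0 P] by (simp add: N_def dist_commute)
    then show "v Q = w Q" using wv by simp
  qed
  have "C2_with (U0 \<inter> N) (mol \<eta> w) E1 E2"
    by (rule C2_with_transform[OF C2_with_subset[OF G(1)]]) (use G N mol_wv in auto)
  from C2_with_unique[OF this \<Gamma>, of P0] G N have "E1 P0 = \<gamma>1 P0" "E2 P0 = \<gamma>2 P0"
    by auto
  then have \<mu>': "\<mu> < mop g1 g2 g3 \<gamma>1 \<gamma>2 P0"
    using \<mu> by (simp add: mop_def)
  have \<rho>2: "0 \<le> (\<rho> + 1) + \<eta> * (1 + (\<rho> + 1))" using \<rho> \<eta> by simp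
  obtain C \<tau>0 where C: "0 \<le> C" and \<tau>0: "0 < \<tau>0"
    and lower: "\<And>\<Lambda> \<tau> Y. 0 < \<Lambda> \<Longrightarrow> 0 < \<tau> \<Longrightarrow> \<tau> < \<tau>0 \<Longrightarrow> (\<And>P. \<bar>Y P\<bar> \<le> B) \<Longrightarrow>
    (\<And>P. \<Lambda> * (Y P - mol \<eta> w P) = dop g1 g2 g3 \<tau> Y P) \<Longrightarrow> mol \<eta> w P0 + \<mu> / \<Lambda> - C / \<Lambda>\<^sup>2 \<le> Y P0"
    by (rule resolvent_lower_bound[OF \<Gamma> \<Gamma>0 \<rho>2 \<Gamma>B \<mu>', of B]) blast+
  define r2 where "r2 = (2 * r1 + R) / 3"
  define r3 where "r3 = (r1 + 2 * R) / 3"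
  have r: "r1 < r2" "r2 < r3" "r3 < R" "0 < r3" using r1 by (auto simp: r2_def r3_def)
  \<comment> \<open>The price on the sphere: \<open>2 * B\<close> for two functions bounded by
    \<open>B\<close>, \<open>\<bar>l0\<bar>\<close> for \<open>- \<kappa>\<close>, and the rest to
    absorb \<open>\<delta> \<le> 1\<close>.\<close>
  have M: "0 \<le> 2 * B + \<bar>l0\<bar> + 3" using B by simp
  obtain C' where C': "0 \<le> C'" and barrier: "\<And>\<Lambda>. 0 < \<Lambda> \<Longrightarrow> \<exists>b E1 E2. C2_with UNIV b E1 E2 \<and>
    (\<forall>P. dist P P0 = r3 \<longrightarrow> 2 * B + \<bar>l0\<bar> + 3 \<le> b P) \<and> (\<forall>P. dist P P0 \<le> r1 \<longrightarrow> b P \<le> C' / \<Lambda>\<^sup>2) \<and>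
    (\<forall>P. dist P P0 \<le> r3 \<longrightarrow> mop g1 g2 g3 E1 E2 P \<le> \<Lambda> * b P)"
    by (rule barrier_exists[OF r1(1) r(1,2) M, of P0 g1 g2 g3]) blast
  \<comment> \<open>Two estimates at \<open>P0\<close> meet: \<open>v\<close> exceeds the resolvent
    up to \<open>k\<close>, and the mollified resolvent exceeds the mollified datum by about
    \<open>\<mu> / \<Lambda>\<close>. Their combination is multiplied by \<open>\<Lambda>\<close>,
    which amplifies \<open>\<delta>\<close>. The auxiliary scale \<open>\<eta>'\<close> is unrelated
    to \<open>\<eta>\<close> and depends on \<open>\<delta>\<close>; the step \<open>\<tau>\<close>
    is chosen last.\<close>
  have key: "\<mu> \<le> l0 + \<delta> + 2 * \<delta> * \<Lambda> + (C + C') / \<Lambda>" if \<Lambda>: "1 \<le> \<Lambda>" and \<delta>: "0 < \<delta>" "\<delta> \<le> 1" for \<Lambda> \<delta>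
  proof -
    have \<Lambda>0: "0 < \<Lambda>" using \<Lambda> by simp
    obtain \<eta>' where \<eta>': "0 < \<eta>'" and mod: "\<And>K X. norm K < \<eta>' \<Longrightarrow> \<bar>w (gmul K X) - w X\<bar> \<le> \<delta>"
      by (rule left_modulus[OF w w0 \<rho>1 \<delta>(1)]) blast+
    obtain \<tau>1 where \<tau>1: "0 < \<tau>1" and approx: "\<And>V \<tau>. continuous_on UNIV V \<Longrightarrow> (\<And>P. \<bar>V P\<bar> \<le> B) \<Longrightarrow> 0 < \<tau> \<Longrightarrow> \<tau> < \<tau>1 \<Longrightarrow>
       \<exists>D1 D2. C2_with (ball 0 (\<rho> + 1)) (mol \<eta>' V) D1 D2 \<and>
         (\<forall>P. norm P \<le> \<rho> \<longrightarrow> \<bar>dop g1 g2 g3 \<tau> (mol \<eta>' V) P - mop g1 g2 g3 D1 D2 P\<bar> \<le> \<delta>)"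
      by (rule mol_dop_mop[OF \<eta>' B(1) \<delta>(1) \<rho>, of g1 g2 g3]) blast
    define \<tau> where "\<tau> = min \<tau>0 \<tau>1 / 2"
    have \<tau>: "0 < \<tau>" "\<tau> < \<tau>0" "\<tau> < \<tau>1" using \<tau>0 \<tau>1 by (auto simp: \<tau>_def)
    obtain V where V: "continuous_on UNIV V" "\<And>P. \<bar>V P\<bar> \<le> B"
      and Veq: "\<And>P. \<Lambda> * (V P - w P) = dop g1 g2 g3 \<tau> V P"
      by (rule dop_resolvent[OF w B(2) \<Lambda>0 \<tau>(1)]) blast
    have Vmod: "\<bar>V (gmul K X) - V X\<bar> \<le> \<delta>" if "norm K < \<eta>'" for K X
      by (rule resolvent_left_modulus[OF V(2) Veq \<Lambda>0 \<tau>(1) mod[OF that]])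
    have \<Phi>V: "\<bar>mol \<eta>' V P - V P\<bar> \<le> \<delta>" for P
      by (rule mol_near_modulus[OF \<eta>' V(1) Vmod])
    have ww: "\<bar>mol \<eta>' w P - w P\<bar> \<le> \<delta>" for P
      by (rule mol_near_modulus[OF \<eta>' w mod])
    obtain D1 D2 where D: "C2_with (ball 0 (\<rho> + 1)) (mol \<eta>' V) D1 D2"
      and Dm: "\<And>P. norm P \<le> \<rho> \<Longrightarrow> \<bar>dop g1 g2 g3 \<tau> (mol \<eta>' V) P - mop g1 g2 g3 D1 D2 P\<bar> \<le> \<delta>"
      using approx[OF V \<tau>(1,3)] by blast
    obtain b E1' E2' where b: "C2_with UNIV b E1' E2'"
      and bM: "\<And>P. dist P P0 = r3 \<Longrightarrow> 2 * B + \<bar>l0\<bar> + 3 \<le> b P"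
      and bs: "\<And>P. dist P P0 \<le> r1 \<Longrightarrow> b P \<le> C' / \<Lambda>\<^sup>2"
      and bm: "\<And>P. dist P P0 \<le> r3 \<Longrightarrow> mop g1 g2 g3 E1' E2' P \<le> \<Lambda> * b P"
      using barrier[OF \<Lambda>0] by blast
    have near: "norm P \<le> \<rho>" if "dist P P0 < R" for P
      using that norm_triangle_sub[of P P0] by (simp add: \<rho>_def dist_norm)
    \<comment> \<open>Chosen so that \<open>\<Lambda> * \<kappa>\<close> is
      \<open>\<Lambda> * \<delta>\<close>, for replacing \<open>w\<close> by its mollification, plus
      \<open>l0\<close>, plus \<open>\<delta>\<close> for the discretization.\<close>
    define \<kappa> where "\<kappa> = \<delta> + (l0 + \<delta>) / \<Lambda>"
    have \<Lambda>\<kappa>: "\<Lambda> * \<kappa> = \<Lambda> * \<delta> + l0 + \<delta>" using \<Lambda>0 by (simp add: \<kappa>_def field_simps)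
    have \<kappa>: "- \<kappa> \<le> \<bar>l0\<bar>"
    proof -
      have "\<Lambda> * - \<bar>l0\<bar> \<le> 1 * - \<bar>l0\<bar>" using \<Lambda> by (intro mult_right_mono_neg) auto
      also have "\<dots> \<le> \<Lambda> * \<kappa>"
      proof -
        have "0 \<le> \<Lambda> * \<delta>" using \<Lambda>0 \<delta> by simp
        then show ?thesis unfolding \<Lambda>\<kappa> using \<delta> by linarith
      qed
      finally have "- \<bar>l0\<bar> \<le> \<kappa>" using \<Lambda>0 by (simp only: mult_le_cancel_left_pos)
      then show ?thesis by linarith
    qed
    have vge: "- \<kappa> \<le> v P - mol \<eta>' V P + b P" if "dist P P0 \<le> r3" for P
    proof (rule supersolution_ge_resolvent[OF v visc r(4,3) _ b bm _ \<Lambda>0 _ that])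
      show "C2_with (ball P0 R) (mol \<eta>' V) D1 D2"
      proof (rule C2_with_subset[OF D], rule subsetI)
        fix P assume "P \<in> ball P0 R"
        then show "P \<in> ball 0 (\<rho> + 1)" using near[of P] by (simp add: dist_commute)
      qed
      show "- \<kappa> \<le> v P - mol \<eta>' V P + b P" if "dist P P0 = r3" for P
      proof -
        have "w P = v P" using that r by (intro wv) simp
        then show ?thesis
          using bM[OF that] B(2)[of P] V(2)[of P] \<Phi>V[of P] \<delta> \<kappa> by linarith
      qed
      show "\<Lambda> * (mol \<eta>' V P - v P - \<kappa>) + l0 \<le> mop g1 g2 g3 D1 D2 P" if "dist P P0 \<le> r3" for P
      proof -
        have P: "dist P P0 < R" using that r by simp
        have "\<Lambda> * (mol \<eta>' V P - v P - \<kappa>) + l0 = \<Lambda> * (mol \<eta>' V P - v P - \<delta>) - \<delta>"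
          using \<Lambda>\<kappa> by (simp add: algebra_simps)
        also have "\<Lambda> * (mol \<eta>' V P - v P - \<delta>) \<le> \<Lambda> * (mol \<eta>' V P - mol \<eta>' w P)"
          using ww[of P] wv[OF P] \<Lambda>0 by (intro mult_left_mono) auto
        also have "\<dots> = dop g1 g2 g3 \<tau> (mol \<eta>' V) P"
          by (rule resolvent_mol[OF \<eta>' V(1) w Veq])
        finally show ?thesis using Dm[OF near[OF P]] by linarith
      qed
    qed
    \<comment> \<open>The sum of \<open>\<kappa>\<close>, the barrier within \<open>r1\<close>, and
      another \<open>\<delta>\<close> for passing from the mollified resolvent back to
      \<open>V\<close>.\<close>
    define k where "k = 2 * \<delta> + C' / \<Lambda>\<^sup>2 + (l0 + \<delta>) / \<Lambda>"
    have "mol \<eta> (\<lambda>P. V P + - k) P0 \<le> mol \<eta> v P0"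
    proof (rule mol_mono[OF \<eta>(1) _ v])
      show "continuous_on UNIV (\<lambda>P. V P + - k)" by (intro continuous_intros V(1))
      fix Q assume "dist P0 Q \<le> \<eta> * (1 + norm P0)"
      then have Q: "dist Q P0 \<le> r1" using \<eta> by (simp add: dist_commute)
      then have "dist Q P0 \<le> r3" using r by simp
      from vge[OF this] bs[OF Q] \<Phi>V[of Q] show "V Q + - k \<le> v Q"
        unfolding k_def \<kappa>_def by linarith
    qed
    then have "mol \<eta> V P0 - k \<le> mol \<eta> w P0"
      using mol_wv[OF N(2)] by (simp add: mol_add[OF \<eta>(1) V(1) continuous_on_const] mol_const[OF \<eta>(1)] del: add_uminus_conv_diff)
    moreover have "mol \<eta> w P0 + \<mu> / \<Lambda> - C / \<Lambda>\<^sup>2 \<le> mol \<eta> V P0"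
      by (rule lower[OF \<Lambda>0 \<tau>(1,2) mol_bd[OF V] resolvent_mol[OF \<eta>(1) V(1) w Veq]])
    ultimately have "\<mu> / \<Lambda> \<le> k + C / \<Lambda>\<^sup>2" by linarith
    then have "\<Lambda> * (\<mu> / \<Lambda>) \<le> \<Lambda> * (k + C / \<Lambda>\<^sup>2)"
      using \<Lambda>0 by (intro mult_left_mono) auto
    moreover have "\<Lambda> * (x / \<Lambda>\<^sup>2) = x / \<Lambda>" "\<Lambda> * (x / \<Lambda>) = x" for x
      using \<Lambda>0 by (auto simp: power2_eq_square)
    ultimately show ?thesis
      by (simp add: k_def distrib_left add_divide_distrib mult.commute)
  qed
  show "\<mu> \<le> l0"
  proof (rule field_le_epsilon)
    fix \<epsilon> :: real assume \<epsilon>: "0 < \<epsilon>"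
    \<comment> \<open>First \<open>\<Lambda>\<close> makes the quadratic errors at most half of
      \<open>\<epsilon>\<close>; then \<open>\<delta>\<close> is taken small relative to
      \<open>\<Lambda>\<close>, since it enters multiplied by it.\<close>
    define \<Lambda> where "\<Lambda> = 1 + 2 * (C + C') / \<epsilon>"
    have \<Lambda>: "1 \<le> \<Lambda>" using C C' \<epsilon> by (simp add: \<Lambda>_def)
    define \<delta> where "\<delta> = min 1 (\<epsilon> / (2 * (1 + 2 * \<Lambda>)))"
    have \<delta>: "0 < \<delta>" "\<delta> \<le> 1" using \<epsilon> \<Lambda> by (auto simp: \<delta>_def)
    have "(C + C') / \<Lambda> \<le> \<epsilon> / 2"
      using \<epsilon> \<Lambda> C C' by (simp add: \<Lambda>_def field_simps)
    moreover have "\<delta> * (1 + 2 * \<Lambda>) \<le> \<epsilon> / 2"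
    proof -
      have "\<delta> * (1 + 2 * \<Lambda>) \<le> (\<epsilon> / (2 * (1 + 2 * \<Lambda>))) * (1 + 2 * \<Lambda>)"
        using \<Lambda> by (intro mult_right_mono) (auto simp: \<delta>_def)
      also have "\<dots> = \<epsilon> / 2" using \<Lambda> by (simp add: field_simps)
      finally show ?thesis .
    qed
    ultimately show "\<mu> \<le> l0 + \<epsilon>"
    proof -
      assume "(C + C') / \<Lambda> \<le> \<epsilon> / 2" "\<delta> * (1 + 2 * \<Lambda>) \<le> \<epsilon> / 2"
      moreover have "\<delta> + 2 * \<delta> * \<Lambda> = \<delta> * (1 + 2 * \<Lambda>)" by (simp add: algebra_simps)
      ultimately show ?thesis using key[OF \<Lambda> \<delta>] by linarith
    qed
  qed
qed

section \<open>The operator in terms of second derivatives along left-invariant fields\<close>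

lemma fld_basis: "fld (a, b, s) P = a *\<^sub>R fld (1, 0, 0) P + b *\<^sub>R fld (0, 1, 0) P + s *\<^sub>R (0, 1)"
  by (rule st_cases[of P]) (simp add: zero_prod_def algebra_simps diff_divide_distrib)

lemma coordinate_curves:
  "((\<lambda>s. ((s, y, z), t)) has_derivative (\<lambda>r. r *\<^sub>R ((1, 0, 0), 0))) (at x)"
  "((\<lambda>s. ((x, s, z), t)) has_derivative (\<lambda>r. r *\<^sub>R ((0, 1, 0), 0))) (at y)"
  "((\<lambda>s. ((x, y, s), t)) has_derivative (\<lambda>r. r *\<^sub>R ((0, 0, 1), 0))) (at z)"
  "((\<lambda>s. ((x, y, z), s)) has_derivative (\<lambda>r. r *\<^sub>R ((0, 0, 0), 1))) (at t)"
  for x y z t :: real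
     apply (rule has_derivative_eq_rhs[OF has_derivative_Pair[OF has_derivative_Pair[OF
            has_derivative_ident has_derivative_const] has_derivative_const]], simp add: fun_eq_iff zero_prod_def)
    apply (rule has_derivative_eq_rhs[OF has_derivative_Pair[OF has_derivative_Pair[OF
            has_derivative_const has_derivative_Pair[OF has_derivative_ident has_derivative_const]]
            has_derivative_const]], simp add: fun_eq_iff)
   apply (rule has_derivative_eq_rhs[OF has_derivative_Pair[OF has_derivative_Pair[OF
            has_derivative_const has_derivative_Pair[OF has_derivative_const has_derivative_ident]]
            has_derivative_const]], simp add: fun_eq_iff)
  apply (rule has_derivative_eq_rhs[OF has_derivative_Pair[OF has_derivative_const has_derivative_ident]],
      simp add: fun_eq_iff zero_prod_def)
  done

lemma deriv_along_curve:
  fixes D1 :: "'a::real_normed_vector \<Rightarrow> 'a \<Rightarrow>\<^sub>L real"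
  assumes D: "C2_with U \<phi> D1 D2" and c: "(c has_derivative (\<lambda>r. r *\<^sub>R v)) (at s)" and "c s \<in> U"
  shows "deriv (\<lambda>s. \<phi> (c s)) s = D1 (c s) v"
proof (rule DERIV_imp_deriv)
  have "((\<lambda>s. \<phi> (c s)) has_derivative (\<lambda>r. D1 (c s) (r *\<^sub>R v))) (at s)"
    by (rule has_derivative_compose[OF c C2_withD(1)[OF D \<open>c s \<in> U\<close>]])
  then show "((\<lambda>s. \<phi> (c s)) has_real_derivative D1 (c s) v) (at s)"
    unfolding has_field_derivative_def
    by (rule has_derivative_eq_rhs) (simp add: fun_eq_iff blinfun.scaleR_right)
qed

lemma X_eq:
  assumes D: "C2_with U \<phi> D1 D2" and q: "(q, t) \<in> U"
  shows "X1 (\<lambda>q. \<phi> (q, t)) q = D1 (q, t) (fld (1, 0, 0) (q, t))"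
    and "X2 (\<lambda>q. \<phi> (q, t)) q = D1 (q, t) (fld (0, 1, 0) (q, t))"
proof -
  obtain x y z where xyz: "q = (x, y, z)" by (metis prod.exhaust)
  have dx: "deriv (\<lambda>s. \<phi> ((s, y, z), t)) x = D1 (q, t) ((1, 0, 0), 0)"
    using deriv_along_curve[OF D coordinate_curves(1)] q xyz by simp
  have dy: "deriv (\<lambda>s. \<phi> ((x, s, z), t)) y = D1 (q, t) ((0, 1, 0), 0)"
    using deriv_along_curve[OF D coordinate_curves(2)] q xyz by simp
  have dz: "deriv (\<lambda>s. \<phi> ((x, y, s), t)) z = D1 (q, t) ((0, 0, 1), 0)"
    using deriv_along_curve[OF D coordinate_curves(3)] q xyz by simp
  have "fld (1, 0, 0) (q, t) = ((1, 0, 0), 0) + (- (y / 2)) *\<^sub>R ((0, 0, 1), 0)"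
    "fld (0, 1, 0) (q, t) = ((0, 1, 0), 0) + (x / 2) *\<^sub>R ((0, 0, 1), 0)"
    by (simp_all add: xyz)
  then show "X1 (\<lambda>q. \<phi> (q, t)) q = D1 (q, t) (fld (1, 0, 0) (q, t))"
    "X2 (\<lambda>q. \<phi> (q, t)) q = D1 (q, t) (fld (0, 1, 0) (q, t))"
    by (simp_all only: blinfun.add_right blinfun.scaleR_right)
      (simp_all add: xyz dx[unfolded xyz] dy[unfolded xyz] dz[unfolded xyz])
qed

text \<open>The linear part of the affine map \<open>fld g\<close>. It produces the first-order term
  that appears when a derivative along one field is differentiated along another.\<close>

fun dfld :: "real \<times> real \<times> real \<Rightarrow> heis \<times> real \<Rightarrow> heis \<times> real" where
  "dfld (a, b, s) ((x, y, z), t) = ((0, 0, (x * b - y * a) / 2), 0)"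

lemma dfld_linear: "dfld g (v + r *\<^sub>R w) = dfld g v + r *\<^sub>R dfld g w"
  by (cases g; rule st_cases[of v]; rule st_cases[of w]) (simp add: algebra_simps add_divide_distrib diff_divide_distrib)

lemma fld_has_derivative: "(fld g has_derivative dfld g) (at P)"
proof -
  obtain a b s where g: "g = (a, b, s)" by (cases g)
  have "fld g = (\<lambda>P. ((a, b, (fst (fst P) * b - fst (snd (fst P)) * a) / 2), s))"
    "dfld g = (\<lambda>P. ((0, 0, (fst (fst P) * b - fst (snd (fst P)) * a) / 2), 0))"
    by (auto simp: fun_eq_iff g)
  then show ?thesis
    by (auto intro!: derivative_eq_intros)
qed

lemma deriv_gradient_along_curve:
  assumes D: "C2_with U \<phi> D1 D2" and "open U"
    and c: "(c has_derivative (\<lambda>r. r *\<^sub>R v)) (at s)" and cs: "c s \<in> U"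
    and \<psi>: "\<And>r. c r \<in> U \<Longrightarrow> \<psi> r = D1 (c r) (fld g (c r))"
  shows "deriv \<psi> s = D2 (c s) v (fld g (c s)) + D1 (c s) (dfld g v)"
proof -
  have "isCont c s" using c by (rule has_derivative_continuous)
  then have "\<forall>\<^sub>F r in nhds s. c r \<in> U"
    using \<open>open U\<close> cs by (simp add: isCont_def tendsto_nhds_iff eventually_nhds_conv_at topological_tendstoD)
  then have "\<forall>\<^sub>F r in nhds s. \<psi> r = D1 (c r) (fld g (c r))"
    by eventually_elim (rule \<psi>)
  then have "deriv \<psi> s = deriv (\<lambda>r. D1 (c r) (fld g (c r))) s"
    by (intro deriv_cong_ev) auto
  also have "\<dots> = D2 (c s) v (fld g (c s)) + D1 (c s) (dfld g v)"
  proof (rule DERIV_imp_deriv)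
    have "((\<lambda>r. D1 (c r) (fld g (c r))) has_derivative
        (\<lambda>r. D1 (c s) (dfld g (r *\<^sub>R v)) + D2 (c s) (r *\<^sub>R v) (fld g (c s)))) (at s)"
      by (rule bounded_bilinear.FDERIV[OF bounded_bilinear_blinfun_apply
            has_derivative_compose[OF c C2_withD(2)[OF D cs]]
            has_derivative_compose[OF c fld_has_derivative]])
    moreover have "dfld g (r *\<^sub>R v) = r *\<^sub>R dfld g v" for r
      by (cases g; rule st_cases[of v]) (simp add: algebra_simps)
    ultimately show "((\<lambda>r. D1 (c r) (fld g (c r))) has_real_derivative
        D2 (c s) v (fld g (c s)) + D1 (c s) (dfld g v)) (at s)"
      unfolding has_field_derivative_def
      by (elim has_derivative_eq_rhs)
        (simp add: fun_eq_iff blinfun.scaleR_right blinfun.scaleR_left algebra_simps)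
  qed
  finally show ?thesis .
qed

lemma X_X_eq:
  assumes D: "C2_with U \<phi> D1 D2" and U: "open U" and p: "(p, t) \<in> U"
    and \<psi>: "\<And>q. (q, t) \<in> U \<Longrightarrow> \<psi> q = D1 (q, t) (fld g (q, t))"
  shows "X1 \<psi> p = D2 (p, t) (fld (1, 0, 0) (p, t)) (fld g (p, t)) + D1 (p, t) (dfld g (fld (1, 0, 0) (p, t)))"
    and "X2 \<psi> p = D2 (p, t) (fld (0, 1, 0) (p, t)) (fld g (p, t)) + D1 (p, t) (dfld g (fld (0, 1, 0) (p, t)))"
proof -
  obtain x y z where xyz: "p = (x, y, z)" by (metis prod.exhaust)
  define K where "K v = D2 (p, t) v (fld g (p, t)) + D1 (p, t) (dfld g v)" for v
  have dx: "deriv (\<lambda>s. \<psi> (s, y, z)) x = K ((1, 0, 0), 0)"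
    unfolding K_def xyz
    using deriv_gradient_along_curve[OF D U coordinate_curves(1)] p \<psi> by (simp add: xyz)
  have dy: "deriv (\<lambda>s. \<psi> (x, s, z)) y = K ((0, 1, 0), 0)"
    unfolding K_def xyz
    using deriv_gradient_along_curve[OF D U coordinate_curves(2)] p \<psi> by (simp add: xyz)
  have dz: "deriv (\<lambda>s. \<psi> (x, y, s)) z = K ((0, 0, 1), 0)"
    unfolding K_def xyz
    using deriv_gradient_along_curve[OF D U coordinate_curves(3)] p \<psi> by (simp add: xyz)
  have K: "K (v + r *\<^sub>R w) = K v + r * K w" for v w r
    by (simp add: K_def dfld_linear blinfun.bilinear_simps algebra_simps)
  have "fld (1, 0, 0) (p, t) = ((1, 0, 0), 0) + (- (y / 2)) *\<^sub>R ((0, 0, 1), 0)"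
    "fld (0, 1, 0) (p, t) = ((0, 1, 0), 0) + (x / 2) *\<^sub>R ((0, 0, 1), 0)"
    by (simp_all add: xyz)
  then have "K (fld (1, 0, 0) (p, t)) = K ((1, 0, 0), 0) + (- (y / 2)) * K ((0, 0, 1), 0)"
    "K (fld (0, 1, 0) (p, t)) = K ((0, 1, 0), 0) + (x / 2) * K ((0, 0, 1), 0)"
    by (simp_all only: K)
  then show "X1 \<psi> p = D2 (p, t) (fld (1, 0, 0) (p, t)) (fld g (p, t)) + D1 (p, t) (dfld g (fld (1, 0, 0) (p, t)))"
    "X2 \<psi> p = D2 (p, t) (fld (0, 1, 0) (p, t)) (fld g (p, t)) + D1 (p, t) (dfld g (fld (0, 1, 0) (p, t)))"
    unfolding K_def[symmetric] by (simp_all add: xyz dx dy dz)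
qed

definition hgrad_of :: "(heis \<times> real \<Rightarrow> (heis \<times> real) \<Rightarrow>\<^sub>L real) \<Rightarrow> heis \<times> real \<Rightarrow> real^2" where
  "hgrad_of D1 P = vector [D1 P (fld (1, 0, 0) P), D1 P (fld (0, 1, 0) P)]"

lemma inner_hgrad_of: "b \<bullet> hgrad_of D1 P = D1 P (fld (b $ 1, b $ 2, 0) P)"
  unfolding fld_basis[of "b $ 1"]
  by (simp add: hgrad_of_def inner_vec_def sum_2 blinfun.bilinear_simps flip: zero_prod_def)

text \<open>The mixed derivatives of \<open>\<phi>\<close> along the two fields contain opposite
  multiples of the vertical derivative, which cancel in the symmetrized Hessian. With
  \<open>A\<close> written as a sum of two rank-one matrices, the trace becomes second derivatives
  along two constant combinations of the fields, and minus the time derivative is the third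
  field.\<close>

lemma parabolic_op_eq:
  fixes A :: "real^2^2"
  assumes D: "C2_with U \<phi> D1 D2" and U: "open U" and p: "(p, t) \<in> U"
    and A: "A $ 1 $ 1 = s1\<^sup>2 + r1\<^sup>2" "A $ 1 $ 2 = s1 * s2 + r1 * r2"
      "A $ 2 $ 1 = s1 * s2 + r1 * r2" "A $ 2 $ 2 = s2\<^sup>2 + r2\<^sup>2"
  shows "parabolic_op A f \<phi> p t =
    - mop (s1, s2, 0) (r1, r2, 0) (0, 0, - 1) D1 D2 (p, t) + f p (hgrad_of D1 (p, t))"
proof -
  let ?P = "(p, t)" and ?e1 = "(1, 0, 0)" and ?e2 = "(0, 1, 0)"
  note X = X_eq[OF D]
  have dt: "deriv (\<lambda>s. \<phi> (p, s)) t = D1 ?P (0, 1)"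
    using deriv_along_curve[OF D coordinate_curves(4)] p
    by (cases p) (simp add: zero_prod_def)
  have grad: "hgrad (\<lambda>q. \<phi> (q, t)) p = hgrad_of D1 ?P"
    unfolding hgrad_def hgrad_of_def X[OF p] ..
  note XX1 = X_X_eq[OF D U p, of "X1 (\<lambda>q. \<phi> (q, t))" ?e1] and XX2 = X_X_eq[OF D U p, of "X2 (\<lambda>q. \<phi> (q, t))" ?e2]
  obtain x y z where xyz: "p = (x, y, z)" by (metis prod.exhaust)
  define k :: "heis \<times> real" where "k = ((0, 0, 1/2), 0)"
  define w where "w = D1 ?P k"
  have df: "dfld ?e1 (fld ?e1 ?P) = 0" "dfld ?e1 (fld ?e2 ?P) = - k"
    "dfld ?e2 (fld ?e1 ?P) = k" "dfld ?e2 (fld ?e2 ?P) = 0"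
    by (simp_all add: xyz zero_prod_def k_def)
  have 11: "X1 (X1 (\<lambda>q. \<phi> (q, t))) p = D2 ?P (fld ?e1 ?P) (fld ?e1 ?P)"
    and 21: "X2 (X1 (\<lambda>q. \<phi> (q, t))) p = D2 ?P (fld ?e2 ?P) (fld ?e1 ?P) - w"
    using XX1 X(1) by (simp_all add: df w_def blinfun.minus_right blinfun.zero_right del: fld.simps dfld.simps)
  have 12: "X1 (X2 (\<lambda>q. \<phi> (q, t))) p = D2 ?P (fld ?e1 ?P) (fld ?e2 ?P) + w"
    and 22: "X2 (X2 (\<lambda>q. \<phi> (q, t))) p = D2 ?P (fld ?e2 ?P) (fld ?e2 ?P)"
    using XX2 X(2) by (simp_all add: df w_def blinfun.minus_right blinfun.zero_right del: fld.simps dfld.simps)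
  have tr: "trace (A ** hhess_sym (\<lambda>q. \<phi> (q, t)) p) =
      A $ 1 $ 1 * D2 ?P (fld ?e1 ?P) (fld ?e1 ?P) + A $ 2 $ 2 * D2 ?P (fld ?e2 ?P) (fld ?e2 ?P) +
      (A $ 1 $ 2 + A $ 2 $ 1) * ((D2 ?P (fld ?e1 ?P) (fld ?e2 ?P) + D2 ?P (fld ?e2 ?P) (fld ?e1 ?P)) / 2)"
    unfolding hhess_sym_def Let_def 11 12 21 22
    by (simp add: trace_def matrix_matrix_mult_def sum_2 algebra_simps add_divide_distrib)
  have m: "mop (s1, s2, 0) (r1, r2, 0) (0, 0, - 1) D1 D2 ?P =
      trace (A ** hhess_sym (\<lambda>q. \<phi> (q, t)) p) - D1 ?P (0, 1)"
  proof -
    define T :: "heis \<times> real" where "T = (0, 1)"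
    have h: "fld (a, b, 0) ?P = a *\<^sub>R fld ?e1 ?P + b *\<^sub>R fld ?e2 ?P" for a b
      using fld_basis[of a b 0 ?P] by (simp flip: zero_prod_def)
    have T: "fld (0, 0, - 1) ?P = - T"
      by (simp add: T_def xyz zero_prod_def)
    define B where "B v w = D2 ?P (fld v ?P) (fld w ?P)" for v w
    have q: "B (a, b, 0) (a, b, 0) =
        a\<^sup>2 * B ?e1 ?e1 + a * b * (B ?e1 ?e2 + B ?e2 ?e1) + b\<^sup>2 * B ?e2 ?e2" for a b
      unfolding B_def h[of a b] blinfun.add_left blinfun.add_right blinfun.scaleR_left blinfun.scaleR_right
      by (simp add: power2_eq_square algebra_simps)
    have d: "D1 ?P (fld (0, 0, - 1) ?P) = - D1 ?P (0, 1)"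
      unfolding T T_def[symmetric] by (simp add: blinfun.minus_right)
    show ?thesis
      unfolding mop_def tr A d B_def[symmetric] q[of s1 s2] q[of r1 r2] by (simp add: algebra_simps add_divide_distrib)
  qed
  show ?thesis
    unfolding parabolic_op_def dt grad m by simp
qed

text \<open>Cholesky factorization; a vanishing pivot \<open>a\<close> forces the off-diagonal entry
  to vanish too.\<close>

lemma psd_2x2_decomposition:
  fixes A :: "real^2^2"
  assumes sym: "transpose A = A" and psd: "\<forall>v. 0 \<le> v \<bullet> (A *v v)"
  obtains s1 s2 r1 r2 where "A $ 1 $ 1 = s1\<^sup>2 + r1\<^sup>2" "A $ 1 $ 2 = s1 * s2 + r1 * r2"
      "A $ 2 $ 1 = s1 * s2 + r1 * r2" "A $ 2 $ 2 = s2\<^sup>2 + r2\<^sup>2"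
proof -
  define a b c where "a = A $ 1 $ 1" and "b = A $ 1 $ 2" and "c = A $ 2 $ 2"
  have b': "A $ 2 $ 1 = b"
    using arg_cong[OF sym, of "\<lambda>M. M $ 1 $ 2"] by (simp add: transpose_def b_def)
  have quad: "0 \<le> a * x\<^sup>2 + 2 * b * x * y + c * y\<^sup>2" for x y
  proof -
    have "0 \<le> vector [x, y] \<bullet> (A *v vector [x, y])" using psd by blast
    then show ?thesis
      by (simp add: inner_vec_def matrix_vector_mult_def sum_2 a_def b'[unfolded b_def] b_def c_def
          power2_eq_square algebra_simps)
  qed
  have a: "0 \<le> a" using quad[of 1 0] by simp
  have c: "0 \<le> c" using quad[of 0 1] by simp
  show ?thesis
  proof (cases "a = 0")
    case True
    have "b = 0"
    proof (rule ccontr)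
      assume "b \<noteq> 0"
      \<comment> \<open>At this argument the quadratic form takes the value -1.\<close>
      then show False using quad[of "- (c + 1) / (2 * b)" 1] True by simp
    qed
    then show ?thesis
      using True c b' by (intro that[of 0 0 0 "sqrt c"]) (simp_all add: a_def b_def c_def)
  next
    case False
    then have a0: "0 < a" using a by simp
    have "0 \<le> a * (c * a - b\<^sup>2)"
      using quad[of "- b" a] by (simp add: power2_eq_square algebra_simps)
    then have "0 \<le> c * a - b\<^sup>2" using a0 by (simp add: zero_le_mult_iff)
    then have d: "0 \<le> c - b\<^sup>2 / a" using a0 by (simp add: field_simps)
    show ?thesis
      \<comment> \<open>The instantiation follows the order of occurrence \<open>s1\<close>,
        \<open>r1\<close>, \<open>s2\<close>, \<open>r2\<close>, so the two vectors are
        \<open>(sqrt a, b / sqrt a)\<close> and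
        \<open>(0, sqrt (c - b\<^sup>2 / a))\<close>.\<close>
      using a0 d b' by (intro that[of "sqrt a" 0 "b / sqrt a" "sqrt (c - b\<^sup>2 / a)"])
        (simp_all add: a_def[symmetric] b_def[symmetric] c_def[symmetric] power_divide)
  qed
qed

section \<open>Supergradients of concave functions\<close>

text \<open>At a negative minimum, step symmetrically to both sides until an endpoint is reached.
  One of the two values is 0 and the other is no smaller than the minimum, which violates the
  midpoint inequality.\<close>

lemma midpoint_concave_nonneg:
  fixes F :: "real \<Rightarrow> real"
  assumes F: "continuous_on {0..1} F" and 0: "F 0 = 0" "F 1 = 0"
    and mid: "\<And>a b. F a + F b \<le> 2 * F ((a + b) / 2)" and u: "u \<in> {0..1}"
  shows "0 \<le> F u"
proof (rule ccontr)
  assume "\<not> 0 \<le> F u"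
  obtain s where s: "s \<in> {0..1}" "\<And>r. r \<in> {0..1} \<Longrightarrow> F s \<le> F r"
    using continuous_attains_inf[OF compact_Icc _ F] u by auto
  have neg: "F s < 0" using s(2)[OF u] \<open>\<not> 0 \<le> F u\<close> by simp
  define d where "d = min s (1 - s)"
  have "F (s - d) + F (s + d) \<le> 2 * F s"
    using mid[of "s - d" "s + d"] by simp
  moreover have "F s \<le> F (s - d)" "F s \<le> F (s + d)"
    using s by (auto simp: d_def intro!: s(2))
  moreover have "F (s - d) = 0 \<or> F (s + d) = 0"
    using 0 by (auto simp: d_def min_def)
  ultimately show False using neg by linarith
qed

text \<open>Continuity upgrades midpoint concavity to concavity along segments; a hyperplane
  separating the hypograph from the point of the graph over \<open>m\<close> is then the graph of an
  affine majorant.\<close>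

lemma supergradient_exists:
  fixes g :: "'a::euclidean_space \<Rightarrow> real"
  assumes g: "continuous_on UNIV g"
    and mid: "\<And>\<xi> \<eta>. g \<xi> + g \<eta> \<le> 2 * g ((1/2) *\<^sub>R (\<xi> + \<eta>))"
  obtains b where "\<And>\<zeta>. g \<zeta> \<le> g m + b \<bullet> (\<zeta> - m)"
proof -
  have conc: "(1 - u) * g x + u * g y \<le> g ((1 - u) *\<^sub>R x + u *\<^sub>R y)" if "u \<in> {0..1}" for u x y
  proof -
    define F where "F s = g ((1 - s) *\<^sub>R x + s *\<^sub>R y) - ((1 - s) * g x + s * g y)" for s
    have "0 \<le> F u"
    proof (rule midpoint_concave_nonneg[OF _ _ _ _ that])
      show "continuous_on {0..1} F"
        unfolding F_def by (intro continuous_intros continuous_on_compose2[OF g]) auto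
      show "F 0 = 0" "F 1 = 0" by (simp_all add: F_def)
      fix a b
      have e1: "(1/2) *\<^sub>R (((1 - a) *\<^sub>R x + a *\<^sub>R y) + ((1 - b) *\<^sub>R x + b *\<^sub>R y)) =
          (1 - (a + b) / 2) *\<^sub>R x + ((a + b) / 2) *\<^sub>R y"
      proof -
        have "(1/2) *\<^sub>R (((1 - a) *\<^sub>R x + a *\<^sub>R y) + ((1 - b) *\<^sub>R x + b *\<^sub>R y)) =
          ((1/2) * (1 - a) + (1/2) * (1 - b)) *\<^sub>R x + ((1/2) * a + (1/2) * b) *\<^sub>R y"
          by (simp only: scaleR_add_right scaleR_add_left scaleR_scaleR ac_simps)
        moreover have "(1/2) * (1 - a) + (1/2) * (1 - b) = 1 - (a + b) / 2" "(1/2) * a + (1/2) * b = (a + b) / 2"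
          by (simp_all add: field_simps)
        ultimately show ?thesis by (simp only:)
      qed
      have e2: "2 * ((1 - (a + b) / 2) * g x + (a + b) / 2 * g y) =
          ((1 - a) * g x + a * g y) + ((1 - b) * g x + b * g y)"
        by (simp add: field_simps)
      have arith: "p + q \<le> 2 * r \<Longrightarrow> 2 * d = e + e' \<Longrightarrow> (p - e) + (q - e') \<le> 2 * (r - d)" for p q r d e e' :: real
        by (simp add: algebra_simps)
      show "F a + F b \<le> 2 * F ((a + b) / 2)"
        unfolding F_def
        by (rule arith[OF mid[of "(1 - a) *\<^sub>R x + a *\<^sub>R y" "(1 - b) *\<^sub>R x + b *\<^sub>R y", unfolded e1] e2])
    qed
    then show ?thesis by (simp add: F_def)
  qed
  \<comment> \<open>The strict hypograph, so that the point of the graph lies outside and can be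
    separated.\<close>
  define S where "S = {(\<zeta>, r). r < g \<zeta>}"
  have "convex S"
    unfolding convex_alt
  proof (intro ballI allI impI)
    fix X Y u assume X: "X \<in> S" and Y: "Y \<in> S" and u: "0 \<le> u \<and> (u::real) \<le> 1"
    obtain x r y s where XY: "X = (x, r)" "Y = (y, s)" by (metis prod.exhaust)
    have "(1 - u) * r + u * s < (1 - u) * g x + u * g y"
    proof (cases "u = 0")
      case True
      then show ?thesis using X by (simp add: XY S_def)
    next
      case False
      then have "u * s < u * g y" using u Y by (simp add: XY S_def)
      moreover have "(1 - u) * r \<le> (1 - u) * g x"
        using u X by (intro mult_left_mono) (auto simp: XY S_def)
      ultimately show ?thesis by linarith
    qed
    also have "\<dots> \<le> g ((1 - u) *\<^sub>R x + u *\<^sub>R y)" using u by (intro conc) auto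
    finally show "(1 - u) *\<^sub>R X + u *\<^sub>R Y \<in> S" by (simp add: XY S_def)
  qed
  moreover have "S \<noteq> {}"
  proof -
    have "(0, g 0 - 1) \<in> S" by (simp add: S_def)
    then show ?thesis by blast
  qed
  moreover have "S \<inter> {(m, g m)} = {}" by (auto simp: S_def)
  ultimately obtain a c where a: "a \<noteq> 0" and le: "\<forall>X\<in>S. a \<bullet> X \<le> c" and ge: "\<forall>X\<in>{(m, g m)}. c \<le> a \<bullet> X"
    using separating_hyperplane_sets[of S "{(m, g m)}"] by auto
  obtain \<alpha> \<rho> where ar: "a = (\<alpha>, \<rho>)" by (cases a)
  have sep: "\<alpha> \<bullet> \<zeta> + \<rho> * r \<le> \<alpha> \<bullet> m + \<rho> * g m" if "r < g \<zeta>" for \<zeta> r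
    using le ge that by (force simp: S_def ar)
  have "0 \<le> \<rho>" using sep[of "g m - 1" m] by (simp add: algebra_simps)
  \<comment> \<open>A vertical hyperplane is impossible because \<open>g\<close> is finite on the
    whole space: moving from \<open>m\<close> in the direction \<open>\<alpha>\<close> would cross
    it.\<close>
  moreover have "\<rho> \<noteq> 0"
  proof
    assume "\<rho> = 0"
    with sep[of "g (m + \<alpha>) - 1" "m + \<alpha>"] have "\<alpha> \<bullet> \<alpha> \<le> 0" by (simp add: inner_add_right)
    then have "\<alpha> = 0" by (metis inner_eq_zero_iff inner_ge_zero order_antisym)
    with \<open>\<rho> = 0\<close> a ar show False by (simp add: zero_prod_def)
  qed
  ultimately have \<rho>: "0 < \<rho>" by simp
  have "g \<zeta> \<le> g m + ((- 1 / \<rho>) *\<^sub>R \<alpha>) \<bullet> (\<zeta> - m)" for \<zeta>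
  proof (rule dense_le)
    fix r assume "r < g \<zeta>"
    from sep[OF this] have "\<rho> * r \<le> \<rho> * g m - \<alpha> \<bullet> (\<zeta> - m)" by (simp add: inner_diff_right)
    then have "r \<le> (\<rho> * g m - \<alpha> \<bullet> (\<zeta> - m)) / \<rho>" using \<rho> by (simp add: field_simps)
    also have "\<dots> = g m + ((- 1 / \<rho>) *\<^sub>R \<alpha>) \<bullet> (\<zeta> - m)" using \<rho> by (simp add: diff_divide_distrib)
    finally show "r \<le> g m + ((- 1 / \<rho>) *\<^sub>R \<alpha>) \<bullet> (\<zeta> - m)" .
  qed
  then show ?thesis by (rule that)
qed

section \<open>Left translations\<close>

lemma C2_with_affine:
  fixes l :: "'a::real_normed_vector \<Rightarrow>\<^sub>L 'b::real_normed_vector"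
  assumes D: "C2_with U \<phi> D1 D2"
  obtains E1 E2 where "C2_with ((\<lambda>P. c + l P) -` U) (\<lambda>P. \<phi> (c + l P)) E1 E2"
    "\<And>P v. E1 P v = D1 (c + l P) (l v)" "\<And>P v w. E2 P v w = D2 (c + l P) (l v) (l w)"
proof -
  define k :: "('b \<Rightarrow>\<^sub>L real) \<Rightarrow>\<^sub>L ('a \<Rightarrow>\<^sub>L real)" where "k = Blinfun (\<lambda>D. D o\<^sub>L l)"
  have k: "blinfun_apply k D = D o\<^sub>L l" for D
    unfolding k_def by (subst bounded_linear_Blinfun_apply) (auto intro!: bounded_linear_intros)
  have L: "((\<lambda>P. c + l P) has_derivative blinfun_apply l) (at P)" for P
    by (auto intro!: derivative_eq_intros)
  define E1 where "E1 = (\<lambda>P. k (D1 (c + l P)))"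
  define E2 where "E2 = (\<lambda>P. k o\<^sub>L D2 (c + l P) o\<^sub>L l)"
  have "C2_with ((\<lambda>P. c + l P) -` U) (\<lambda>P. \<phi> (c + l P)) E1 E2"
    unfolding C2_with_def
  proof (intro conjI ballI)
    fix P assume "P \<in> (\<lambda>P. c + l P) -` U"
    then have P: "c + l P \<in> U" by simp
    show "((\<lambda>P. \<phi> (c + l P)) has_derivative blinfun_apply (E1 P)) (at P)"
      using has_derivative_compose[OF L C2_withD(1)[OF D P]]
      by (simp add: E1_def k blinfun_apply_blinfun_compose[abs_def])
    have "((\<lambda>P. k (D1 (c + l P))) has_derivative (\<lambda>h. k (D2 (c + l P) (l h)))) (at P)"
      by (rule bounded_linear.has_derivative[OF blinfun.bounded_linear_right
            has_derivative_compose[OF L C2_withD(2)[OF D P]]])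
    then show "(E1 has_derivative blinfun_apply (E2 P)) (at P)"
      by (simp add: E1_def E2_def blinfun_apply_blinfun_compose[abs_def])
  next
    show "continuous_on ((\<lambda>P. c + l P) -` U) E2"
      unfolding E2_def
      by (intro continuous_intros continuous_on_compose2[OF C2_withD(3)[OF D]]) auto
  qed
  then show ?thesis
    by (rule that) (simp_all add: E1_def E2_def k)
qed

text \<open>Left invariance in infinitesimal form: in coordinates a left translation is affine, and
  its linear part carries each field to itself at the translated point.\<close>

lemma left_translation_affine:
  obtains l :: "(heis \<times> real) \<Rightarrow>\<^sub>L (heis \<times> real)"
  where "gmul H = (\<lambda>P. H + l P)" "\<And>g P. fld g (gmul H P) = l (fld g P)"
proof -
  obtain h1 h2 h3 h4 where H: "H = ((h1, h2, h3), h4)" by (rule st_cases)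
  define m where "m v = v + ((0, 0, (h1 * fst (snd (fst v)) - fst (fst v) * h2) / 2), 0)" for v :: "heis \<times> real"
  have "bounded_linear m"
    unfolding m_def linear_conv_bounded_linear[symmetric]
    by (rule linearI) (auto simp: algebra_simps add_divide_distrib diff_divide_distrib)
  then have l: "blinfun_apply (Blinfun m) = m"
    by (rule bounded_linear_Blinfun_apply)
  have "gmul H = (\<lambda>P. H + m P)"
  proof
    fix P show "gmul H P = H + m P"
      by (rule st_cases[of P]) (simp add: H m_def gmul_simp)
  qed
  moreover have "fld g (gmul H P) = m (fld g P)" for g P
    by (cases g; rule st_cases[of P]) (simp add: H m_def gmul_simp algebra_simps add_divide_distrib diff_divide_distrib)
  ultimately show ?thesis
    by (intro that[of "Blinfun m"]) (simp_all add: l)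
qed

lemma C2_with_left:
  assumes D: "C2_with U \<phi> D1 D2"
  obtains E1 E2 where "C2_with (gmul H -` U) (\<lambda>P. \<phi> (gmul H P)) E1 E2"
    "\<And>g1 g2 g3 P. mop g1 g2 g3 E1 E2 P = mop g1 g2 g3 D1 D2 (gmul H P)"
    "\<And>P. hgrad_of E1 P = hgrad_of D1 (gmul H P)"
proof -
  obtain l :: "(heis \<times> real) \<Rightarrow>\<^sub>L (heis \<times> real)"
    where H: "gmul H = (\<lambda>P. H + l P)" and f: "\<And>g P. fld g (gmul H P) = l (fld g P)"
    by (rule left_translation_affine[of H]) blast
  obtain E1 E2 where E: "C2_with ((\<lambda>P. H + l P) -` U) (\<lambda>P. \<phi> (H + l P)) E1 E2"
    "\<And>P v. E1 P v = D1 (H + l P) (l v)" "\<And>P v w. E2 P v w = D2 (H + l P) (l v) (l w)"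
    by (rule C2_with_affine[OF D, of H l]) blast
  show ?thesis
    using E f by (intro that[of E1 E2]) (simp_all add: mop_def hgrad_of_def fun_cong[OF H] H)
qed

section \<open>Mollified supersolutions of the nonlinear equation\<close>

lemma mop_drift: "mop g1 g2 (a, b, s) D1 D2 P =
    mop g1 g2 (0, 0, s) D1 D2 P + vector [a, b] \<bullet> hgrad_of D1 P"
proof -
  have "fld (a, b, s) P = fld (0, 0, s) P + fld (a, b, 0) P"
    by (rule st_cases[of P]) simp
  then show ?thesis
    using inner_hgrad_of[of "vector [a, b]" D1 P] by (simp add: mop_def blinfun.add_right)
qed

lemma approx_supersolution:
  fixes A :: "real^2^2"
  assumes super: "viscosity_supersolution A f u"
    and A: "A $ 1 $ 1 = s1\<^sup>2 + r1\<^sup>2" "A $ 1 $ 2 = s1 * s2 + r1 * r2"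
      "A $ 2 $ 1 = s1 * s2 + r1 * r2" "A $ 2 $ 2 = s2\<^sup>2 + r2\<^sup>2"
    and lip: "\<And>p w1 w2. \<bar>f p w1 - f p w2\<bar> \<le> L1 * norm (w1 - w2)"
    and conc: "right_inv_concave f"
    and w: "continuous_on UNIV w" "\<And>P. 0 < snd P \<Longrightarrow> w P = u P"
    and r: "0 < r" "r < R" "R \<le> snd P0" and \<eta>: "0 < \<eta>" "\<eta> * (1 + norm P0) \<le> r"
    and \<omega>: "\<And>q \<zeta>. dist q (fst P0) < R \<Longrightarrow> f q \<zeta> \<le> f (fst P0) \<zeta> + \<omega>"
    and G: "C2_with U0 (mol \<eta> w) E1 E2" "open U0" "P0 \<in> U0"
  shows "- \<omega> \<le> - mop (s1, s2, 0) (r1, r2, 0) (0, 0, - 1) E1 E2 P0 + f (fst P0) (hgrad_of E1 P0)"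
proof -
  define m where "m = hgrad_of E1 P0"
  have fc: "continuous_on UNIV (f (fst P0))"
  proof (rule continuous_at_imp_continuous_on, rule ballI)
    fix x
    have "((\<lambda>y. f (fst P0) y - f (fst P0) x) \<longlongrightarrow> 0) (at x)"
    proof (rule Lim_null_comparison)
      show "\<forall>\<^sub>F y in at x. norm (f (fst P0) y - f (fst P0) x) \<le> L1 * norm (y - x)"
        using lip by simp
      have "isCont (\<lambda>y. L1 * norm (y - x)) x" by (intro continuous_intros)
      then show "((\<lambda>y. L1 * norm (y - x)) \<longlongrightarrow> 0) (at x)" by (simp add: isCont_def)
    qed
    then show "isCont (f (fst P0)) x"
      unfolding isCont_def by (rule LIM_zero_cancel)
  qed
  \<comment> \<open>Right invariant concavity with the identity as \<open>h\<close> reduces to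
    midpoint concavity in the gradient at a fixed position.\<close>
  have "(0, 0, 0) \<in> H0" by (auto simp: H0_def)
  then have "f (fst P0) \<xi> + f (fst P0) \<zeta> \<le> 2 * f (fst P0) ((1/2) *\<^sub>R (\<xi> + \<zeta>))" for \<xi> \<zeta>
    using conc[unfolded right_inv_concave_def, rule_format, of "(0, 0, 0)" "fst P0" \<xi> \<zeta>]
    by (cases "fst P0") simp
  then obtain b where b: "\<And>\<zeta>. f (fst P0) \<zeta> \<le> f (fst P0) m + b \<bullet> (\<zeta> - m)"
    using supergradient_exists[OF fc] by metis
  \<comment> \<open>The part of the affine majorant that does not involve the gradient, plus the
    cost of freezing the position. Its gradient part becomes the drift \<open>- b\<close>. The
    majorant touches at \<open>m\<close>, the gradient of the mollification itself, so
    \<open>f (fst P0) m\<close> is recovered at the end.\<close>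
  define l0 where "l0 = f (fst P0) m - b \<bullet> m + \<omega>"
  have bv: "vector [- (b $ 1), - (b $ 2)] = - b"
    by (simp add: vec_eq_iff forall_2)
  have "mop (s1, s2, 0) (r1, r2, 0) (- (b $ 1), - (b $ 2), - 1) E1 E2 P0 \<le> l0"
  proof (rule mollified_supersolution[OF w(1) r(1,2) \<eta> _ G])
    fix P U \<phi> D1 D2
    assume P: "dist P P0 < R" and U: "open U" "P \<in> U" and D: "C2_with U \<phi> D1 D2"
      and min: "\<forall>\<^sub>F Q in nhds P. w P - \<phi> P \<le> w Q - \<phi> Q"
    obtain p t where pt: "P = (p, t)" by (cases P)
    have "dist t (snd P0) < R"
      using dist_snd_le[of P P0] P by (simp add: pt)
    then have t: "0 < t" using r by (auto simp: dist_real_def)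
    have "\<forall>\<^sub>F Q in nhds P. snd Q > 0"
      using eventually_nhds_in_open[of "{Q. snd Q > 0}" P] t
      by (simp add: pt open_Collect_less continuous_on_snd)
    with min have "\<forall>\<^sub>F Q in nhds P. u Q - \<phi> Q \<ge> u P - \<phi> P"
      by eventually_elim (use w(2) t pt in auto)
    moreover have "(p, t) \<in> space_time" using t by simp
    ultimately have "0 \<le> parabolic_op A f \<phi> p t"
      using super C2_with_near[OF D U] unfolding viscosity_supersolution_def pt by blast
    also have "\<dots> = - mop (s1, s2, 0) (r1, r2, 0) (0, 0, - 1) D1 D2 P + f p (hgrad_of D1 P)"
      using parabolic_op_eq[OF D U(1) U(2)[unfolded pt] A] by (simp add: pt)
    also have "f p (hgrad_of D1 P) \<le> f (fst P0) (hgrad_of D1 P) + \<omega>"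
      using \<omega> dist_fst_le[of P P0] P by (simp add: pt)
    also have "f (fst P0) (hgrad_of D1 P) \<le> f (fst P0) m + b \<bullet> (hgrad_of D1 P - m)"
      by (rule b)
    finally show "mop (s1, s2, 0) (r1, r2, 0) (- (b $ 1), - (b $ 2), - 1) D1 D2 P \<le> l0"
      unfolding mop_drift[of _ _ "- (b $ 1)"] bv l0_def by (simp add: inner_diff_right)
  qed
  then show ?thesis
    unfolding mop_drift[of _ _ "- (b $ 1)"] bv l0_def m_def[symmetric] by simp
qed

lemma mol_uniform:
  fixes w :: "heis \<times> real \<Rightarrow> real"
  assumes w: "continuous_on UNIV w" and "0 < \<delta>"
  obtains \<eta>0 where "0 < \<eta>0" "\<And>\<eta> P. 0 < \<eta> \<Longrightarrow> \<eta> < \<eta>0 \<Longrightarrow> norm P \<le> \<rho> \<Longrightarrow> \<bar>mol \<eta> w P - w P\<bar> \<le> \<delta>"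
proof -
  define H where "H = (\<lambda>(K, P). w (gmul (ginv K) P))"
  have H: "continuous_on UNIV H"
    unfolding H_def split_beta by (intro continuous_on_compose2[OF w] continuous_intros) auto
  obtain d where d: "0 < d" "\<And>K P. norm K < d \<Longrightarrow> P \<in> cball 0 \<rho> \<Longrightarrow> \<bar>H (K, P) - H (0, P)\<bar> < \<delta>"
    using uniform_at_0[OF H compact_cball[of 0 \<rho>] \<open>0 < \<delta>\<close>] by blast
  have g0: "ginv 0 = 0" using ginv_simp[of 0 0 0 0] by (simp add: zero_prod_def)
  show ?thesis
  proof (rule that[OF d(1)])
    fix \<eta> :: real and P :: "heis \<times> real"
    assume \<eta>: "0 < \<eta>" "\<eta> < d" and P: "norm P \<le> \<rho>"
    show "\<bar>mol \<eta> w P - w P\<bar> \<le> \<delta>"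
    proof (rule mol_near[OF \<eta>(1) w])
      fix Q assume Q: "norm (gmul P (ginv Q)) < \<eta>"
      have "gmul (ginv (gmul P (ginv Q))) P = Q"
        by (simp add: ginv_gmul gmul_assoc)
      then show "\<bar>w Q - w P\<bar> \<le> \<delta>"
        using d(2)[of "gmul P (ginv Q)" P] Q \<eta> P by (simp add: H_def g0)
    qed
  qed
qed

lemma continuous_on_gauge_norm [continuous_intros]:
  assumes "continuous_on S g"
  shows "continuous_on S (\<lambda>x. gauge_norm (g x))"
proof -
  have gn: "gauge_norm = (\<lambda>p. root 4 (((fst p)\<^sup>2 + (fst (snd p))\<^sup>2)\<^sup>2 + 16 * (snd (snd p))\<^sup>2))"
    by (auto simp: fun_eq_iff)
  show ?thesis
    unfolding gn using assms by (intro continuous_intros)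
qed

text \<open>The gauge of \<open>q p^-1\<close> tends to 0 with \<open>q - p\<close>, uniformly for
  bounded \<open>p\<close>. Uniformity in \<open>\<zeta>\<close> matters because no bound on the
  gradients is available.\<close>

lemma f_modulus:
  fixes f :: "heis \<Rightarrow> 'a \<Rightarrow> real"
  assumes A2: "\<forall>\<rho>>0. \<exists>L2>0. \<forall>p q w. norm p \<le> \<rho> \<longrightarrow> norm q \<le> \<rho> \<longrightarrow>
               \<bar>f p w - f q w\<bar> \<le> L2 * gauge_norm (p \<odot> hinv q)"
    and \<rho>: "0 \<le> \<rho>" and \<omega>: "0 < \<omega>"
  obtains R where "0 < R" "\<And>p q \<zeta>. norm p \<le> \<rho> \<Longrightarrow> dist q p < R \<Longrightarrow> f q \<zeta> \<le> f p \<zeta> + \<omega>"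
proof -
  obtain L2 where L2: "0 < L2" "\<And>p q w. norm p \<le> \<rho> + 1 \<Longrightarrow> norm q \<le> \<rho> + 1 \<Longrightarrow>
               \<bar>f p w - f q w\<bar> \<le> L2 * gauge_norm (p \<odot> hinv q)"
    using A2[rule_format, of "\<rho> + 1"] \<rho> by auto
  define H where "H = (\<lambda>(s :: heis, p :: heis). gauge_norm (fst (gmul (p + s, 0) (ginv (p, 0)))))"
  have H: "continuous_on UNIV H"
    unfolding H_def split_beta by (intro continuous_intros)
  have H0: "H (0, p) = 0" for p
    by (cases p) (simp add: H_def gmul_def ginv_def zero_prod_def)
  obtain d where d: "0 < d" "\<And>s p. norm s < d \<Longrightarrow> p \<in> cball 0 \<rho> \<Longrightarrow> \<bar>H (s, p) - H (0, p)\<bar> < \<omega> / L2"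
    using uniform_at_0[OF H compact_cball[of 0 \<rho>], of "\<omega> / L2"] \<omega> L2 by auto
  show ?thesis
  proof (rule that[of "min d 1"])
    show "0 < min d 1" using d by simp
    fix p q :: heis and \<zeta> assume p: "norm p \<le> \<rho>" and q: "dist q p < min d 1"
    have "norm q \<le> \<rho> + 1"
      using q p norm_triangle_sub[of q p] by (simp add: dist_norm)
    then have "\<bar>f q \<zeta> - f p \<zeta>\<bar> \<le> L2 * gauge_norm (q \<odot> hinv p)"
      using L2 p by simp
    also have "gauge_norm (q \<odot> hinv p) = H (q - p, p)"
      by (simp add: H_def gmul_def ginv_def)
    also have "L2 * \<dots> \<le> L2 * (\<omega> / L2)"
      using d(2)[of "q - p" p] q p L2 by (intro mult_left_mono) (auto simp: H0 dist_norm)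
    finally show "f q \<zeta> \<le> f p \<zeta> + \<omega>" using L2 by simp
  qed
qed

section \<open>Growth weights\<close>

text \<open>One plus the fourth power of the gauge: a polynomial that dominates the fourth power of
  \<open>japanese\<close> and has horizontal derivatives controlled by powers of its own fourth
  root.\<close>

fun hN :: "heis \<Rightarrow> real" where
  "hN (x, y, z) = 1 + (x\<^sup>2 + y\<^sup>2)\<^sup>2 + 16 * z\<^sup>2"

lemma hN_ge_1: "1 \<le> hN p"
  by (cases p) simp

lemma japanese_le_hN: "japanese p \<le> root 4 (hN p)"
proof (cases p)
  case (fields x y z)
  have "x ^ 4 + y ^ 4 \<le> (x\<^sup>2 + y\<^sup>2)\<^sup>2"
    by (simp add: power2_sum flip: power_mult)
  then show ?thesis using fields by simp
qed

lemma norm_le_hN: "(norm p)\<^sup>2 \<le> hN p"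
proof (cases p)
  case (fields x y z)
  have "x\<^sup>2 + y\<^sup>2 \<le> 1 + (x\<^sup>2 + y\<^sup>2)\<^sup>2"
    by (smt (verit) power2_eq_square mult_left_le mult_le_cancel_left1 zero_le_power2 self_le_power)
  moreover have "z\<^sup>2 \<le> 16 * z\<^sup>2" by simp
  moreover have "(norm p)\<^sup>2 = x\<^sup>2 + y\<^sup>2 + z\<^sup>2" "hN p = 1 + (x\<^sup>2 + y\<^sup>2)\<^sup>2 + 16 * z\<^sup>2"
    using fields by (simp_all add: norm_Pair)
  ultimately show ?thesis by linarith
qed

text \<open>Bounded left translations change the weight by a bounded factor. This is needed both for
  the translates by \<open>h\<close> and for points in the support of the kernel.\<close>

lemma hN_left:
  assumes r: "0 \<le> r"
  obtains c where "1 \<le> c" "\<And>k p. norm k \<le> r \<Longrightarrow> hN (k \<odot> p) \<le> c * hN p"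
proof -
  define R where "R = (1 + r)\<^sup>2"
  have R: "1 \<le> R" using r by (simp add: R_def)
  show ?thesis
  proof (rule that[of "200 * R\<^sup>2"])
    have R2: "R \<le> R\<^sup>2" "1 \<le> R\<^sup>2" using R by (auto simp: power2_eq_square mult_le_cancel_left1 mult_ge1_I)
    then show "1 \<le> 200 * R\<^sup>2" by simp
    fix k p :: heis assume k: "norm k \<le> r"
    obtain a b e where abe: "k = (a, b, e)" by (metis prod.exhaust)
    obtain x y z where xyz: "p = (x, y, z)" by (metis prod.exhaust)
    define q where "q = x\<^sup>2 + y\<^sup>2"
    have q: "0 \<le> q" by (simp add: q_def)
    have "(norm k)\<^sup>2 \<le> (1 + r)\<^sup>2" using k r by (intro power_mono) auto
    then have ab: "a\<^sup>2 + b\<^sup>2 + e\<^sup>2 \<le> R"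
      by (simp add: abe norm_Pair R_def)
    have q1: "(a + x)\<^sup>2 + (b + y)\<^sup>2 \<le> 2 * R + 2 * q"
    proof -
      have "(a + x)\<^sup>2 + (b + y)\<^sup>2 + ((a - x)\<^sup>2 + (b - y)\<^sup>2) = 2 * (a\<^sup>2 + b\<^sup>2) + 2 * q"
        by (simp add: q_def power2_eq_square algebra_simps)
      moreover have "0 \<le> (a - x)\<^sup>2 + (b - y)\<^sup>2" "0 \<le> e\<^sup>2" by auto
      ultimately show ?thesis using ab by (simp only: distrib_left)
    qed
    have sq: "(s + t)\<^sup>2 \<le> 2 * s\<^sup>2 + 2 * t\<^sup>2" for s t :: real
      using sum_squares_bound[of s t] by (simp add: power2_sum)
    have "((a + x)\<^sup>2 + (b + y)\<^sup>2)\<^sup>2 \<le> (2 * R + 2 * q)\<^sup>2"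
      using q1 by (intro power_mono) auto
    also have "\<dots> \<le> 8 * R\<^sup>2 + 8 * q\<^sup>2"
      using sq[of "2 * R" "2 * q"] by (simp add: power_mult_distrib)
    finally have 1: "((a + x)\<^sup>2 + (b + y)\<^sup>2)\<^sup>2 \<le> 8 * R\<^sup>2 + 8 * q\<^sup>2" .
    have "(a * y - x * b)\<^sup>2 + (a * x + b * y)\<^sup>2 = (a\<^sup>2 + b\<^sup>2) * q"
      by (simp add: q_def power2_eq_square algebra_simps)
    moreover have "(a\<^sup>2 + b\<^sup>2) * q \<le> R * q"
    proof (rule mult_right_mono[OF _ q])
      have "0 \<le> e\<^sup>2" by simp
      with ab show "a\<^sup>2 + b\<^sup>2 \<le> R" by linarith
    qed
    moreover have "0 \<le> (a * x + b * y)\<^sup>2" by simp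
    ultimately have c: "(a * y - x * b)\<^sup>2 \<le> R * q" by linarith
    have q2: "q \<le> 1 + q\<^sup>2"
    proof -
      have "0 \<le> (q - 1/2)\<^sup>2" by simp
      then show ?thesis by (simp add: power2_eq_square algebra_simps)
    qed
    have "R * q \<le> R\<^sup>2 * (1 + q\<^sup>2)"
      using q q2 R R2 by (intro mult_mono) auto
    with c have c': "(a * y - x * b)\<^sup>2 \<le> R\<^sup>2 + R\<^sup>2 * q\<^sup>2" by (simp add: algebra_simps)
    have "(e + z + (a * y - x * b) / 2)\<^sup>2 \<le> 2 * (e + z)\<^sup>2 + 2 * ((a * y - x * b) / 2)\<^sup>2"
      by (rule sq)
    also have "((a * y - x * b) / 2)\<^sup>2 = (a * y - x * b)\<^sup>2 / 4"
      by (simp add: power_divide)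
    also have "(e + z)\<^sup>2 \<le> 2 * e\<^sup>2 + 2 * z\<^sup>2" by (rule sq)
    finally have 2: "(e + z + (a * y - x * b) / 2)\<^sup>2 \<le> 4 * e\<^sup>2 + 4 * z\<^sup>2 + (a * y - x * b)\<^sup>2 / 2"
      by simp
    have e: "e\<^sup>2 \<le> R\<^sup>2"
    proof -
      have "0 \<le> a\<^sup>2" "0 \<le> b\<^sup>2" by auto
      with ab R2 show ?thesis by linarith
    qed
    have "hN (k \<odot> p) = 1 + ((a + x)\<^sup>2 + (b + y)\<^sup>2)\<^sup>2 + 16 * (e + z + (a * y - x * b) / 2)\<^sup>2"
      by (simp add: abe xyz)
    also have "\<dots> \<le> 1 + 80 * R\<^sup>2 + 8 * q\<^sup>2 + 64 * z\<^sup>2 + 8 * (R\<^sup>2 * q\<^sup>2)"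
      using 1 2 e c' by linarith
    also have "\<dots> \<le> 200 * R\<^sup>2 + 200 * (R\<^sup>2 * q\<^sup>2) + 3200 * (R\<^sup>2 * z\<^sup>2)"
    proof -
      have "1 * q\<^sup>2 \<le> R\<^sup>2 * q\<^sup>2" "1 * z\<^sup>2 \<le> R\<^sup>2 * z\<^sup>2"
        using mult_right_mono[OF R2(2), of "q\<^sup>2"] mult_right_mono[OF R2(2), of "z\<^sup>2"] by auto
      then have "q\<^sup>2 \<le> R\<^sup>2 * q\<^sup>2" "z\<^sup>2 \<le> R\<^sup>2 * z\<^sup>2" by simp_all
      moreover have "0 \<le> z\<^sup>2" "0 \<le> q\<^sup>2" by auto
      ultimately show ?thesis using R2 by linarith
    qed
    also have "\<dots> = 200 * R\<^sup>2 * hN p"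
      by (simp add: xyz q_def algebra_simps)
    finally show "hN (k \<odot> p) \<le> 200 * R\<^sup>2 * hN p" .
  qed
qed

lemma DERIV_exp_root:
  fixes \<kappa> :: real
  defines "h0 \<equiv> \<lambda>n. exp (\<kappa> * n powr (1/4))"
    and "h1 \<equiv> \<lambda>n. exp (\<kappa> * n powr (1/4)) * (\<kappa> / 4 * n powr (- 3/4))"
    and "h2 \<equiv> \<lambda>n. exp (\<kappa> * n powr (1/4)) *
      ((\<kappa> / 4 * n powr (- 3/4))\<^sup>2 - 3 * \<kappa> / 16 * n powr (- 7/4))"
  assumes n: "0 < n"
  shows "(h0 has_real_derivative h1 n) (at n)" "(h1 has_real_derivative h2 n) (at n)"
proof -
  have p: "((\<lambda>n. n powr r) has_real_derivative r * n powr (r - 1)) (at n)" for r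
    by (rule has_real_derivative_powr[OF n])
  have e: "((\<lambda>n. exp (\<kappa> * n powr (1/4))) has_real_derivative
      exp (\<kappa> * n powr (1/4)) * (\<kappa> / 4 * n powr (- 3/4))) (at n)"
    using DERIV_fun_exp[OF DERIV_cmult[OF p[of "1/4"], of \<kappa>]] by simp
  then show "(h0 has_real_derivative h1 n) (at n)"
    by (simp add: h0_def h1_def)
  have "((\<lambda>n. \<kappa> / 4 * n powr (- 3/4)) has_real_derivative - 3 * \<kappa> / 16 * n powr (- 7/4)) (at n)"
    by (rule DERIV_cong[OF DERIV_cmult[OF p[of "- 3/4"], of "\<kappa> / 4"]]) simp
  from DERIV_mult[OF e this] show "(h1 has_real_derivative h2 n) (at n)"
    unfolding h1_def h2_def by (rule DERIV_cong) (simp add: power2_eq_square algebra_simps)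
qed

text \<open>
  With \<open>J = N\<^sup>1\<^sup>/\<^sup>4\<close> the first and second derivatives of \<open>N\<close> along a horizontal direction of
  length \<open>v\<close> are at most \<open>8 J\<^sup>3 v\<close> and \<open>12 J\<^sup>2 v\<^sup>2\<close>, so that \<open>exp (\<kappa> J)\<close> is controlled
  by itself.
\<close>

lemma exp_root_bounds:
  fixes \<kappa> n d1 d2 v :: real
  assumes n: "1 \<le> n" and \<kappa>: "0 \<le> \<kappa>" and v: "0 \<le> v"
    and d1: "\<bar>d1\<bar> \<le> 8 * (n powr (1/4)) ^ 3 * v" and d2: "d2 \<le> 12 * (n powr (1/4))\<^sup>2 * v\<^sup>2"
  shows "\<bar>exp (\<kappa> * n powr (1/4)) * (\<kappa> / 4 * n powr (- 3/4)) * d1\<bar> \<le> exp (\<kappa> * n powr (1/4)) * (2 * \<kappa> * v)"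
    and "exp (\<kappa> * n powr (1/4)) * ((\<kappa> / 4 * n powr (- 3/4))\<^sup>2 - 3 * \<kappa> / 16 * n powr (- 7/4)) * d1\<^sup>2 +
      exp (\<kappa> * n powr (1/4)) * (\<kappa> / 4 * n powr (- 3/4)) * d2 \<le>
      exp (\<kappa> * n powr (1/4)) * ((4 * \<kappa>\<^sup>2 + 3 * \<kappa>) * v\<^sup>2)"
proof -
  define J where "J = n powr (1/4)"
  have J: "1 \<le> J" unfolding J_def using n by (simp add: ge_one_powr_ge_zero)
  have J0: "0 < J" using J by simp
  have m3: "n powr (- 3/4) = 1 / J ^ 3"
    using n by (simp add: J_def powr_power powr_minus_divide[symmetric])
  define a where "a = \<kappa> / 4 * (1 / J ^ 3)"
  have a: "0 \<le> a" using \<kappa> J0 by (simp add: a_def)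
  have "\<bar>a * d1\<bar> = a * \<bar>d1\<bar>" using a by (simp add: abs_mult)
  also have "\<dots> \<le> a * (8 * J ^ 3 * v)"
    using d1 a by (intro mult_left_mono) (auto simp: J_def)
  also have "\<dots> = 2 * \<kappa> * v" using J0 by (simp add: a_def)
  finally have ad1: "\<bar>a * d1\<bar> \<le> 2 * \<kappa> * v" .
  have E: "0 \<le> exp (\<kappa> * J)" by simp
  show "\<bar>exp (\<kappa> * n powr (1/4)) * (\<kappa> / 4 * n powr (- 3/4)) * d1\<bar> \<le> exp (\<kappa> * n powr (1/4)) * (2 * \<kappa> * v)"
    unfolding m3 J_def[symmetric] a_def[symmetric] mult.assoc
    using mult_left_mono[OF ad1 E] by (simp add: abs_mult)
  have "(a * d1)\<^sup>2 \<le> (2 * \<kappa> * v)\<^sup>2"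
    using ad1 by (metis abs_ge_zero power2_abs power_mono)
  then have 1: "a\<^sup>2 * d1\<^sup>2 \<le> 4 * \<kappa>\<^sup>2 * v\<^sup>2" by (simp add: power_mult_distrib)
  have "a * d2 \<le> a * (12 * J\<^sup>2 * v\<^sup>2)"
    using d2 a by (intro mult_left_mono) (auto simp: J_def)
  also have "\<dots> = 3 * \<kappa> * v\<^sup>2 * (1 / J)"
    using J0 by (simp add: a_def power2_eq_square power3_eq_cube)
  also have "\<dots> \<le> 3 * \<kappa> * v\<^sup>2 * 1"
    using J \<kappa> by (intro mult_left_mono) auto
  finally have 2: "a * d2 \<le> 3 * \<kappa> * v\<^sup>2" by simp
  \<comment> \<open>The second summand of the second derivative of the profile has a favourable sign
    and is dropped.\<close>
  have 3: "0 \<le> 3 * \<kappa> / 16 * n powr (- 7/4) * d1\<^sup>2" using \<kappa> by simp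
  have "(a\<^sup>2 - 3 * \<kappa> / 16 * n powr (- 7/4)) * d1\<^sup>2 + a * d2 \<le> (4 * \<kappa>\<^sup>2 + 3 * \<kappa>) * v\<^sup>2"
    using 1 2 3 by (simp add: algebra_simps)
  from mult_left_mono[OF this E]
  show "exp (\<kappa> * n powr (1/4)) * ((\<kappa> / 4 * n powr (- 3/4))\<^sup>2 - 3 * \<kappa> / 16 * n powr (- 7/4)) * d1\<^sup>2 +
      exp (\<kappa> * n powr (1/4)) * (\<kappa> / 4 * n powr (- 3/4)) * d2 \<le>
      exp (\<kappa> * n powr (1/4)) * ((4 * \<kappa>\<^sup>2 + 3 * \<kappa>) * v\<^sup>2)"
    unfolding m3 J_def[symmetric] a_def[symmetric] by (simp add: algebra_simps)
qed

text \<open>By Lagrange's identity the radial and the rotational component of the direction have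
  squares adding up to the product of the squared lengths. The coefficient 16 of the vertical term
  gives both squares the same factor in the second derivative, which is therefore exactly
  \<open>12 * Q * v\<^sup>2\<close>.\<close>

lemma hN_horizontal_derivatives:
  fixes x y z a b :: real
  defines "n \<equiv> \<lambda>r. hN (x + r * a, y + r * b, z + r * ((x * b - y * a) / 2))"
  shows "\<exists>n1 n2. (\<forall>r. (n has_real_derivative n1 r) (at r)) \<and> (n1 has_real_derivative n2) (at 0) \<and>
    \<bar>n1 0\<bar> \<le> 8 * (n 0 powr (1/4)) ^ 3 * sqrt (a\<^sup>2 + b\<^sup>2) \<and>
    n2 \<le> 12 * (n 0 powr (1/4))\<^sup>2 * (sqrt (a\<^sup>2 + b\<^sup>2))\<^sup>2"
proof -
  define q where "q = (\<lambda>r. (x + r * a)\<^sup>2 + (y + r * b)\<^sup>2)"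
  define c where "c = (x * b - y * a) / 2"
  define n1 where "n1 = (\<lambda>r. 2 * q r * (2 * (x + r * a) * a + 2 * (y + r * b) * b) + 32 * (z + r * c) * c)"
  define n2 where "n2 = 2 * (2 * x * a + 2 * y * b)\<^sup>2 + 4 * q 0 * (a\<^sup>2 + b\<^sup>2) + 32 * c\<^sup>2"
  have n_eq: "n = (\<lambda>r. 1 + (q r)\<^sup>2 + 16 * (z + r * c)\<^sup>2)"
    by (simp add: n_def q_def c_def)
  have dq: "(q has_real_derivative 2 * (x + r * a) * a + 2 * (y + r * b) * b) (at r)" for r
    unfolding q_def by (auto intro!: derivative_eq_intros simp: algebra_simps)
  have dn: "(n has_real_derivative n1 r) (at r)" for r
    unfolding n_eq n1_def by (auto intro!: derivative_eq_intros dq)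
  have dn1: "(n1 has_real_derivative n2) (at 0)"
    unfolding n1_def n2_def by (auto intro!: derivative_eq_intros dq simp: power2_eq_square algebra_simps)
  define Q where "Q = x\<^sup>2 + y\<^sup>2"
  define v where "v = sqrt (a\<^sup>2 + b\<^sup>2)"
  define s where "s = sqrt Q"
  have Q: "0 \<le> Q" by (simp add: Q_def)
  have s: "0 \<le> s" "s\<^sup>2 = Q" using Q by (simp_all add: s_def)
  have v: "0 \<le> v" "v\<^sup>2 = a\<^sup>2 + b\<^sup>2" by (simp_all add: v_def)
  define J where "J = n 0 powr (1/4)"
  have n0: "n 0 = 1 + Q\<^sup>2 + 16 * z\<^sup>2" by (simp add: n_def Q_def)
  have n0': "1 \<le> n 0" by (simp add: n0)
  have J0: "0 \<le> J" by (simp add: J_def)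
  have J4: "J ^ 4 = n 0" using n0' by (simp add: J_def powr_power)
  have J2: "Q \<le> J\<^sup>2" "4 * \<bar>z\<bar> \<le> J\<^sup>2"
  proof -
    have "Q\<^sup>2 \<le> (J\<^sup>2)\<^sup>2" "(4 * \<bar>z\<bar>)\<^sup>2 \<le> (J\<^sup>2)\<^sup>2"
      using J4 by (simp_all add: n0 power_mult_distrib flip: power_mult)
    then show "Q \<le> J\<^sup>2" "4 * \<bar>z\<bar> \<le> J\<^sup>2" by (auto intro: power2_le_imp_le)
  qed
  have sJ: "s \<le> J" using J2(1) J0 s by (auto intro: power2_le_imp_le)
  have lag: "(x * a + y * b)\<^sup>2 + (x * b - y * a)\<^sup>2 = s\<^sup>2 * v\<^sup>2"
    unfolding s v Q_def by (simp add: power2_eq_square algebra_simps)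
  have d: "\<bar>x * a + y * b\<bar> \<le> s * v" "\<bar>x * b - y * a\<bar> \<le> s * v"
  proof -
    have "0 \<le> (x * a + y * b)\<^sup>2" "0 \<le> (x * b - y * a)\<^sup>2" by auto
    with lag have "(x * a + y * b)\<^sup>2 \<le> (s * v)\<^sup>2" "(x * b - y * a)\<^sup>2 \<le> (s * v)\<^sup>2"
      unfolding power_mult_distrib by linarith+
    then show "\<bar>x * a + y * b\<bar> \<le> s * v" "\<bar>x * b - y * a\<bar> \<le> s * v"
      using s v by (simp_all add: abs_le_square_iff[symmetric])
  qed
  have n1: "n1 0 = 4 * Q * (x * a + y * b) + 16 * z * (x * b - y * a)"
    by (simp add: n1_def q_def c_def Q_def algebra_simps diff_divide_distrib)
  have "\<bar>n1 0\<bar> \<le> 4 * Q * \<bar>x * a + y * b\<bar> + 4 * (4 * \<bar>z\<bar>) * \<bar>x * b - y * a\<bar>"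
    unfolding n1 using Q by (intro order_trans[OF abs_triangle_ineq]) (simp add: abs_mult)
  also have "\<dots> \<le> 4 * J\<^sup>2 * (J * v) + 4 * J\<^sup>2 * (J * v)"
  proof (rule add_mono)
    have sv: "s * v \<le> J * v" using sJ v by (intro mult_right_mono)
    show "4 * Q * \<bar>x * a + y * b\<bar> \<le> 4 * J\<^sup>2 * (J * v)"
      using d sv J2 Q by (intro mult_mono) auto
    show "4 * (4 * \<bar>z\<bar>) * \<bar>x * b - y * a\<bar> \<le> 4 * J\<^sup>2 * (J * v)"
      using d sv J2 by (intro mult_mono) auto
  qed
  also have "\<dots> = 8 * J ^ 3 * v" by (simp add: power2_eq_square power3_eq_cube)
  finally have 1: "\<bar>n1 0\<bar> \<le> 8 * (n 0 powr (1/4)) ^ 3 * sqrt (a\<^sup>2 + b\<^sup>2)"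
    by (simp add: J_def v_def)
  have "n2 = 8 * ((x * a + y * b)\<^sup>2 + (x * b - y * a)\<^sup>2) + 4 * Q * v\<^sup>2"
    unfolding v(2) n2_def q_def c_def Q_def by (simp add: power2_eq_square field_simps)
  also have "\<dots> = 12 * Q * v\<^sup>2" unfolding lag s(2) by simp
  also have "\<dots> \<le> 12 * J\<^sup>2 * v\<^sup>2" using J2 by (intro mult_right_mono) auto
  finally have 2: "n2 \<le> 12 * (n 0 powr (1/4))\<^sup>2 * (sqrt (a\<^sup>2 + b\<^sup>2))\<^sup>2"
    by (simp add: J_def v_def)
  show ?thesis using dn dn1 1 2 by blast
qed

lemma C2_on_hN: "C2_on U (\<lambda>P :: heis \<times> real. hN (fst P))"
proof -
  have eq: "hN (fst P) = 1 + ((fst (fst P))\<^sup>2 + (fst (snd (fst P)))\<^sup>2)\<^sup>2 + 16 * (snd (snd (fst P)))\<^sup>2"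
    for P :: "heis \<times> real"
    by (rule st_cases[of P]) simp
  show ?thesis
    unfolding eq
    by (intro C2_intros C2_on_linear bounded_linear_intros bounded_linear_fst_comp bounded_linear_snd_comp)
qed

text \<open>The weight is \<open>exp (C * t)\<close> times the exponential of
  \<open>\<kappa>\<close> times the fourth root of \<open>hN\<close>, plus
  \<open>1 / (T - t)\<close>. The spatial part beats the growth of the solution, the time factor
  makes the sum a strict supersolution with room for the Lipschitz term, and the singular part keeps
  maxima away from \<open>T\<close>.\<close>

lemma weight_exists:
  fixes \<kappa> L T s1 s2 r1 r2 :: real
  assumes \<kappa>: "0 \<le> \<kappa>" and L: "0 \<le> L"
  obtains V D1 D2 where "C2_with (UNIV \<times> {..<T}) V D1 D2"
    "\<And>p t. 0 \<le> t \<Longrightarrow> t < T \<Longrightarrow> exp (\<kappa> * root 4 (hN p)) \<le> V (p, t)"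
    "\<And>p t. 0 \<le> t \<Longrightarrow> t < T \<Longrightarrow> 1 / (T - t) \<le> V (p, t)"
    "\<And>p t. 0 \<le> t \<Longrightarrow> t < T \<Longrightarrow>
       1 + L * norm (hgrad_of D1 (p, t)) \<le> - mop (s1, s2, 0) (r1, r2, 0) (0, 0, - 1) D1 D2 (p, t)"
proof -
  define m where "m = s1\<^sup>2 + s2\<^sup>2 + (r1\<^sup>2 + r2\<^sup>2)"
  \<comment> \<open>Second-order terms, then \<open>L\<close> times the bound
    \<open>4 * \<kappa>\<close> for the gradient (twice \<open>2 * \<kappa>\<close>, one per
    component), then 1 for strictness; all relative to the weight itself.\<close>
  define C where "C = (4 * \<kappa>\<^sup>2 + 3 * \<kappa>) * m + L * (4 * \<kappa>) + 1"
  define h0 where "h0 = (\<lambda>n. exp (\<kappa> * n powr (1/4)))"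
  define h1 where "h1 = (\<lambda>n. exp (\<kappa> * n powr (1/4)) * (\<kappa> / 4 * n powr (- 3/4)))"
  define h2 where "h2 = (\<lambda>n. exp (\<kappa> * n powr (1/4)) * ((\<kappa> / 4 * n powr (- 3/4))\<^sup>2 - 3 * \<kappa> / 16 * n powr (- 7/4)))"
  have dh: "(h0 has_real_derivative h1 n) (at n)" "(h1 has_real_derivative h2 n) (at n)" if "0 < n" for n
    unfolding h0_def h1_def h2_def using DERIV_exp_root[OF that] by auto
  define V where "V P = exp (C * snd P) * h0 (hN (fst P)) + inverse (T - snd P)" for P :: "heis \<times> real"
  define U where "U = (UNIV :: heis set) \<times> {..<T}"
  have U: "open U" unfolding U_def by (intro open_Times) auto
  have hN0: "0 < hN p" for p using hN_ge_1[of p] by linarith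
  have C2t: "C2_on U (\<lambda>P :: heis \<times> real. snd P)"
    by (intro C2_on_linear bounded_linear_intros)
  have "C2_on U V"
    unfolding V_def
  proof (intro C2_on_add C2_on_mult)
    show "C2_on U (\<lambda>P :: heis \<times> real. exp (C * snd P))"
      by (rule C2_on_compose_real[OF C2t, where h="\<lambda>s. exp (C * s)" and ?h1.0="\<lambda>s. C * exp (C * s)"
            and ?h2.0="\<lambda>s. C * (C * exp (C * s))"])
        (auto intro!: derivative_eq_intros continuous_intros)
    show "C2_on U (\<lambda>P. h0 (hN (fst P)))"
    proof (rule C2_on_compose_real[OF C2_on_hN])
      show "(h0 has_real_derivative h1 (hN (fst x))) (at (hN (fst x)))"
        "(h1 has_real_derivative h2 (hN (fst x))) (at (hN (fst x)))" for x :: "heis \<times> real"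
        using dh hN0 by auto
      show "continuous_on ((\<lambda>P. hN (fst P)) ` U) h2"
        unfolding h2_def using hN0 less_imp_neq
        by (intro continuous_intros) (fastforce simp: less_le)+
    qed
    show "C2_on U (\<lambda>P :: heis \<times> real. inverse (T - snd P))"
    proof (rule C2_on_compose_real[OF C2_on_diff[OF C2_on_const C2t], where h=inverse and
          ?h1.0="\<lambda>s. - (inverse s)\<^sup>2" and ?h2.0="\<lambda>s. 2 * (inverse s) ^ 3"])
      show "(inverse has_real_derivative - (inverse (T - snd x))\<^sup>2) (at (T - snd x))"
        "((\<lambda>s. - (inverse s)\<^sup>2) has_real_derivative 2 * (inverse (T - snd x)) ^ 3) (at (T - snd x))"
        if "x \<in> U" for x
        using that by (auto simp: U_def power2_eq_square power3_eq_cube intro!: derivative_eq_intros)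
      show "continuous_on ((\<lambda>x. T - snd x) ` U) (\<lambda>s. 2 * (inverse s) ^ 3)"
        by (intro continuous_intros) (auto simp: U_def)
    qed
  qed
  then obtain D1 D2 where D: "C2_with U V D1 D2"
    using C2_on_iff by blast
  have hor: "\<bar>D1 (p, t) (fld (a, b, 0) (p, t))\<bar> \<le> exp (C * t) * (h0 (hN p) * (2 * \<kappa> * sqrt (a\<^sup>2 + b\<^sup>2)))"
    "D2 (p, t) (fld (a, b, 0) (p, t)) (fld (a, b, 0) (p, t)) \<le> exp (C * t) * (h0 (hN p) * ((4 * \<kappa>\<^sup>2 + 3 * \<kappa>) * (a\<^sup>2 + b\<^sup>2)))"
    if t: "t < T" for p t a b
  proof -
    obtain x y z where xyz: "p = (x, y, z)" by (metis prod.exhaust)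
    define c where "c = (x * b - y * a) / 2"
    define n where "n = (\<lambda>r. hN (x + r * a, y + r * b, z + r * c))"
    have "\<exists>n1 n2. (\<forall>r. (n has_real_derivative n1 r) (at r)) \<and> (n1 has_real_derivative n2) (at 0) \<and>
      \<bar>n1 0\<bar> \<le> 8 * (n 0 powr (1/4)) ^ 3 * sqrt (a\<^sup>2 + b\<^sup>2) \<and>
      n2 \<le> 12 * (n 0 powr (1/4))\<^sup>2 * (sqrt (a\<^sup>2 + b\<^sup>2))\<^sup>2"
      unfolding n_def c_def by (rule hN_horizontal_derivatives)
    then obtain n1 n2 where nd: "\<And>r. (n has_real_derivative n1 r) (at r)" "(n1 has_real_derivative n2) (at 0)"
      "\<bar>n1 0\<bar> \<le> 8 * (n 0 powr (1/4)) ^ 3 * sqrt (a\<^sup>2 + b\<^sup>2)"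
      "n2 \<le> 12 * (n 0 powr (1/4))\<^sup>2 * (sqrt (a\<^sup>2 + b\<^sup>2))\<^sup>2"
      by blast
    have pU: "(p, t) \<in> U" using t by (simp add: U_def)
    have n_pos: "0 < n r" for r unfolding n_def by (rule hN0)
    have g: "V ((p, t) + r *\<^sub>R fld (a, b, 0) (p, t)) = exp (C * t) * h0 (n r) + inverse (T - t)" for r
      by (simp add: V_def xyz n_def c_def)
    have g1: "((\<lambda>r. exp (C * t) * h0 (n r) + inverse (T - t)) has_real_derivative exp (C * t) * (h1 (n r) * n1 r)) (at r)" for r
      by (rule DERIV_cong[OF DERIV_add[OF DERIV_cmult[OF DERIV_chain2[OF dh(1)[OF n_pos] nd(1)]] DERIV_const]]) simp
    have g2: "((\<lambda>r. exp (C * t) * (h1 (n r) * n1 r)) has_real_derivative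
        exp (C * t) * (h2 (n 0) * n1 0 * n1 0 + n2 * h1 (n 0))) (at 0)"
      by (rule DERIV_cmult[OF DERIV_mult[OF DERIV_chain2[OF dh(2)[OF n_pos] nd(1)] nd(2)]])
    note line = derivs_along_line[OF D U pU g g1 g2]
    have n0: "n 0 = hN p" by (simp add: n_def xyz)
    have nn: "1 \<le> n 0" unfolding n_def by (rule hN_ge_1)
    note bd = exp_root_bounds[OF nn \<kappa> real_sqrt_ge_zero nd(3,4)]
    have ab: "0 \<le> a\<^sup>2 + b\<^sup>2" by simp
    show "\<bar>D1 (p, t) (fld (a, b, 0) (p, t))\<bar> \<le> exp (C * t) * (h0 (hN p) * (2 * \<kappa> * sqrt (a\<^sup>2 + b\<^sup>2)))"
      unfolding line(1) abs_mult abs_exp_cancel n0[symmetric]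
      using bd(1)[OF ab] unfolding h1_def h0_def abs_mult by (intro mult_left_mono) auto
    have "h2 (n 0) * n1 0 * n1 0 + n2 * h1 (n 0) \<le> h0 (n 0) * ((4 * \<kappa>\<^sup>2 + 3 * \<kappa>) * (a\<^sup>2 + b\<^sup>2))"
      using bd(2)[OF ab] unfolding h0_def h1_def h2_def by (simp add: power2_eq_square mult.assoc mult.commute[of n2])
    then show "D2 (p, t) (fld (a, b, 0) (p, t)) (fld (a, b, 0) (p, t)) \<le> exp (C * t) * (h0 (hN p) * ((4 * \<kappa>\<^sup>2 + 3 * \<kappa>) * (a\<^sup>2 + b\<^sup>2)))"
      unfolding line(2) n0[symmetric] by (intro mult_left_mono) auto
  qed
  \<comment> \<open>The field points backwards in time; the contribution of the singular term is
    minus a square and only helps.\<close>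
  have time: "D1 (p, t) (fld (0, 0, - 1) (p, t)) \<le> - C * (exp (C * t) * h0 (hN p))" if t: "t < T" for p t
  proof -
    have pU: "(p, t) \<in> U" using t by (simp add: U_def)
    have g: "V ((p, t) + r *\<^sub>R fld (0, 0, - 1) (p, t)) = exp (C * (t - r)) * h0 (hN p) + inverse (T - t + r)" for r
      by (cases p) (simp add: V_def algebra_simps)
    have g1: "((\<lambda>r. exp (C * (t - r)) * h0 (hN p) + inverse (T - t + r)) has_real_derivative
        - C * exp (C * (t - r)) * h0 (hN p) - (inverse (T - t + r))\<^sup>2) (at r)"
      if "(p, t) + r *\<^sub>R fld (0, 0, - 1) (p, t) \<in> U" for r
    proof -
      have "T - t + r \<noteq> 0" using that by (cases p) (auto simp: U_def)
      then show ?thesis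
        by (auto intro!: derivative_eq_intros simp: power2_eq_square)
    qed
    have g2: "((\<lambda>r. - C * exp (C * (t - r)) * h0 (hN p) - (inverse (T - t + r))\<^sup>2) has_real_derivative
        C * C * exp (C * t) * h0 (hN p) + 2 * (inverse (T - t)) ^ 3) (at 0)"
      using t by (auto intro!: derivative_eq_intros simp: power2_eq_square power3_eq_cube)
    from derivs_along_line(1)[OF D U pU g g1 g2] show ?thesis by simp
  qed
  show ?thesis
  proof (rule that[OF D[unfolded U_def]])
    fix p t assume t: "0 \<le> t" "t < T"
    have C0: "0 \<le> C" using \<kappa> L by (simp add: C_def m_def)
    have h0: "1 \<le> h0 n" for n using \<kappa> by (simp add: h0_def)
    have e1: "1 \<le> exp (C * t)" using C0 t by simp
    have hpos: "1 \<le> exp (C * t) * h0 (hN p)" using mult_mono[OF e1 h0[of "hN p"]] by simp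
    have rt: "root 4 (hN p) = hN p powr (1/4)"
      using root_powr_inverse[of 4 "hN p"] less_imp_le[OF hN0[of p]] by simp
    have inv: "0 < inverse (T - t)" using t by simp
    have V_eq: "V (p, t) = exp (C * t) * h0 (hN p) + inverse (T - t)"
      by (simp add: V_def)
    have "1 * h0 (hN p) \<le> exp (C * t) * h0 (hN p)"
      using e1 h0[of "hN p"] by (intro mult_right_mono) auto
    then have "h0 (hN p) \<le> V (p, t)"
      unfolding V_eq mult_1 using inv by linarith
    then show "exp (\<kappa> * root 4 (hN p)) \<le> V (p, t)"
      unfolding rt h0_def .
    show "1 / (T - t) \<le> V (p, t)"
      using hpos by (simp add: V_def inverse_eq_divide)
    define E where "E = exp (C * t) * h0 (hN p)"
    have E: "1 \<le> E" using hpos by (simp add: E_def)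
    have "norm (hgrad_of D1 (p, t)) \<le> \<bar>D1 (p, t) (fld (1, 0, 0) (p, t))\<bar> + \<bar>D1 (p, t) (fld (0, 1, 0) (p, t))\<bar>"
      using norm_le_l1_cart[of "hgrad_of D1 (p, t)"] by (simp add: hgrad_of_def sum_2)
    also have "\<dots> \<le> 4 * \<kappa> * E"
      using hor(1)[OF t(2), of p 1 0] hor(1)[OF t(2), of p 0 1] by (simp add: E_def algebra_simps)
    finally have "L * norm (hgrad_of D1 (p, t)) \<le> L * (4 * \<kappa> * E)"
      using L by (rule mult_left_mono)
    moreover have "mop (s1, s2, 0) (r1, r2, 0) (0, 0, - 1) D1 D2 (p, t) \<le>
        E * ((4 * \<kappa>\<^sup>2 + 3 * \<kappa>) * (s1\<^sup>2 + s2\<^sup>2)) + E * ((4 * \<kappa>\<^sup>2 + 3 * \<kappa>) * (r1\<^sup>2 + r2\<^sup>2)) - C * E"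
      using hor(2)[OF t(2), of p s1 s2] hor(2)[OF t(2), of p r1 r2] time[OF t(2), of p]
      by (simp add: mop_def E_def mult.assoc)
    moreover have "C * E = E * ((4 * \<kappa>\<^sup>2 + 3 * \<kappa>) * (s1\<^sup>2 + s2\<^sup>2)) + E * ((4 * \<kappa>\<^sup>2 + 3 * \<kappa>) * (r1\<^sup>2 + r2\<^sup>2)) +
        L * (4 * \<kappa> * E) + E"
      by (simp add: C_def m_def algebra_simps)
    ultimately show "1 + L * norm (hgrad_of D1 (p, t)) \<le> - mop (s1, s2, 0) (r1, r2, 0) (0, 0, - 1) D1 D2 (p, t)"
      using E by linarith
  qed
qed

section \<open>The comparison argument\<close>

lemma norm_hinv: "norm (hinv h) = norm h"
  by (cases h) (simp add: norm_Pair)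

text \<open>For fixed \<open>h\<close>, \<open>u\<close> is compared with the average of its two
  translates on a compact cylinder. A positive maximum is excluded at the bottom by the initial
  inequality, on the side by the growth of the weight, and at the top by its singularity. At an
  interior maximum the strictness of the weight contradicts the subsolution inequality.\<close>

lemma h_convexity_at_point:
  fixes A :: "real^2^2"
    and f :: "heis \<Rightarrow> real^2 \<Rightarrow> real"
    and u :: "heis \<times> real \<Rightarrow> real"
  assumes A: "A $ 1 $ 1 = s1\<^sup>2 + r1\<^sup>2" "A $ 1 $ 2 = s1 * s2 + r1 * r2"
      "A $ 2 $ 1 = s1 * s2 + r1 * r2" "A $ 2 $ 2 = s2\<^sup>2 + r2\<^sup>2"
    and L1: "0 \<le> L1" and lip: "\<And>p w1 w2. \<bar>f p w1 - f p w2\<bar> \<le> L1 * norm (w1 - w2)"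
    and A2: "\<forall>\<rho>>0. \<exists>L2>0. \<forall>p q w. norm p \<le> \<rho> \<longrightarrow> norm q \<le> \<rho> \<longrightarrow>
               \<bar>f p w - f q w\<bar> \<le> L2 * gauge_norm (p \<odot> hinv q)"
    and conc: "right_inv_concave f"
    and u_cont: "continuous_on (UNIV \<times> {0..}) u"
    and sub: "viscosity_subsolution A f u" and super: "viscosity_supersolution A f u"
    and growth: "\<forall>T>0. \<exists>k>0. \<exists>C>0. \<forall>p. \<forall>t\<in>{0..T}. \<bar>u (p, t)\<bar> \<le> C * exp (k * japanese p)"
    and h: "h \<in> H0"
    and init: "\<And>p. 2 * u (p, 0) \<le> u (hinv h \<odot> p, 0) + u (h \<odot> p, 0)"
    and t1: "0 < t1"
  shows "2 * u (p1, t1) \<le> u (hinv h \<odot> p1, t1) + u (h \<odot> p1, t1)"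
proof -
  define T where "T = t1 + 1"
  have T: "0 < T" "t1 < T" using t1 by (auto simp: T_def)
  \<comment> \<open>Continuation by the initial value to negative times makes mollification
    available on the whole of space-time; the equation is used only at positive times.\<close>
  define w where "w P = u (fst P, max 0 (snd P))" for P
  have w: "continuous_on UNIV w"
    unfolding w_def by (intro continuous_on_compose2[OF u_cont] continuous_intros) auto
  have wu: "w P = u P" if "0 < snd P" for P
    using that by (cases P) (simp add: w_def)
  define H where "H = (h, 0 :: real)"
  define H' where "H' = (hinv h, 0 :: real)"
  have HP: "gmul H (p, t) = (h \<odot> p, t)" "gmul H' (p, t) = (hinv h \<odot> p, t)" for p t
    by (simp_all add: H_def H'_def gmul_def)
  have nH: "norm H = norm h" "norm H' = norm h"
    by (simp_all add: H_def H'_def norm_Pair norm_hinv)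
  define S where "S P = (w (gmul H' P) + w (gmul H P)) / 2" for P
  have S: "continuous_on UNIV S"
    unfolding S_def by (intro continuous_intros continuous_on_compose2[OF w]) auto
  obtain k C where kC: "0 < k" "0 < C" and gr: "\<And>p t. t \<in> {0..T + 1} \<Longrightarrow> \<bar>u (p, t)\<bar> \<le> C * exp (k * japanese p)"
    using growth[rule_format, of "T + 1"] T by auto
  obtain c1 where c1: "1 \<le> c1" "\<And>k p. norm k \<le> 1 \<Longrightarrow> hN (k \<odot> p) \<le> c1 * hN p"
    using hN_left[of 1] by auto
  obtain c2 where c2: "1 \<le> c2" "\<And>k p. norm k \<le> norm h \<Longrightarrow> hN (k \<odot> p) \<le> c2 * hN p"
    using hN_left[of "norm h"] by auto
  \<comment> \<open>\<open>c1\<close> allows for displacement within the support of the kernel,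
    \<open>c2\<close> for translation by \<open>h\<close> or its inverse. The fourth root of
    \<open>c\<close> then enlarges the growth rate \<open>k\<close> to
    \<open>\<kappa>0\<close>.\<close>
  define c where "c = c1 * c2"
  have c: "1 \<le> c" unfolding c_def using mult_mono[OF c1(1) c2(1)] c1 by simp
  define \<kappa>0 where "\<kappa>0 = k * root 4 c"
  have root_c: "1 \<le> root 4 c" using c by simp
  have \<kappa>0: "0 \<le> \<kappa>0" "k \<le> \<kappa>0"
    using kC root_c mult_left_mono[of 1 "root 4 c" k] by (auto simp: \<kappa>0_def)
  have wgr: "\<bar>w Q\<bar> \<le> C * exp (\<kappa>0 * root 4 (hN p))" if "hN (fst Q) \<le> c * hN p" "snd Q \<le> T + 1" for Q p
  proof -
    have "\<bar>w Q\<bar> \<le> C * exp (k * japanese (fst Q))"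
      unfolding w_def using that T by (intro gr) auto
    also have "\<dots> \<le> C * exp (\<kappa>0 * root 4 (hN p))"
    proof -
      have "japanese (fst Q) \<le> root 4 (hN (fst Q))" by (rule japanese_le_hN)
      also have "\<dots> \<le> root 4 (c * hN p)" using that by simp
      also have "\<dots> = root 4 c * root 4 (hN p)" by (rule real_root_mult)
      finally have "k * japanese (fst Q) \<le> k * (root 4 c * root 4 (hN p))"
        using kC by (intro mult_left_mono) auto
      then show ?thesis using kC by (simp add: \<kappa>0_def mult.assoc)
    qed
    finally show ?thesis .
  qed
  have mol_ge: "- (C * exp (\<kappa>0 * root 4 (hN p))) \<le> mol \<eta> w (gmul X (p, t))"
    if \<eta>: "0 < \<eta>" "\<eta> \<le> 1" and X: "X = H \<or> X = H'" and t: "t \<le> T" for \<eta> X p t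
  proof -
    have "mol \<eta> (\<lambda>Q. - (C * exp (\<kappa>0 * root 4 (hN p)))) (gmul X (p, t)) \<le> mol \<eta> w (gmul X (p, t))"
    proof (rule mol_mono[OF \<eta>(1) continuous_on_const w])
      fix Q
      define K where "K = gmul (gmul X (p, t)) (ginv Q)"
      assume "norm (gmul (gmul X (p, t)) (ginv Q)) < \<eta>"
      then have K: "norm (ginv K) < 1" using \<eta> by (simp add: K_def)
      have Q: "Q = gmul (ginv K) (gmul X (p, t))"
      proof -
        have "gmul (ginv (gmul Y (ginv Q))) Y = Q" for Y
          by (simp add: ginv_gmul gmul_assoc)
        then show ?thesis by (simp only: K_def)
      qed
      have "norm (fst (ginv K)) \<le> 1"
        using K norm_fst_le[of "fst (ginv K)" "snd (ginv K)"] by simp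
      then have "hN (fst Q) \<le> c1 * hN (fst X \<odot> p)"
        using c1(2) by (simp add: Q gmul_def)
      also have "hN (fst X \<odot> p) \<le> c2 * hN p"
        using c2(2)[of h p] c2(2)[of "hinv h" p] X by (auto simp: H_def H'_def norm_hinv)
      finally have hQ: "hN (fst Q) \<le> c * hN p"
        using c1(1) by (simp add: c_def mult.assoc)
      have "\<bar>snd (ginv K)\<bar> \<le> norm (ginv K)"
        using norm_snd_le[of "snd (ginv K)" "fst (ginv K)"] by simp
      then have "snd Q \<le> T + 1"
        using K X t by (auto simp: Q gmul_def H_def H'_def)
      from wgr[OF hQ this] show "- (C * exp (\<kappa>0 * root 4 (hN p))) \<le> w Q" by linarith
    qed
    then show ?thesis by (simp add: mol_const[OF \<eta>(1)])
  qed
  \<comment> \<open>The rate exceeds the growth rate \<open>\<kappa>0\<close> by 1, so that any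
    positive multiple of the weight wins at infinity.\<close>
  obtain V V1 V2 where V: "C2_with (UNIV \<times> {..<T}) V V1 V2"
    and V_exp: "\<And>p t. 0 \<le> t \<Longrightarrow> t < T \<Longrightarrow> exp ((\<kappa>0 + 1) * root 4 (hN p)) \<le> V (p, t)"
    and V_T: "\<And>p t. 0 \<le> t \<Longrightarrow> t < T \<Longrightarrow> 1 / (T - t) \<le> V (p, t)"
    and V_op: "\<And>p t. 0 \<le> t \<Longrightarrow> t < T \<Longrightarrow>
       1 + L1 * norm (hgrad_of V1 (p, t)) \<le> - mop (s1, s2, 0) (r1, r2, 0) (0, 0, - 1) V1 V2 (p, t)"
    by (rule weight_exists[of "\<kappa>0 + 1" L1 T s1 s2 r1 r2]) (use \<kappa>0 L1 in \<open>simp, simp, blast\<close>)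
  have V0: "0 \<le> V (p, t)" if "0 \<le> t" "t < T" for p t
    using V_exp[OF that, of p] exp_ge_zero order_trans by blast
  have key: "u (p1, t1) \<le> S (p1, t1) + \<epsilon> * (V (p1, t1) + 2)" if \<epsilon>: "0 < \<epsilon>" for \<epsilon>
  proof -
    \<comment> \<open>Since \<open>(norm p)\<^sup>2\<close> is at most \<open>hN p\<close>, the
      square here makes the fourth root of \<open>hN p\<close> at least
      \<open>2 * C / \<epsilon>\<close>, and the spare exponential absorbs that factor.\<close>
    define \<rho> where "\<rho> = (2 * C / \<epsilon>)\<^sup>2 + norm p1 + 1"
    have \<rho>: "0 < \<rho>" "norm p1 < \<rho>" by (auto simp: \<rho>_def add_nonneg_pos)
    have far: "2 * (C * exp (\<kappa>0 * root 4 (hN p))) \<le> \<epsilon> * V (p, t)"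
      if p: "\<rho> \<le> norm p" and t: "0 \<le> t" "t < T" for p t
    proof -
      have "((2 * C / \<epsilon>)\<^sup>2)\<^sup>2 \<le> (norm p)\<^sup>2"
        using p by (intro power_mono) (auto simp: \<rho>_def intro: order_trans[rotated])
      also have "\<dots> \<le> hN p" by (rule norm_le_hN)
      finally have "(2 * C / \<epsilon>) ^ 4 \<le> hN p" by (simp flip: power_mult)
      then have "root 4 ((2 * C / \<epsilon>) ^ 4) \<le> root 4 (hN p)" by simp
      then have J: "2 * C / \<epsilon> \<le> root 4 (hN p)"
        using kC \<epsilon> by (simp add: real_root_power_cancel)
      also have "\<dots> \<le> exp (root 4 (hN p))"
        using exp_ge_add_one_self[of "root 4 (hN p)"] by linarith
      finally have "2 * C \<le> \<epsilon> * exp (root 4 (hN p))" using \<epsilon> by (simp add: field_simps)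
      then have "2 * C * exp (\<kappa>0 * root 4 (hN p)) \<le> \<epsilon> * exp (root 4 (hN p)) * exp (\<kappa>0 * root 4 (hN p))"
        by (intro mult_right_mono) auto
      also have "\<dots> = \<epsilon> * exp ((\<kappa>0 + 1) * root 4 (hN p))"
        by (simp add: distrib_right exp_add mult.commute mult.left_commute)
      also have "\<dots> \<le> \<epsilon> * V (p, t)"
        using V_exp[OF t] \<epsilon> by (intro mult_left_mono) auto
      finally show ?thesis by (simp add: mult.assoc)
    qed
    define \<rho>1 where "\<rho>1 = \<rho> + T"
    have \<rho>1: "norm (p, t) \<le> \<rho>1" if "norm p \<le> \<rho>" "0 \<le> t" "t \<le> T" for p :: heis and t
      using norm_Pair_le[of p t] that by (simp add: \<rho>1_def)
    define \<rho>2 where "\<rho>2 = \<rho>1 + norm h * (1 + \<rho>1)"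
    have \<rho>2: "norm (gmul X P) \<le> \<rho>2" if "X = H \<or> X = H'" "norm P \<le> \<rho>1" for X P
    proof -
      have "norm (gmul X P) \<le> norm P + norm (gmul X P - P)" by (rule norm_triangle_sub)
      also have "\<dots> \<le> norm P + norm X * (1 + norm P)"
        using norm_gmul_diff by simp
      also have "\<dots> \<le> \<rho>1 + norm h * (1 + \<rho>1)"
        using that nH by (intro add_mono mult_mono) auto
      finally show ?thesis by (simp add: \<rho>2_def)
    qed
    have \<rho>2_0: "0 \<le> \<rho>2" using \<rho> T by (simp add: \<rho>2_def \<rho>1_def)
    define F where "F = (\<lambda>(r :: real, p). w (p, r) - S (p, r))"
    have F: "continuous_on UNIV F"
      unfolding F_def split_beta
      by (intro continuous_intros continuous_on_compose2[OF w] continuous_on_compose2[OF S]) auto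
    have F0: "F (0, p) \<le> 0" for p
      using init[of p] by (simp add: F_def S_def w_def HP)
    have \<epsilon>2: "0 < \<epsilon> / 2" using \<epsilon> by simp
    obtain \<delta> where \<delta>: "0 < \<delta>" "\<And>r p. norm r < \<delta> \<Longrightarrow> p \<in> cball 0 \<rho> \<Longrightarrow> \<bar>F (r, p) - F (0, p)\<bar> < \<epsilon> / 2"
      using uniform_at_0[OF F compact_cball[of 0 \<rho>] \<epsilon>2] by blast
    \<comment> \<open>The cylinder starts at a positive time: mollification needs room for the
      supersolution property below it, and uniform continuity carries the initial inequality there
      up to \<open>\<epsilon> / 2\<close>.\<close>
    define s where "s = min (\<delta> / 2) (t1 / 2)"
    have s: "0 < s" "s < \<delta>" "s < t1" using \<delta> t1 by (auto simp: s_def)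
    have start: "w (p, s) - S (p, s) \<le> \<epsilon> / 2" if "norm p \<le> \<rho>" for p
    proof -
      have "\<bar>F (s, p) - F (0, p)\<bar> < \<epsilon> / 2" using \<delta>(2)[of s p] s that by simp
      then have "F (s, p) \<le> \<epsilon> / 2" using F0[of p] by linarith
      then show ?thesis by (simp add: F_def)
    qed
    obtain R0 where R0: "0 < R0" "\<And>p q \<zeta>. norm p \<le> \<rho>2 \<Longrightarrow> dist q p < R0 \<Longrightarrow> f q \<zeta> \<le> f p \<zeta> + \<epsilon> / 2"
      using f_modulus[OF A2 \<rho>2_0 \<epsilon>2] by blast
    \<comment> \<open>Balls of radius \<open>R\<close> around points at times from \<open>s\<close>
      on stay in positive times, and \<open>f\<close> increases there by at most
      \<open>\<epsilon> / 2\<close>.\<close>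
    define R where "R = min R0 s"
    have R: "0 < R" "R \<le> R0" "R \<le> s" using R0 s by (auto simp: R_def)
    obtain \<eta>0 where \<eta>0: "0 < \<eta>0" "\<And>\<eta> P. 0 < \<eta> \<Longrightarrow> \<eta> < \<eta>0 \<Longrightarrow> norm P \<le> \<rho>2 \<Longrightarrow> \<bar>mol \<eta> w P - w P\<bar> \<le> \<epsilon> / 2"
      using mol_uniform[OF w \<epsilon>2, of \<rho>2] by blast
    \<comment> \<open>Three demands: at most 1 for the growth bound \<open>mol_ge\<close>, below
      \<open>\<eta>0\<close> for uniform closeness to \<open>w\<close>, and small enough for the
      kernel to stay within \<open>R / 2\<close>.\<close>
    define \<eta> where "\<eta> = min (min 1 (\<eta>0 / 2)) (R / 2 / (1 + \<rho>2))"
    have \<eta>: "0 < \<eta>" "\<eta> \<le> 1" "\<eta> < \<eta>0" using \<eta>0 R \<rho>2_0 by (auto simp: \<eta>_def min_less_iff_disj)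
    have \<eta>R: "\<eta> * (1 + norm P) \<le> R / 2" if "norm P \<le> \<rho>2" for P :: "heis \<times> real"
    proof -
      have "\<eta> * (1 + norm P) \<le> (R / 2 / (1 + \<rho>2)) * (1 + \<rho>2)"
        using that R \<rho>2_0 by (intro mult_mono) (auto simp: \<eta>_def)
      also have "\<dots> = R / 2"
      proof -
        have "x \<noteq> 0 \<Longrightarrow> R / 2 / x * x = R / 2" for x :: real by simp
        then show ?thesis using \<rho>2_0 by (metis add_nonneg_eq_0_iff zero_le_one zero_neq_one)
      qed
      finally show ?thesis .
    qed
    define U where "U = mol \<eta> w"
    obtain D1 D2 where D: "C2_with (ball 0 (\<rho>2 + 1)) U D1 D2"
      unfolding U_def by (rule mol_C2[OF \<eta>(1) w])
    have U_super: "- (\<epsilon> / 2) \<le> - mop (s1, s2, 0) (r1, r2, 0) (0, 0, - 1) D1 D2 P + f (fst P) (hgrad_of D1 P)"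
      if P: "norm P \<le> \<rho>2" "s \<le> snd P" for P
    proof (rule approx_supersolution[OF super A lip conc w wu])
      show "0 < R / 2" "R / 2 < R" "R \<le> snd P" "0 < \<eta>" using R P \<eta> by auto
      show "\<eta> * (1 + norm P) \<le> R / 2" by (rule \<eta>R[OF P(1)])
      show "C2_with (ball 0 (\<rho>2 + 1)) (mol \<eta> w) D1 D2" using D by (simp add: U_def)
      show "open (ball (0 :: heis \<times> real) (\<rho>2 + 1))" by simp
      show "P \<in> ball 0 (\<rho>2 + 1)" using P by simp
      fix q \<zeta> assume "dist q (fst P) < R"
      moreover have "norm (fst P) \<le> \<rho>2"
        using P norm_fst_le[of "fst P" "snd P"] by simp
      ultimately show "f q \<zeta> \<le> f (fst P) \<zeta> + \<epsilon> / 2"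
        using R0(2) R by simp
    qed
    obtain E1 E2 where E: "C2_with (gmul H -` ball 0 (\<rho>2 + 1)) (\<lambda>P. U (gmul H P)) E1 E2"
      and E_mop: "\<And>g1 g2 g3 P. mop g1 g2 g3 E1 E2 P = mop g1 g2 g3 D1 D2 (gmul H P)"
      and E_grad: "\<And>P. hgrad_of E1 P = hgrad_of D1 (gmul H P)"
      by (rule C2_with_left[OF D, of H]) blast
    obtain E1' E2' where E': "C2_with (gmul H' -` ball 0 (\<rho>2 + 1)) (\<lambda>P. U (gmul H' P)) E1' E2'"
      and E_mop': "\<And>g1 g2 g3 P. mop g1 g2 g3 E1' E2' P = mop g1 g2 g3 D1 D2 (gmul H' P)"
      and E_grad': "\<And>P. hgrad_of E1' P = hgrad_of D1 (gmul H' P)"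
      by (rule C2_with_left[OF D, of H']) blast
    \<comment> \<open>The final \<open>\<epsilon>\<close> covers the defect
      \<open>\<epsilon> / 2\<close> at the starting time and the mollification error
      \<open>\<epsilon> / 2\<close>.\<close>
    define \<phi> where "\<phi> P = 1/2 * U (gmul H' P) + 1/2 * U (gmul H P) + \<epsilon> * V P + \<epsilon>" for P
    define O1 where "O1 = gmul H -` ball 0 (\<rho>2 + 1) \<inter> gmul H' -` ball 0 (\<rho>2 + 1) \<inter> UNIV \<times> {..<T}"
    have O1: "open O1"
      unfolding O1_def
      by (intro open_Int open_vimage open_Times) (auto intro!: continuous_intros)
    define P1 where "P1 P = (1/2) *\<^sub>R E1' P + (1/2) *\<^sub>R E1 P + \<epsilon> *\<^sub>R V1 P + 0" for P
    define P2 where "P2 P = (1/2) *\<^sub>R E2' P + (1/2) *\<^sub>R E2 P + \<epsilon> *\<^sub>R V2 P + 0" for P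
    have \<phi>C2: "C2_with O1 \<phi> P1 P2"
      unfolding \<phi>_def P1_def P2_def
      by (intro C2_with_add C2_with_scale C2_with_const C2_with_subset[OF E] C2_with_subset[OF E']
          C2_with_subset[OF V]) (auto simp: O1_def)
    have in_O1: "(p, t) \<in> O1" if "norm p \<le> \<rho>" "0 \<le> t" "t < T" for p t
      using \<rho>2[of H "(p, t)"] \<rho>2[of H' "(p, t)"] \<rho>1[of p t] that by (simp add: O1_def)
    define \<Psi> where "\<Psi> P = w P - \<phi> P" for P
    have US: "\<bar>(1/2 * U (gmul H' P) + 1/2 * U (gmul H P)) - S P\<bar> \<le> \<epsilon> / 2" if "norm P \<le> \<rho>1" for P
    proof -
      have "\<bar>U (gmul H' P) - w (gmul H' P)\<bar> \<le> \<epsilon> / 2" "\<bar>U (gmul H P) - w (gmul H P)\<bar> \<le> \<epsilon> / 2"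
        unfolding U_def using \<eta>0(2)[OF \<eta>(1,3)] \<rho>2 that by auto
      then show ?thesis unfolding S_def add_divide_distrib by linarith
    qed
    have "\<Psi> (p1, t1) \<le> 0"
    proof (rule ccontr)
      assume "\<not> \<Psi> (p1, t1) \<le> 0"
      then have pos: "0 < \<Psi> (p1, t1)" by simp
      define D0 where "D0 P = w P - (1/2 * U (gmul H' P) + 1/2 * U (gmul H P))" for P
      have Uc: "continuous_on UNIV U" unfolding U_def by (rule mol_continuous[OF \<eta>(1) w])
      have UX: "continuous_on UNIV (\<lambda>P. U (gmul X P))" for X
        by (rule continuous_on_compose2[OF Uc]) (auto intro!: continuous_intros)
      have "continuous_on UNIV D0"
        unfolding D0_def by (intro continuous_on_diff continuous_on_add continuous_on_mult continuous_on_const w UX)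
      then have "compact (D0 ` (cball 0 \<rho> \<times> {0..T}))"
        by (intro compact_continuous_image[OF continuous_on_subset compact_Times[OF compact_cball compact_Icc]]) auto
      then obtain M where M0: "\<forall>y\<in>D0 ` (cball 0 \<rho> \<times> {0..T}). norm y \<le> M"
        using compact_imp_bounded bounded_iff by metis
      have M: "\<bar>w P - (1/2 * U (gmul H' P) + 1/2 * U (gmul H P))\<bar> \<le> M" if "P \<in> cball 0 \<rho> \<times> {0..T}" for P
        using M0[rule_format, OF imageI[OF that]] by (simp only: D0_def real_norm_def)
      define M' where "M' = max 1 M"
      have M': "0 < M'" "M \<le> M'" by (auto simp: M'_def)
      \<comment> \<open>From this time on the singular term contributes at least
        \<open>\<epsilon> / (T - t)\<close>, hence at least \<open>M'\<close>, which exceeds the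
        difference to be dominated.\<close>
      define T' where "T' = T - \<epsilon> / M'"
      have T': "T' < T" using M' \<epsilon> by (simp add: T'_def)
      have late: "\<Psi> (p, t) \<le> 0" if p: "norm p \<le> \<rho>" and t: "0 \<le> t" "T' \<le> t" "t < T" for p t
      proof -
        have "T - t \<le> \<epsilon> / M'" using t by (simp add: T'_def)
        then have "M' \<le> \<epsilon> * (1 / (T - t))"
          using t M' \<epsilon> by (simp add: field_simps)
        also have "\<dots> \<le> \<epsilon> * V (p, t)"
          using V_T[OF t(1,3), of p] \<epsilon> by (intro mult_left_mono) auto
        finally have "M \<le> \<epsilon> * V (p, t)" using M' by simp
        moreover have "(p, t) \<in> cball 0 \<rho> \<times> {0..T}" using p t by simp
        ultimately show ?thesis
          using M[of "(p, t)"] \<epsilon> unfolding \<Psi>_def \<phi>_def by linarith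
      qed
      have t1': "t1 < T'" using late[of p1 t1] pos t1 T \<rho> by force
      define X where "X = cball (0 :: heis) \<rho> \<times> {s..T'}"
      have X: "compact X" unfolding X_def by (intro compact_Times) auto
      have X1: "(p1, t1) \<in> X" using \<rho> s t1' by (simp add: X_def)
      have XO: "X \<subseteq> O1"
        unfolding X_def using in_O1 s T' by (auto simp: mem_cball_0)
      have "continuous_on X \<Psi>"
        unfolding \<Psi>_def
        by (intro continuous_intros continuous_on_subset[OF w] continuous_on_subset[OF C2_withD(5)[OF \<phi>C2] XO]) auto
      then obtain Y where Y: "Y \<in> X" and Ymax: "\<And>Q. Q \<in> X \<Longrightarrow> \<Psi> Q \<le> \<Psi> Y"
        using continuous_attains_sup[OF X] X1 by blast
      obtain p t where pt: "Y = (p, t)" by (cases Y)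
      have Ypos: "0 < \<Psi> (p, t)" using Ymax[OF X1] pos pt by simp
      have p: "norm p \<le> \<rho>" and t: "s \<le> t" "t \<le> T'"
        using Y by (auto simp: X_def pt)
      have t0: "0 < t" "t < T" using t s T' by auto
      have p': "norm p < \<rho>"
      proof (rule ccontr)
        assume "\<not> norm p < \<rho>"
        then have "2 * (C * exp (\<kappa>0 * root 4 (hN p))) \<le> \<epsilon> * V (p, t)"
          using far[of p t] t0 by simp
        moreover have "w (p, t) \<le> C * exp (\<kappa>0 * root 4 (hN p))"
        proof -
          have "1 * hN p \<le> c * hN p" using c hN_ge_1[of p] by (intro mult_right_mono) auto
          then show ?thesis using wgr[of "(p, t)" p] t0 by simp
        qed
        moreover have "- (C * exp (\<kappa>0 * root 4 (hN p))) \<le> U (gmul H' (p, t))"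
          "- (C * exp (\<kappa>0 * root 4 (hN p))) \<le> U (gmul H (p, t))"
          unfolding U_def using mol_ge[OF \<eta>(1,2)] t0 by auto
        ultimately have "\<Psi> (p, t) \<le> 0"
          using \<epsilon> unfolding \<Psi>_def \<phi>_def by linarith
        with Ypos show False by simp
      qed
      have t_T': "t < T'" using late[of p t] Ypos p t t0 by force
      have t_s: "s < t"
      proof (rule ccontr)
        assume "\<not> s < t"
        then have ts: "t = s" using t by simp
        have "w (p, t) - S (p, t) \<le> \<epsilon> / 2" unfolding ts by (rule start[OF p])
        moreover have "\<bar>(1/2 * U (gmul H' (p, t)) + 1/2 * U (gmul H (p, t))) - S (p, t)\<bar> \<le> \<epsilon> / 2"
          using US \<rho>1 p t0 by simp
        moreover have "0 \<le> \<epsilon> * V (p, t)" using \<epsilon> V0[of t p] t0 by simp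
        ultimately have "\<Psi> (p, t) \<le> 0"
          unfolding \<Psi>_def \<phi>_def by linarith
        with Ypos show False by simp
      qed
      have "\<forall>\<^sub>F Q in nhds (p, t). Q \<in> ball 0 \<rho> \<times> {s<..<T'}"
        by (rule eventually_nhds_in_open) (use p' t_s t_T' in \<open>auto intro!: open_Times\<close>)
      then have "\<forall>\<^sub>F Q in nhds (p, t). u Q - \<phi> Q \<le> u (p, t) - \<phi> (p, t)"
      proof eventually_elim
        case (elim Q)
        then have "Q \<in> X" by (auto simp: X_def)
        then have "\<Psi> Q \<le> \<Psi> (p, t)" using Ymax pt by simp
        moreover have "0 < snd Q" using elim s by auto
        ultimately show ?case
          using wu[of Q] wu[of "(p, t)"] t0 by (simp add: \<Psi>_def)
      qed
      moreover have O1pt: "(p, t) \<in> O1" using in_O1 p t0 by simp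
      moreover have "(p, t) \<in> space_time" using t0 by simp
      ultimately have "parabolic_op A f \<phi> p t \<le> 0"
        using sub C2_with_near[OF \<phi>C2 O1 O1pt] unfolding viscosity_subsolution_def by blast
      then have le0: "- mop (s1, s2, 0) (r1, r2, 0) (0, 0, - 1) P1 P2 (p, t) + f p (hgrad_of P1 (p, t)) \<le> 0"
        unfolding parabolic_op_eq[OF \<phi>C2 O1 O1pt A] .
      let ?m = "mop (s1, s2, 0) (r1, r2, 0) (0, 0, - 1)"
      let ?\<xi> = "hgrad_of D1 (gmul H' (p, t))" and ?\<zeta> = "hgrad_of D1 (gmul H (p, t))"
      let ?v = "hgrad_of V1 (p, t)"
      have m: "?m P1 P2 (p, t) = 1/2 * ?m D1 D2 (gmul H' (p, t)) + 1/2 * ?m D1 D2 (gmul H (p, t)) + \<epsilon> * ?m V1 V2 (p, t)"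
        unfolding E_mop[symmetric] E_mop'[symmetric]
        by (simp add: mop_def P1_def P2_def blinfun.bilinear_simps algebra_simps)
      have g: "hgrad_of P1 (p, t) = (1/2) *\<^sub>R (?\<xi> + ?\<zeta>) + \<epsilon> *\<^sub>R ?v"
        unfolding E_grad[symmetric] E_grad'[symmetric]
        by (simp add: vec_eq_iff forall_2 hgrad_of_def P1_def blinfun.bilinear_simps algebra_simps)
      have "norm (gmul H' (p, t)) \<le> \<rho>2" "norm (gmul H (p, t)) \<le> \<rho>2"
        using \<rho>2 \<rho>1[of p t] p t0 by auto
      then have "- (\<epsilon> / 2) \<le> - ?m D1 D2 (gmul H' (p, t)) + f (hinv h \<odot> p) ?\<xi>"
        "- (\<epsilon> / 2) \<le> - ?m D1 D2 (gmul H (p, t)) + f (h \<odot> p) ?\<zeta>"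
        using U_super[of "gmul H' (p, t)"] U_super[of "gmul H (p, t)"] t by (simp_all add: HP)
      moreover have "f (hinv h \<odot> p) ?\<xi> + f (h \<odot> p) ?\<zeta> \<le> 2 * f p ((1/2) *\<^sub>R (?\<xi> + ?\<zeta>))"
        using conc h unfolding right_inv_concave_def by blast
      moreover have "f p ((1/2) *\<^sub>R (?\<xi> + ?\<zeta>)) - L1 * (\<epsilon> * norm ?v) \<le> f p (hgrad_of P1 (p, t))"
        using lip[of p "(1/2) *\<^sub>R (?\<xi> + ?\<zeta>)" "hgrad_of P1 (p, t)"] \<epsilon> unfolding g by simp
      moreover have "\<epsilon> * (1 + L1 * norm ?v) \<le> \<epsilon> * (- ?m V1 V2 (p, t))"
        using V_op[of t p] t0 \<epsilon> by (intro mult_left_mono) auto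
      moreover have "\<epsilon> * (1 + L1 * norm ?v) = \<epsilon> + L1 * (\<epsilon> * norm ?v)" "\<epsilon> * (- ?m V1 V2 (p, t)) = - (\<epsilon> * ?m V1 V2 (p, t))"
        by (simp_all add: algebra_simps)
      \<comment> \<open>The balance: the two mollified inequalities cost
        \<open>\<epsilon> / 2\<close> on average, concavity merges the two values of
        \<open>f\<close>, and the weight gains \<open>\<epsilon>\<close> beyond the Lipschitz error.
        The operator at the maximum is thus at least \<open>\<epsilon> / 2\<close>.\<close>
      ultimately show False
        using le0 \<epsilon> unfolding m by linarith
    qed
    moreover have "\<bar>(1/2 * U (gmul H' (p1, t1)) + 1/2 * U (gmul H (p1, t1))) - S (p1, t1)\<bar> \<le> \<epsilon> / 2"
      using US \<rho>1 \<rho> t1 T by simp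
    moreover have "u (p1, t1) = w (p1, t1)" using wu t1 by simp
    \<comment> \<open>One \<open>\<epsilon>\<close> is the constant in \<open>\<phi>\<close>; the
      other covers the mollification error.\<close>
    moreover have "\<epsilon> * (V (p1, t1) + 2) = \<epsilon> * V (p1, t1) + 2 * \<epsilon>" by (simp add: algebra_simps)
    ultimately show ?thesis
      using \<epsilon> unfolding \<Psi>_def \<phi>_def by linarith
  qed
  have "u (p1, t1) \<le> S (p1, t1)"
  proof (rule field_le_epsilon)
    fix e :: real assume e: "0 < e"
    have K: "0 < V (p1, t1) + 2" using V0[of t1 p1] t1 T by simp
    show "u (p1, t1) \<le> S (p1, t1) + e"
      using key[of "e / (V (p1, t1) + 2)"] e K by simp
  qed
  then show ?thesis
    using t1 by (simp add: S_def HP w_def)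
qed

theorem theorem5p3:
  fixes A :: "real^2^2"
    and f :: "heis \<Rightarrow> real^2 \<Rightarrow> real"
    and u :: "heis \<times> real \<Rightarrow> real"
    and u0 :: "heis \<Rightarrow> real"
  assumes A_sym: "transpose A = A"
    and A_psd: "\<forall>v. 0 \<le> v \<bullet> (A *v v)"
    and A1: "\<exists>L1>0. \<forall>p w1 w2. \<bar>f p w1 - f p w2\<bar> \<le> L1 * norm (w1 - w2)"
    and A2: "\<forall>\<rho>>0. \<exists>L2>0. \<forall>p q w. norm p \<le> \<rho> \<longrightarrow> norm q \<le> \<rho> \<longrightarrow>
               \<bar>f p w - f q w\<bar> \<le> L2 * gauge_norm (p \<odot> hinv q)"
    and A3: "\<exists>C>0. \<forall>p \<xi>. \<bar>f p \<xi>\<bar> \<le> C * (1 + norm \<xi>)"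
    and u_cont: "continuous_on (UNIV \<times> {0..}) u"
    and u_sol: "viscosity_solution A f u"
    and u_init: "\<forall>p. u (p, 0) = u0 p"
    and growth: "\<forall>T>0. \<exists>k>0. \<exists>C>0. \<forall>p. \<forall>t\<in>{0..T}. \<bar>u (p, t)\<bar> \<le> C * exp (k * japanese p)"
    and f_concave: "right_inv_concave f"
    and u0_convex: "right_inv_h_convex u0"
  shows "\<forall>t\<ge>0. right_inv_h_convex (\<lambda>p. u (p, t))"
proof (intro allI impI)
  fix t :: real assume t: "0 \<le> t"
  obtain s1 s2 r1 r2 where A: "A $ 1 $ 1 = s1\<^sup>2 + r1\<^sup>2" "A $ 1 $ 2 = s1 * s2 + r1 * r2"
      "A $ 2 $ 1 = s1 * s2 + r1 * r2" "A $ 2 $ 2 = s2\<^sup>2 + r2\<^sup>2"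
    by (rule psd_2x2_decomposition[OF A_sym A_psd])
  obtain L1 where L1: "0 < L1" "\<And>p w1 w2. \<bar>f p w1 - f p w2\<bar> \<le> L1 * norm (w1 - w2)"
    using A1 by blast
  have sub: "viscosity_subsolution A f u" and super: "viscosity_supersolution A f u"
    using u_sol by (auto simp: viscosity_solution_def)
  have init: "2 * u (p, 0) \<le> u (hinv h \<odot> p, 0) + u (h \<odot> p, 0)" if "h \<in> H0" for h p
    using u0_convex that unfolding right_inv_h_convex_def u_init[rule_format] by blast
  have "2 * u (p, t) \<le> u (hinv h \<odot> p, t) + u (h \<odot> p, t)" if h: "h \<in> H0" for h p
  proof (cases "t = 0")
    case True
    then show ?thesis using init[OF h] by simp
  next
    case False
    then have "0 < t" using t by simp
    then show ?thesis
      using h_convexity_at_point[OF A less_imp_le[OF L1(1)] L1(2) A2 f_concave u_cont sub super growth h init[OF h]]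
      by blast
  qed
  moreover have "usc_on UNIV (\<lambda>p. u (p, t))"
    unfolding usc_on_def
  proof (intro ballI allI impI)
    fix p c assume "u (p, t) < c"
    moreover have "continuous_on UNIV (\<lambda>p. u (p, t))"
      by (intro continuous_on_compose2[OF u_cont] continuous_intros) (use t in auto)
    then have "isCont (\<lambda>p. u (p, t)) p"
      using continuous_on_eq_continuous_at[OF open_UNIV] by blast
    then have "((\<lambda>p. u (p, t)) \<longlongrightarrow> u (p, t)) (at p)"
      by (simp only: isCont_def)
    ultimately show "\<forall>\<^sub>F q in at p. u (q, t) < c"
      by (simp add: order_tendstoD(2))
  qed
  ultimately show "right_inv_h_convex (\<lambda>p. u (p, t))"
    unfolding right_inv_h_convex_def by blast
qed

end
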